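(* Let $E$ be a finite directed graph, let $K$ be a field, and let $L_K(E)$ be the Leavitt path algebra of $E$ with coefficients in $K$. Then the Dixmier-Moeglin equivalence holds for prime ideals of $L_K(E)$; that is, for every prime ideal $P$ of $L_K(E)$ the following conditions are equivalent: (1) $P$ is primitive; (2) $P$ is rational; (3) $P$ is locally closed in $\mathrm{Spec}(L_K(E))$.
   Context: Directed graphs. A directed graph $E=(E^0,E^1,r,s)$ consists of a set $E^0$ of vertices, a set $E^1$ of edges, and maps $r,s:E^1\to E^0$ (range and source); loops and parallel edges are allowed. $E$ is finite if $E^0$ and $E^1$ are both finite; it is row-finite if $s^{-1}(v)$ is finite for every $v\in E^0$. Leavitt path algebras. For a row-finite graph $E$ and a field $K$, $L_K(E)$ is the (associative, possibly non-unital; unital if $E^0$ is finite) $K$-algebra generated by a set $\{v\mid v\in E^0\}$ of pairwise orthogonal idempotents together with a set of variables $\{e,e^*\mid e\in E^1\}$, subject to the relations: (1) $s(e)e=er(e)=e$ for all $e\in E^1$; (2) $r(e)e^*=e^*s(e)=e^*$ for all $e\in E^1$; (3) $e^*e'=\delta_{e,e'}r(e)$ for all $e,e'\in E^1$; (4) $v=\sum_{e\in E^1,\, s(e)=v}ee^*$ for every $v\in E^0$ with $s^{-1}(v)\neq\emptyset$. Properties of prime ideals. Let $A$ be a $K$-algebra. $\mathrm{Spec}(A)$ is the set of (proper two-sided) prime ideals of $A$ with the Zariski topology. An ideal $P$ is primitive if it is the annihilator of a simple right $A$-module. A prime ideal $P$ is locally closed if $\{P\}$ is open in the closure of $\{P\}$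 in $\mathrm{Spec}(A)$; equivalently, the intersection of all prime ideals of $A$ properly containing $P$ strictly contains $P$ (an empty intersection being $A$). Rationality. For a prime $K$-algebra $A$, the (right) Martindale ring of quotients $\mathrm{Frac}(A)$ is the set of equivalence classes of pairs $(I,f)$, where $I$ is a nonzero two-sided ideal of $A$ and $f:I\to A$ is a right $A$-module homomorphism; $(I,f)$ and $(J,g)$ are equivalent if $f=g$ on $I\cap J$. Addition and multiplication are $(I,f)+(J,g)=(I\cap J,f+g)$ and $(I,f)\cdot(J,g)=(JI,f\circ g)$. The extended centroid $C(A)$ is the center $Z(\mathrm{Frac}(A))$; it is a field extension of $K$ and consists precisely of the classes of pairs $(I,f)$ with $f:I\to A$ an $(A,A)$-bimodule homomorphism. A prime ideal $P$ of a $K$-algebra $A$ is rational if $C(A/P)$ is an algebraic extension of $K$. *)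

theory Defs
  imports
    "HOL-Algebra.Finite_Extensions"
    "HOL-Algebra.Ideal_Product"
    "HOL-Analysis.Abstract_Topology"
    "Graph_Theory.Digraph"
begin

section \<open>Free algebras and Leavitt path algebras\<close>

text \<open>
  A \<open>K\<close>-algebra is a \<^typ>\<open>('k, 'a) module\<close>: the ring structure on \<^typ>\<open>'a\<close> together with the
  scalar multiplication by elements of \<open>K\<close>.

  The free unital algebra on an alphabet \<open>S\<close> consists of the finitely supported functions on the
  words over \<open>S\<close>; the product is convolution with respect to concatenation, every factorisation
  of a word \<open>w\<close> being \<open>take i w @ drop i w\<close> for exactly one \<open>i \<le> length w\<close>.
\<close>

definition convolution ::
  "('k, 'm) ring_scheme \<Rightarrow> ('x list \<Rightarrow> 'k) \<Rightarrow> ('x list \<Rightarrow> 'k) \<Rightarrow> 'x list \<Rightarrow> 'k" where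
  "convolution K f g w = (\<Oplus>\<^bsub>K\<^esub>i\<in>{..length w}. f (take i w) \<otimes>\<^bsub>K\<^esub> g (drop i w))"

definition free_algebra :: "('k, 'm) ring_scheme \<Rightarrow> 'x set \<Rightarrow> ('k, 'x list \<Rightarrow> 'k) module" where
  "free_algebra K S =
     \<lparr>carrier = {f. (\<forall>w. f w \<in> carrier K) \<and> finite {w. f w \<noteq> \<zero>\<^bsub>K\<^esub>} \<and> {w. f w \<noteq> \<zero>\<^bsub>K\<^esub>} \<subseteq> lists S},
      mult = convolution K,
      one = (\<lambda>w. if w = [] then \<one>\<^bsub>K\<^esub> else \<zero>\<^bsub>K\<^esub>),
      zero = (\<lambda>w. \<zero>\<^bsub>K\<^esub>),
      add = (\<lambda>f g w. f w \<oplus>\<^bsub>K\<^esub> g w),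
      smult = (\<lambda>c f w. c \<otimes>\<^bsub>K\<^esub> f w)\<rparr>"

context cring
begin

lemma convolution_closed:
  assumes "\<And>w. f w \<in> carrier R" "\<And>w. g w \<in> carrier R"
  shows "convolution R f g w \<in> carrier R"
  unfolding convolution_def using assms by (intro finsum_closed) auto

lemma convolution_Nil:
  assumes "\<And>w. f w \<in> carrier R" "\<And>w. g w \<in> carrier R"
  shows "convolution R f g [] = f [] \<otimes> g []"
  using assms by (simp add: convolution_def)

lemma convolution_Cons:
  assumes "\<And>w. f w \<in> carrier R" "\<And>w. g w \<in> carrier R"
  shows "convolution R f g (x # w) = convolution R (\<lambda>u. f (x # u)) g w \<oplus> f [] \<otimes> g (x # w)"
  using assms by (simp add: convolution_def finsum_Suc2 del: finsum_Suc)

lemma convolution_add_left: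
  assumes "\<And>w. f w \<in> carrier R" "\<And>w. g w \<in> carrier R" "\<And>w. h w \<in> carrier R"
  shows "convolution R (\<lambda>u. f u \<oplus> g u) h w = convolution R f h w \<oplus> convolution R g h w"
  unfolding convolution_def using assms by (subst finsum_addf[symmetric]) (auto simp: l_distr)

lemma convolution_add_right:
  assumes "\<And>w. f w \<in> carrier R" "\<And>w. g w \<in> carrier R" "\<And>w. h w \<in> carrier R"
  shows "convolution R h (\<lambda>u. f u \<oplus> g u) w = convolution R h f w \<oplus> convolution R h g w"
  unfolding convolution_def using assms by (subst finsum_addf[symmetric]) (auto simp: r_distr)

lemma convolution_smult_left:
  assumes "\<And>w. f w \<in> carrier R" "\<And>w. g w \<in> carrier R" "c \<in> carrier R"
  shows "convolution R (\<lambda>u. c \<otimes> f u) g w = c \<otimes> convolution R f g w"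
  unfolding convolution_def using assms
  by (subst finsum_rdistr) (auto simp: m_assoc intro!: finsum_cong')

lemma convolution_assoc:
  assumes "\<And>w. f w \<in> carrier R" "\<And>w. g w \<in> carrier R" "\<And>w. h w \<in> carrier R"
  shows "convolution R (convolution R f g) h w = convolution R f (convolution R g h) w"
  using assms
proof (induction w arbitrary: f)
  case Nil
  then show ?case by (simp add: convolution_Nil convolution_closed m_assoc)
next
  case (Cons x w)
  note cl [simp] = Cons.prems convolution_closed
  show ?case
    using Cons.IH[of "\<lambda>u. f (x # u)"]
    by (simp add: convolution_Cons convolution_Nil convolution_add_left convolution_smult_left
        r_distr a_assoc m_assoc)
qed

lemma convolution_append:
  assumes "\<And>w. g w \<in> carrier R" "c \<in> carrier R"
  shows "convolution R (\<lambda>w. if w = u then c else \<zero>) g w =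
    (if take (length u) w = u then c \<otimes> g (drop (length u) w) else \<zero>)"
proof (induction u arbitrary: w)
  case Nil
  have "convolution R (\<lambda>w. if w = [] then c else \<zero>) g w =
      (\<Oplus>i\<in>{..length w}. if 0 = i then c \<otimes> g (drop i w) else \<zero>)"
    unfolding convolution_def using assms by (intro finsum_cong') auto
  also have "\<dots> = c \<otimes> g w"
    using assms by (subst finsum_singleton) auto
  finally show ?case by simp
next
  case (Cons x u)
  note [simp] = assms convolution_closed
  have [simp]: "convolution R (\<lambda>u. \<zero>) g w = \<zero>" for w
    by (simp add: convolution_def finsum_zero)
  show ?case
  proof (cases w)
    case Nil
    then show ?thesis by (simp add: convolution_Nil)
  next
    case (Cons y v)
    then show ?thesis
      using Cons.IH[of v] by (cases "y = x") (simp_all add: convolution_Cons)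
  qed
qed

lemma convolution_one_right:
  assumes "\<And>w. f w \<in> carrier R"
  shows "convolution R f (\<lambda>w. if w = [] then \<one> else \<zero>) w = f w"
proof -
  have "convolution R f (\<lambda>w. if w = [] then \<one> else \<zero>) w =
      (\<Oplus>i\<in>{..length w}. if length w = i then f w else \<zero>)"
    unfolding convolution_def using assms by (intro finsum_cong') auto
  also have "\<dots> = f w"
    using assms by (subst finsum_singleton) auto
  finally show ?thesis .
qed

lemma convolution_nonzeroE:
  assumes "\<And>w. f w \<in> carrier R" "\<And>w. g w \<in> carrier R" "convolution R f g w \<noteq> \<zero>"
  obtains u v where "w = u @ v" "f u \<noteq> \<zero>" "g v \<noteq> \<zero>"
proof -
  have "\<exists>i\<le>length w. f (take i w) \<noteq> \<zero> \<and> g (drop i w) \<noteq> \<zero>"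
  proof (rule ccontr)
    assume "\<not> ?thesis"
    then have "convolution R f g w = (\<Oplus>i\<in>{..length w}. \<zero>)"
      unfolding convolution_def using assms(1,2) by (intro finsum_cong') force+
    then show False using assms(3) by (simp add: finsum_zero)
  qed
  then show ?thesis using that by (metis append_take_drop_id)
qed

lemma ring_free_algebra: "ring (free_algebra R S)" (is "ring ?F")
proof -
  have D: "f w \<in> carrier R" "finite {w. f w \<noteq> \<zero>}" "f w \<noteq> \<zero> \<Longrightarrow> w \<in> lists S"
    if "f \<in> carrier ?F" for f w
    using that by (auto simp: free_algebra_def)
  have I: "f \<in> carrier ?F"
    if "\<And>w. f w \<in> carrier R" "finite {w. f w \<noteq> \<zero>}" "\<And>w. f w \<noteq> \<zero> \<Longrightarrow> w \<in> lists S" for f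
    using that by (fastforce simp: free_algebra_def)
  have add: "(\<lambda>w. f w \<oplus> g w) \<in> carrier ?F" if "f \<in> carrier ?F" "g \<in> carrier ?F" for f g
  proof (rule I)
    show "finite {w. f w \<oplus> g w \<noteq> \<zero>}"
      by (rule finite_subset[OF _ finite_UnI[OF D(2)[OF that(1)] D(2)[OF that(2)]]])
        auto
    show "w \<in> lists S" if "f w \<oplus> g w \<noteq> \<zero>" for w
      using D(3)[OF \<open>f \<in> _\<close>, of w] D(3)[OF \<open>g \<in> _\<close>, of w] D(1)[OF \<open>g \<in> _\<close>, of w] that
      by (cases "f w = \<zero>") auto
  qed (use that D in auto)
  have mult: "convolution R f g \<in> carrier ?F" if fg: "f \<in> carrier ?F" "g \<in> carrier ?F" for f g
  proof (rule I)
    note E = convolution_nonzeroE[OF D(1)[OF fg(1)] D(1)[OF fg(2)]]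
    have "{w. convolution R f g w \<noteq> \<zero>} \<subseteq>
        (\<lambda>(u, v). u @ v) ` ({w. f w \<noteq> \<zero>} \<times> {w. g w \<noteq> \<zero>})"
      by (force elim!: E)
    then show "finite {w. convolution R f g w \<noteq> \<zero>}"
      by (rule finite_subset) (use D(2) fg in auto)
    show "w \<in> lists S" if "convolution R f g w \<noteq> \<zero>" for w
      using that by (elim E) (use D(3) fg in \<open>fastforce\<close>)
  qed (use fg D in \<open>auto intro!: convolution_closed\<close>)
  have neg: "(\<lambda>w. \<ominus> f w) \<in> carrier ?F" if "f \<in> carrier ?F" for f
  proof (rule I)
    show "finite {w. \<ominus> f w \<noteq> \<zero>}"
      by (rule finite_subset[OF _ D(2)[OF that]]) auto
    show "w \<in> lists S" if "\<ominus> f w \<noteq> \<zero>" for w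
      using D(3)[OF \<open>f \<in> _\<close>, of w] that by force
  qed (use that D in auto)
  have [simp]: "zero ?F = (\<lambda>w. \<zero>)" "one ?F = (\<lambda>w. if w = [] then \<one> else \<zero>)"
    "add ?F = (\<lambda>f g w. f w \<oplus> g w)" "mult ?F = convolution R"
    by (auto simp: free_algebra_def)
  show ?thesis
  proof (rule ringI)
    show "abelian_group ?F"
    proof (rule abelian_groupI, goal_cases)
      case (6 f)
      then show ?case
        by (intro bexI[OF _ neg]) (auto simp: l_neg D)
    qed (auto simp: add D a_ac intro!: I)
    show "monoid ?F"
    proof (rule monoidI, goal_cases)
      case (4 f)
      then show ?case
        using convolution_append[of f \<one> "[]"] by (auto simp: D)
    qed (auto simp: mult D convolution_assoc convolution_one_right split: if_splits intro!: I ext)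
  qed (auto simp: D convolution_add_left convolution_add_right)
qed

end


definition word :: "('k, 'm) ring_scheme \<Rightarrow> 'x list \<Rightarrow> 'x list \<Rightarrow> 'k" where
  "word K u = (\<lambda>w. if w = u then \<one>\<^bsub>K\<^esub> else \<zero>\<^bsub>K\<^esub>)"

definition quotient_algebra :: "('k, 'a, 'm) module_scheme \<Rightarrow> 'a set \<Rightarrow> ('k, 'a set) module" where
  "quotient_algebra A I =
     \<lparr>carrier = carrier (A Quot I), mult = mult (A Quot I), one = one (A Quot I),
      zero = zero (A Quot I), add = add (A Quot I),
      smult = (\<lambda>k C. \<Union>x\<in>C. I +>\<^bsub>A\<^esub> (k \<odot>\<^bsub>A\<^esub> x))\<rparr>"

datatype ('v, 'e) lpa_generator = Vert 'v | Edge 'e | Ghost 'e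

definition lpa_generators :: "('v, 'e) pre_digraph \<Rightarrow> ('v, 'e) lpa_generator set" where
  "lpa_generators G = Vert ` verts G \<union> Edge ` arcs G \<union> Ghost ` arcs G"

abbreviation lpa_free ::
  "('k, 'm) ring_scheme \<Rightarrow> ('v, 'e) pre_digraph \<Rightarrow>
    ('k, ('v, 'e) lpa_generator list \<Rightarrow> 'k) module" where
  "lpa_free K G \<equiv> free_algebra K (lpa_generators G)"

text \<open>
  \<^const>\<open>tail\<close> is the source map \<open>s\<close>, \<^const>\<open>head\<close> is the range map \<open>r\<close>, and
  \<open>out_arcs G v\<close> is the fibre of \<open>s\<close> over \<open>v\<close>.
\<close>

definition lpa_relators ::
  "('k, 'm) ring_scheme \<Rightarrow> ('v, 'e) pre_digraph \<Rightarrow>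
    (('v, 'e) lpa_generator list \<Rightarrow> 'k) set" where
  "lpa_relators K G =
    (let F = lpa_free K G;
         v = (\<lambda>x. word K [Vert x]); e = (\<lambda>a. word K [Edge a]); g = (\<lambda>a. word K [Ghost a])
     in {v x \<otimes>\<^bsub>F\<^esub> v y \<ominus>\<^bsub>F\<^esub> (if x = y then v x else \<zero>\<^bsub>F\<^esub>) | x y. x \<in> verts G \<and> y \<in> verts G}
      \<union> {v (tail G a) \<otimes>\<^bsub>F\<^esub> e a \<ominus>\<^bsub>F\<^esub> e a | a. a \<in> arcs G}
      \<union> {e a \<otimes>\<^bsub>F\<^esub> v (head G a) \<ominus>\<^bsub>F\<^esub> e a | a. a \<in> arcs G}
      \<union> {v (head G a) \<otimes>\<^bsub>F\<^esub> g a \<ominus>\<^bsub>F\<^esub> g a | a. a \<in> arcs G}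
      \<union> {g a \<otimes>\<^bsub>F\<^esub> v (tail G a) \<ominus>\<^bsub>F\<^esub> g a | a. a \<in> arcs G}
      \<union> {g a \<otimes>\<^bsub>F\<^esub> e b \<ominus>\<^bsub>F\<^esub> (if a = b then v (head G a) else \<zero>\<^bsub>F\<^esub>) | a b. a \<in> arcs G \<and> b \<in> arcs G}
      \<union> {v x \<ominus>\<^bsub>F\<^esub> (\<Oplus>\<^bsub>F\<^esub>a\<in>out_arcs G x. e a \<otimes>\<^bsub>F\<^esub> g a) | x. x \<in> verts G \<and> out_arcs G x \<noteq> {}})"

abbreviation lpa_ideal ::
  "('k, 'm) ring_scheme \<Rightarrow> ('v, 'e) pre_digraph \<Rightarrow>
    (('v, 'e) lpa_generator list \<Rightarrow> 'k) set" where
  "lpa_ideal K G \<equiv> Idl\<^bsub>lpa_free K G\<^esub> (lpa_relators K G)"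

text \<open>
  The Leavitt path algebra is a quotient of the free algebra without unit, i.e. of the
  elements of the free algebra whose coefficient at the empty word vanishes. Every relator is
  such an element, so the ideal it generates in the unital free algebra is the algebra ideal it
  generates in the one without unit. The sum of the vertices is the unit element if there are
  only finitely many vertices; otherwise there is none and the field \<^const>\<open>one\<close> has no meaning.
\<close>

definition leavitt ::
  "('k, 'm) ring_scheme \<Rightarrow> ('v, 'e) pre_digraph \<Rightarrow>
    ('k, (('v, 'e) lpa_generator list \<Rightarrow> 'k) set) module" where
  "leavitt K G =
     (quotient_algebra (lpa_free K G) (lpa_ideal K G))
       \<lparr>carrier := {lpa_ideal K G +>\<^bsub>lpa_free K G\<^esub> f | f.
                      f \<in> carrier (lpa_free K G) \<and> f [] = \<zero>\<^bsub>K\<^esub>},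
        one := lpa_ideal K G +>\<^bsub>lpa_free K G\<^esub>
                 (\<Oplus>\<^bsub>lpa_free K G\<^esub>x\<in>verts G. word K [Vert x])\<rparr>"

context cring
begin

lemma free_algebra_simps:
  "zero (free_algebra R S) = (\<lambda>w. \<zero>)"
  "one (free_algebra R S) = (\<lambda>w. if w = [] then \<one> else \<zero>)"
  "add (free_algebra R S) = (\<lambda>f g w. f w \<oplus> g w)"
  "mult (free_algebra R S) = convolution R"
  "smult (free_algebra R S) = (\<lambda>c f w. c \<otimes> f w)"
  by (auto simp: free_algebra_def)

lemma word_closed: "u \<in> lists S \<Longrightarrow> word R u \<in> carrier (free_algebra R S)"
  by (auto simp: word_def free_algebra_def)

lemma scaled_word_closed:
  "u \<in> lists S \<Longrightarrow> c \<in> carrier R \<Longrightarrow> (\<lambda>w. if w = u then c else \<zero>) \<in> carrier (free_algebra R S)"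
  by (auto simp: free_algebra_def)

lemma free_algebra_nonunital_induct [consumes 2, case_names zero step]:
  assumes "f \<in> carrier (free_algebra R S)" "f [] = \<zero>"
    and zero: "P (\<lambda>w. \<zero>)"
    and step: "\<And>u c g. \<lbrakk>u \<in> lists S; u \<noteq> []; c \<in> carrier R; g \<in> carrier (free_algebra R S); g [] = \<zero>; P g\<rbrakk>
      \<Longrightarrow> P ((\<lambda>w. if w = u then c else \<zero>) \<oplus>\<^bsub>free_algebra R S\<^esub> g)"
  shows "P f"
proof -
  have "finite {w. f w \<noteq> \<zero>}" using assms(1) by (simp add: free_algebra_def)
  then show ?thesis using assms(1,2)
  proof (induction "{w. f w \<noteq> \<zero>}" arbitrary: f rule: finite_induct)
    case empty
    then have "f = (\<lambda>w. \<zero>)" by auto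
    with zero show ?case by simp
  next
    case (insert u T)
    define g where "g = f(u := \<zero>)"
    have T: "T = {w. g w \<noteq> \<zero>}" using insert.hyps by (auto simp: g_def)
    have "finite {w. g w \<noteq> \<zero>}" "{w. g w \<noteq> \<zero>} \<subseteq> {w. f w \<noteq> \<zero>}"
      using T insert.hyps by auto
    then have g: "g \<in> carrier (free_algebra R S)" "g [] = \<zero>"
      using insert.prems by (auto simp: free_algebra_def) (auto simp: g_def)
    have u: "f u \<noteq> \<zero>" using insert.hyps(4) by blast
    have "(\<lambda>w. if w = u then f u else \<zero>) \<oplus>\<^bsub>free_algebra R S\<^esub> g = f"
      using insert.prems by (auto simp: free_algebra_def g_def)
    moreover have "P ((\<lambda>w. if w = u then f u else \<zero>) \<oplus>\<^bsub>free_algebra R S\<^esub> g)"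
      using u insert.prems by (intro step g insert.hyps(3)[OF T g]) (auto simp: free_algebra_def)
    ultimately show ?case by simp
  qed
qed

lemma convolution_words:
  "c \<in> carrier R \<Longrightarrow> convolution R (word R u) (\<lambda>w. if w = v then c else \<zero>) = (\<lambda>w. if w = u @ v then c else \<zero>)"
  "c \<in> carrier R \<Longrightarrow> convolution R (\<lambda>w. if w = v then c else \<zero>) (word R u) = (\<lambda>w. if w = v @ u then c else \<zero>)"
  unfolding word_def
  by (rule ext, subst convolution_append, auto, metis append_take_drop_id)+

end

lemma (in field) ring_leavitt:
  assumes "fin_digraph G"
  shows "ring (leavitt R G)"
proof -
  interpret G: fin_digraph G by fact
  let ?F = "lpa_free R G" and ?I = "lpa_ideal R G"
  interpret F: ring ?F by (rule ring_free_algebra)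
  let ?v = "\<lambda>x. word R [Vert x]" and ?e = "\<lambda>x. word R [Edge x]" and ?g = "\<lambda>x. word R [Ghost x]"
  define U where "U = (\<Oplus>\<^bsub>?F\<^esub>x\<in>verts G. ?v x)"
  have gens: "\<And>x. x \<in> verts G \<Longrightarrow> ?v x \<in> carrier ?F"
    "\<And>x. x \<in> arcs G \<Longrightarrow> ?e x \<in> carrier ?F" "\<And>x. x \<in> arcs G \<Longrightarrow> ?g x \<in> carrier ?F"
    by (auto intro!: word_closed simp: lpa_generators_def)
  note [simp] = gens
  have "(\<Oplus>\<^bsub>?F\<^esub>a\<in>out_arcs G x. ?e a \<otimes>\<^bsub>?F\<^esub> ?g a) \<in> carrier ?F" for x
    by (rule F.finsum_closed) auto
  then have rel: "lpa_relators R G \<subseteq> carrier ?F"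
    unfolding lpa_relators_def Let_def by (auto intro!: F.minus_closed)
  interpret I: ideal ?I ?F by (rule F.genideal_ideal[OF rel])
  interpret Q: ring "?F Quot ?I" by (rule I.quotient_is_ring)
  note relI = F.genideal_self[OF rel, THEN subsetD]
  define p where "p f = ?I +>\<^bsub>?F\<^esub> f" for f
  interpret p: ring_hom_ring ?F "?F Quot ?I" p
    unfolding p_def by (rule I.rcos_ring_hom_ring)
  have eq: "p f = p g" if "f \<in> carrier ?F" "g \<in> carrier ?F" "f \<ominus>\<^bsub>?F\<^esub> g \<in> lpa_relators R G" for f g
    using that(1,2) relI[OF that(3)] unfolding p_def
    by (simp add: F.quotient_eq_iff_same_a_r_cos[OF I.is_ideal])
  have vv: "p (?v x \<otimes>\<^bsub>?F\<^esub> ?v y) = p (if x = y then ?v x else \<zero>\<^bsub>?F\<^esub>)"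
    if "x \<in> verts G" "y \<in> verts G" for x y
    using that by (intro eq) (auto simp: lpa_relators_def Let_def)
  have UV: "p ((\<Oplus>\<^bsub>?F\<^esub>x\<in>V. ?v x) \<otimes>\<^bsub>?F\<^esub> ?v y) = p (if y \<in> V then ?v y else \<zero>\<^bsub>?F\<^esub>) \<and>
       p (?v y \<otimes>\<^bsub>?F\<^esub> (\<Oplus>\<^bsub>?F\<^esub>x\<in>V. ?v x)) = p (if y \<in> V then ?v y else \<zero>\<^bsub>?F\<^esub>)"
    if "finite V" "V \<subseteq> verts G" "y \<in> verts G" for V y
    using that
  proof (induction V rule: finite_induct)
    case empty
    then show ?case by simp
  next
    case (insert x V)
    have [simp]: "(\<Oplus>\<^bsub>?F\<^esub>x\<in>V. ?v x) \<in> carrier ?F"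
      using insert by (intro F.finsum_closed) auto
    have s: "(\<Oplus>\<^bsub>?F\<^esub>x\<in>insert x V. ?v x) = ?v x \<oplus>\<^bsub>?F\<^esub> (\<Oplus>\<^bsub>?F\<^esub>x\<in>V. ?v x)"
      using insert by (intro F.finsum_insert) auto
    show ?case
      unfolding s using insert vv[of x y] vv[of y x]
      by (auto simp: F.l_distr F.r_distr simp del: p.hom_mult)
  qed
  have Uc: "U \<in> carrier ?F" unfolding U_def by (intro F.finsum_closed) auto
  have Uv: "p U \<otimes>\<^bsub>?F Quot ?I\<^esub> p (?v y) = p (?v y)" "p (?v y) \<otimes>\<^bsub>?F Quot ?I\<^esub> p U = p (?v y)"
    if "y \<in> verts G" for y
    using UV[of "verts G" y] that Uc by (auto simp: U_def)
  have ends_F: "p (?v (tail G a) \<otimes>\<^bsub>?F\<^esub> ?e a) = p (?e a)"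
    "p (?e a \<otimes>\<^bsub>?F\<^esub> ?v (head G a)) = p (?e a)"
    "p (?v (head G a) \<otimes>\<^bsub>?F\<^esub> ?g a) = p (?g a)"
    "p (?g a \<otimes>\<^bsub>?F\<^esub> ?v (tail G a)) = p (?g a)"
    if "a \<in> arcs G" for a
    using that by (intro eq; force simp: lpa_relators_def Let_def)+
  have ends: "p (?v (tail G a)) \<otimes>\<^bsub>?F Quot ?I\<^esub> p (?e a) = p (?e a)"
    "p (?e a) \<otimes>\<^bsub>?F Quot ?I\<^esub> p (?v (head G a)) = p (?e a)"
    "p (?v (head G a)) \<otimes>\<^bsub>?F Quot ?I\<^esub> p (?g a) = p (?g a)"
    "p (?g a) \<otimes>\<^bsub>?F Quot ?I\<^esub> p (?v (tail G a)) = p (?g a)"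
    if "a \<in> arcs G" for a
    using ends_F[OF that] that by simp_all
  have Ux: "p U \<otimes>\<^bsub>?F Quot ?I\<^esub> p (word R [x]) = p (word R [x]) \<and>
      p (word R [x]) \<otimes>\<^bsub>?F Quot ?I\<^esub> p U = p (word R [x])"
    if "x \<in> lpa_generators G" for x
  proof -
    have *: "p U \<otimes>\<^bsub>?F Quot ?I\<^esub> p f = p f \<and> p f \<otimes>\<^bsub>?F Quot ?I\<^esub> p U = p f"
      if "p (?v y) \<otimes>\<^bsub>?F Quot ?I\<^esub> p f = p f" "p f \<otimes>\<^bsub>?F Quot ?I\<^esub> p (?v z) = p f"
        "y \<in> verts G" "z \<in> verts G" "f \<in> carrier ?F" for f y z
      using that Uv Uc gens by (metis Q.m_assoc p.hom_closed)
    from that consider y where "y \<in> verts G" "x = Vert y"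
      | a where "a \<in> arcs G" "x = Edge a" | a where "a \<in> arcs G" "x = Ghost a"
      by (auto simp: lpa_generators_def)
    then show ?thesis
    proof cases
      case (1 y)
      then show ?thesis using Uv by simp
    next
      case (2 a)
      then show ?thesis using *[OF ends(1,2)] by simp
    next
      case (3 a)
      then show ?thesis using *[OF ends(3,4)] by simp
    qed
  qed
  have Uf: "p U \<otimes>\<^bsub>?F Quot ?I\<^esub> p f = p f \<and> p f \<otimes>\<^bsub>?F Quot ?I\<^esub> p U = p f"
    if "f \<in> carrier ?F" "f [] = \<zero>" for f
    using that
  proof (induction f rule: free_algebra_nonunital_induct)
    case zero
    have "p (\<lambda>w. \<zero>) = \<zero>\<^bsub>?F Quot ?I\<^esub>" using p.hom_zero by (simp add: free_algebra_simps)
    then show ?case using Uc by simp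
  next
    case (step u c g)
    let ?m = "\<lambda>u w. if w = u then c else \<zero>"
    have m: "?m u \<in> carrier ?F" if "u \<in> lists (lpa_generators G)" for u
      using that step by (auto intro!: scaled_word_closed)
    obtain x v where u: "u = x # v" using step by (cases u) auto
    obtain y w where u': "u = w @ [y]" using step by (cases u rule: rev_cases) auto
    have xv: "x \<in> lpa_generators G" "v \<in> lists (lpa_generators G)"
      using step(1) unfolding u by auto
    have yw: "y \<in> lpa_generators G" "w \<in> lists (lpa_generators G)"
      using step(1) unfolding u' by auto
    have 1: "?m u = word R [x] \<otimes>\<^bsub>?F\<^esub> ?m v"
      unfolding u using step(3) by (simp add: free_algebra_simps convolution_words)
    have 2: "?m u = ?m w \<otimes>\<^bsub>?F\<^esub> word R [y]"
      unfolding u' using step(3) by (simp add: free_algebra_simps convolution_words)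
    have wc: "word R [x] \<in> carrier ?F" "word R [y] \<in> carrier ?F"
      using xv yw by (auto intro!: word_closed)
    have "p U \<otimes>\<^bsub>?F Quot ?I\<^esub> p (?m u) = p (?m u)"
      unfolding 1 using Ux[OF xv(1)] Uc wc m[OF xv(2)] by (simp flip: Q.m_assoc)
    moreover have "p (?m u) \<otimes>\<^bsub>?F Quot ?I\<^esub> p U = p (?m u)"
      unfolding 2 using Ux[OF yw(1)] Uc wc m[OF yw(2)] by (simp add: Q.m_assoc)
    ultimately show ?case
      using m[OF step(1)] step(4,6) Uc by (simp add: Q.l_distr Q.r_distr)
  qed
  define N where "N = {f \<in> carrier ?F. f [] = \<zero>}"
  have N: "f \<in> carrier ?F" if "f \<in> N" for f using that by (simp add: N_def)
  have Nadd: "f \<oplus>\<^bsub>?F\<^esub> g \<in> N" if "f \<in> N" "g \<in> N" for f g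
    using that F.a_closed[of f g] by (auto simp: N_def) (simp add: free_algebra_simps)
  have Nmult: "f \<otimes>\<^bsub>?F\<^esub> g \<in> N" if "f \<in> N" "g \<in> N" for f g
    using that F.m_closed[of f g]
    by (auto simp: N_def) (auto simp: free_algebra_simps convolution_def free_algebra_def)
  have Nneg: "\<ominus>\<^bsub>?F\<^esub> f \<in> N" if "f \<in> N" for f
  proof -
    have "(\<ominus>\<^bsub>?F\<^esub> f \<oplus>\<^bsub>?F\<^esub> f) [] = \<zero>"
      using F.l_neg[OF N[OF that]] by (simp add: free_algebra_simps)
    moreover have "(\<ominus>\<^bsub>?F\<^esub> f) [] \<in> carrier R"
      using F.a_inv_closed[OF N[OF that]] by (simp add: free_algebra_def)
    ultimately show ?thesis
      using that by (auto simp: N_def free_algebra_simps)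
  qed
  have Nzero: "\<zero>\<^bsub>?F\<^esub> \<in> N" using F.zero_closed by (auto simp: N_def) (simp add: free_algebra_simps)
  have NV: "(\<Oplus>\<^bsub>?F\<^esub>x\<in>V. ?v x) \<in> N" if "finite V" "V \<subseteq> verts G" for V
    using that
  proof (induction V rule: finite_induct)
    case (insert x V)
    moreover have "?v x \<in> N" using insert by (auto simp: N_def) (simp add: word_def)
    ultimately show ?case
      by (subst F.finsum_insert) (auto intro!: Nadd)
  qed (use Nzero in simp)
  have UN: "U \<in> N" unfolding U_def by (rule NV) auto
  have L: "carrier (leavitt R G) = p ` N" "one (leavitt R G) = p U"
    "zero (leavitt R G) = \<zero>\<^bsub>?F Quot ?I\<^esub>" "add (leavitt R G) = add (?F Quot ?I)"
    "mult (leavitt R G) = mult (?F Quot ?I)"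
    by (auto simp: leavitt_def quotient_algebra_def p_def U_def N_def)
  have pc: "p f \<in> carrier (?F Quot ?I)" if "f \<in> N" for f using N[OF that] by simp
  show ?thesis
  proof (rule ringI)
    show "abelian_group (leavitt R G)"
    proof (rule abelian_groupI, unfold L, goal_cases)
      case (6 x)
      then obtain f where f: "f \<in> N" "x = p f" by auto
      have "p (\<ominus>\<^bsub>?F\<^esub> f) \<oplus>\<^bsub>?F Quot ?I\<^esub> x = \<zero>\<^bsub>?F Quot ?I\<^esub>"
        using N[OF f(1)] f(2) by (simp add: Q.l_neg)
      then show ?case using Nneg[OF f(1)] by blast
    qed (auto simp: pc F.a_ac N Nadd Nzero simp flip: p.hom_add p.hom_zero)
    show "monoid (leavitt R G)"
    proof (rule monoidI, unfold L, goal_cases)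
      case (3 x y z)
      then show ?case by (auto simp: pc Q.m_assoc)
    next
      case (4 x)
      then show ?case using Uf by (auto simp: N_def)
    next
      case (5 x)
      then show ?case using Uf by (auto simp: N_def)
    qed (auto simp: UN N Nmult simp flip: p.hom_mult)
  qed (unfold L, auto simp: pc Q.l_distr Q.r_distr)
qed


section \<open>Prime ideals and the Zariski topology\<close>

text \<open>The locale \<^locale>\<open>primeideal\<close> of HOL-Algebra is for commutative rings only.\<close>

definition prime_ideal :: "('a, 'm) ring_scheme \<Rightarrow> 'a set \<Rightarrow> bool" where
  "prime_ideal A P \<longleftrightarrow> ideal P A \<and> P \<noteq> carrier A \<and>
     (\<forall>I J. ideal I A \<longrightarrow> ideal J A \<longrightarrow> I \<cdot>\<^bsub>A\<^esub> J \<subseteq> P \<longrightarrow> I \<subseteq> P \<or> J \<subseteq> P)"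

definition Spec :: "('a, 'm) ring_scheme \<Rightarrow> 'a set set" where
  "Spec A = {P. prime_ideal A P}"

definition zariski :: "('a, 'm) ring_scheme \<Rightarrow> 'a set topology" where
  "zariski A = topology (\<lambda>U. \<exists>I. ideal I A \<and> U = Spec A - {P \<in> Spec A. I \<subseteq> P})"

lemma prime_ideal_Int:
  assumes "ring A" "P \<in> Spec A" "ideal I A" "ideal J A"
  shows "I \<inter> J \<subseteq> P \<longleftrightarrow> I \<subseteq> P \<or> J \<subseteq> P"
proof
  assume "I \<inter> J \<subseteq> P"
  then have "I \<cdot>\<^bsub>A\<^esub> J \<subseteq> P" using assms ring.ideal_prod_inter[of A I J] by blast
  then show "I \<subseteq> P \<or> J \<subseteq> P" using assms unfolding Spec_def prime_ideal_def by blast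
qed blast

lemma (in ring) istopology_zariski:
  "istopology (\<lambda>U. \<exists>I. ideal I R \<and> U = Spec R - {P \<in> Spec R. I \<subseteq> P})"
  unfolding istopology_def
proof (intro conjI allI impI)
  fix U V
  assume "\<exists>I. ideal I R \<and> U = Spec R - {P \<in> Spec R. I \<subseteq> P}"
    "\<exists>J. ideal J R \<and> V = Spec R - {P \<in> Spec R. J \<subseteq> P}"
  then obtain I J where "ideal I R" "U = Spec R - {P \<in> Spec R. I \<subseteq> P}"
    "ideal J R" "V = Spec R - {P \<in> Spec R. J \<subseteq> P}" by blast
  then show "\<exists>I. ideal I R \<and> U \<inter> V = Spec R - {P \<in> Spec R. I \<subseteq> P}"
    using prime_ideal_Int[OF ring_axioms] by (intro exI[of _ "I \<inter> J"]) (auto simp: i_intersect)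
next
  fix \<U>
  assume "\<forall>U\<in>\<U>. \<exists>I. ideal I R \<and> U = Spec R - {P \<in> Spec R. I \<subseteq> P}"
  then obtain I where I: "\<And>U. U \<in> \<U> \<Longrightarrow> ideal (I U) R \<and> U = Spec R - {P \<in> Spec R. I U \<subseteq> P}"
    by metis
  have sub: "\<Union> (I ` \<U>) \<subseteq> carrier R" using I ideal.Icarr by fastforce
  have "Idl (\<Union> (I ` \<U>)) \<subseteq> P \<longleftrightarrow> (\<forall>U\<in>\<U>. I U \<subseteq> P)" if "P \<in> Spec R" for P
    using that Idl_subset_ideal[OF _ sub, of P] by (auto simp: Spec_def prime_ideal_def)
  then have "Spec R - {P \<in> Spec R. Idl (\<Union> (I ` \<U>)) \<subseteq> P} =
      (\<Union>U\<in>\<U>. Spec R - {P \<in> Spec R. I U \<subseteq> P})" by blast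
  also have "\<dots> = (\<Union>U\<in>\<U>. U)"
    using I by (intro SUP_cong) auto
  finally have "\<Union> \<U> = Spec R - {P \<in> Spec R. Idl (\<Union> (I ` \<U>)) \<subseteq> P}"
    by simp
  then show "\<exists>I. ideal I R \<and> \<Union> \<U> = Spec R - {P \<in> Spec R. I \<subseteq> P}"
    using genideal_ideal[OF sub] by blast
qed

lemma (in ring) openin_zariski:
  "openin (zariski R) U \<longleftrightarrow> (\<exists>I. ideal I R \<and> U = Spec R - {P \<in> Spec R. I \<subseteq> P})"
  unfolding zariski_def by (simp add: topology_inverse'[OF istopology_zariski])

lemma (in ring) topspace_zariski: "topspace (zariski R) = Spec R"
proof
  show "topspace (zariski R) \<subseteq> Spec R"
    using openin_topspace[of "zariski R"] unfolding openin_zariski by blast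
  have "Spec R = Spec R - {P \<in> Spec R. carrier R \<subseteq> P}"
    by (auto simp: Spec_def prime_ideal_def dest: ideal.Icarr)
  then have "openin (zariski R) (Spec R)"
    unfolding openin_zariski using oneideal by blast
  then show "Spec R \<subseteq> topspace (zariski R)"
    by (rule openin_subset)
qed


definition locally_closed_prime :: "('a, 'm) ring_scheme \<Rightarrow> 'a set \<Rightarrow> bool" where
  "locally_closed_prime A P \<longleftrightarrow>
     openin (subtopology (zariski A) (zariski A closure_of {P})) {P}"


section \<open>Primitive ideals\<close>

text \<open>The record field \<^const>\<open>smult\<close> holds the right action: \<open>a \<odot> m\<close> stands for \<open>m \<cdot> a\<close>.\<close>

locale right_module = R?: ring A + M?: abelian_group M
  for A :: "('a, 'r) ring_scheme" (structure) and M :: "('a, 'm, 's) module_scheme" (structure) +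
  assumes act_closed:
      "\<lbrakk>a \<in> carrier A; m \<in> carrier M\<rbrakk> \<Longrightarrow> a \<odot>\<^bsub>M\<^esub> m \<in> carrier M"
    and act_add_ring:
      "\<lbrakk>a \<in> carrier A; b \<in> carrier A; m \<in> carrier M\<rbrakk> \<Longrightarrow>
        (a \<oplus>\<^bsub>A\<^esub> b) \<odot>\<^bsub>M\<^esub> m = a \<odot>\<^bsub>M\<^esub> m \<oplus>\<^bsub>M\<^esub> b \<odot>\<^bsub>M\<^esub> m"
    and act_add_module:
      "\<lbrakk>a \<in> carrier A; m \<in> carrier M; n \<in> carrier M\<rbrakk> \<Longrightarrow>
        a \<odot>\<^bsub>M\<^esub> (m \<oplus>\<^bsub>M\<^esub> n) = a \<odot>\<^bsub>M\<^esub> m \<oplus>\<^bsub>M\<^esub> a \<odot>\<^bsub>M\<^esub> n"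
    and act_assoc:
      "\<lbrakk>a \<in> carrier A; b \<in> carrier A; m \<in> carrier M\<rbrakk> \<Longrightarrow>
        (a \<otimes>\<^bsub>A\<^esub> b) \<odot>\<^bsub>M\<^esub> m = b \<odot>\<^bsub>M\<^esub> (a \<odot>\<^bsub>M\<^esub> m)"
    and act_one:
      "m \<in> carrier M \<Longrightarrow> \<one>\<^bsub>A\<^esub> \<odot>\<^bsub>M\<^esub> m = m"

definition right_submodule ::
  "('a, 'r) ring_scheme \<Rightarrow> ('a, 'm, 's) module_scheme \<Rightarrow> 'm set \<Rightarrow> bool" where
  "right_submodule A M N \<longleftrightarrow> additive_subgroup N M \<and> (\<forall>a\<in>carrier A. \<forall>m\<in>N. a \<odot>\<^bsub>M\<^esub> m \<in> N)"

locale simple_right_module = right_module +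
  assumes nonzero: "carrier M \<noteq> {\<zero>\<^bsub>M\<^esub>}"
    and simple: "right_submodule A M N \<Longrightarrow> N = {\<zero>\<^bsub>M\<^esub>} \<or> N = carrier M"

definition annihilator :: "('a, 'r) ring_scheme \<Rightarrow> ('a, 'm, 's) module_scheme \<Rightarrow> 'a set" where
  "annihilator A M = {a \<in> carrier A. \<forall>m\<in>carrier M. a \<odot>\<^bsub>M\<^esub> m = \<zero>\<^bsub>M\<^esub>}"

text \<open>
  The elements of the module may be taken to be sets of ring elements, as every simple right
  module is isomorphic to one whose elements are cosets of a right ideal; see
  \<open>primitive_idealI\<close> below.
\<close>

definition primitive_ideal :: "('a, 'r) ring_scheme \<Rightarrow> 'a set \<Rightarrow> bool" where
  "primitive_ideal A P \<longleftrightarrow>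
     (\<exists>M :: ('a, 'a set) module. simple_right_module A M \<and> P = annihilator A M)"

lemma (in right_module) act_zero: "a \<in> carrier A \<Longrightarrow> a \<odot>\<^bsub>M\<^esub> \<zero>\<^bsub>M\<^esub> = \<zero>\<^bsub>M\<^esub>"
  using act_add_module[of a "\<zero>\<^bsub>M\<^esub>" "\<zero>\<^bsub>M\<^esub>"] act_closed[of a "\<zero>\<^bsub>M\<^esub>"]
  by (metis M.add.l_cancel_one M.zero_closed M.l_zero)

lemma (in right_module) act_zero_ring: "m \<in> carrier M \<Longrightarrow> \<zero>\<^bsub>A\<^esub> \<odot>\<^bsub>M\<^esub> m = \<zero>\<^bsub>M\<^esub>"
  using act_add_ring[of "\<zero>\<^bsub>A\<^esub>" "\<zero>\<^bsub>A\<^esub>" m] act_closed[of "\<zero>\<^bsub>A\<^esub>" m]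
  by (metis M.add.l_cancel_one R.zero_closed R.l_zero)

lemma (in simple_right_module) cyclic:
  assumes "m \<in> carrier M" "m \<noteq> \<zero>\<^bsub>M\<^esub>" "n \<in> carrier M"
  shows "\<exists>a\<in>carrier A. a \<odot>\<^bsub>M\<^esub> m = n"
proof -
  let ?N = "(\<lambda>a. a \<odot>\<^bsub>M\<^esub> m) ` carrier A"
  have "additive_subgroup ?N M"
  proof (intro additive_subgroup.intro subgroup.intro)
    fix x assume "x \<in> ?N"
    then obtain a where a: "a \<in> carrier A" "x = a \<odot>\<^bsub>M\<^esub> m" by auto
    have "(\<ominus>\<^bsub>A\<^esub> a) \<odot>\<^bsub>M\<^esub> m \<oplus>\<^bsub>M\<^esub> x = \<zero>\<^bsub>M\<^esub>"
      using a assms act_add_ring[of "\<ominus>\<^bsub>A\<^esub> a" a m] by (simp add: R.l_neg act_zero_ring)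
    then have "\<ominus>\<^bsub>M\<^esub> x = (\<ominus>\<^bsub>A\<^esub> a) \<odot>\<^bsub>M\<^esub> m"
      using a assms act_closed by (intro M.minus_equality) auto
    then show "inv\<^bsub>add_monoid M\<^esub> x \<in> ?N"
      using a by (auto simp: a_inv_def)
  next
    show "\<one>\<^bsub>add_monoid M\<^esub> \<in> ?N"
      using act_zero_ring[OF assms(1)] by (auto intro!: image_eqI[of _ _ "\<zero>\<^bsub>A\<^esub>"])
  qed (use assms act_closed in \<open>auto simp flip: act_add_ring\<close>)
  then have "right_submodule A M ?N"
    using assms by (auto simp: right_submodule_def simp flip: act_assoc)
  moreover have "m \<in> ?N" using act_one[OF assms(1)] by force
  ultimately have "?N = carrier M" using simple[of ?N] assms(2) by blast
  then have "n \<in> ?N" using assms(3) by simp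
  then show ?thesis by blast
qed

lemma primitive_idealI:
  fixes M :: "('a, 'm, 's) module_scheme"
  assumes "simple_right_module A M"
  shows "primitive_ideal A (annihilator A M)"
proof -
  interpret simple_right_module A M by fact
  obtain m0 where m0: "m0 \<in> carrier M" "m0 \<noteq> \<zero>\<^bsub>M\<^esub>" using nonzero by blast
  define h where "h m = {a \<in> carrier A. a \<odot>\<^bsub>M\<^esub> m0 = m}" for m
  define k where "k = inv_into (carrier M) h"
  have "inj_on h (carrier M)"
  proof (rule inj_onI)
    fix x y assume "x \<in> carrier M" "h x = h y"
    then show "x = y" using cyclic[OF m0, of x] by (auto simp: h_def set_eq_iff)
  qed
  then have k [simp]: "k (h m) = m" if "m \<in> carrier M" for m
    using that by (simp add: k_def)
  define M' :: "('a, 'a set) module" where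
    "M' = \<lparr>carrier = h ` carrier M, mult = undefined, one = undefined, zero = h \<zero>\<^bsub>M\<^esub>,
           add = (\<lambda>x y. h (k x \<oplus>\<^bsub>M\<^esub> k y)), smult = (\<lambda>a x. h (a \<odot>\<^bsub>M\<^esub> k x))\<rparr>"
  have M' [simp]: "carrier M' = h ` carrier M" "zero M' = h \<zero>\<^bsub>M\<^esub>"
    "add M' = (\<lambda>x y. h (k x \<oplus>\<^bsub>M\<^esub> k y))" "smult M' = (\<lambda>a x. h (a \<odot>\<^bsub>M\<^esub> k x))"
    by (auto simp: M'_def)
  have ag: "abelian_group M'"
  proof (rule abelian_groupI, goal_cases)
    case (6 x)
    then obtain m where "m \<in> carrier M" "x = h m" by auto
    then show ?case by (auto simp: M.l_neg intro!: bexI[of _ "\<ominus>\<^bsub>M\<^esub> m"])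
  qed (auto simp: M.a_ac)
  interpret M': abelian_group M' by (fact ag)
  have neg: "\<ominus>\<^bsub>M'\<^esub> h m = h (\<ominus>\<^bsub>M\<^esub> m)" if "m \<in> carrier M" for m
    using that by (intro M'.minus_equality) (auto simp: M.l_neg)
  interpret M': right_module A M'
    by unfold_locales
      (auto simp: act_closed act_add_ring act_add_module act_assoc act_one)
  have simple_M': "simple_right_module A M'"
  proof (unfold_locales, goal_cases)
    case 1
    have "h m0 \<noteq> h \<zero>\<^bsub>M\<^esub>" using k m0 by (metis M.zero_closed)
    then show ?case using m0(1) by auto
  next
    case (2 N)
    then interpret N: additive_subgroup N M' by (simp add: right_submodule_def)
    have N: "N \<subseteq> h ` carrier M" "h \<zero>\<^bsub>M\<^esub> \<in> N"
      using N.a_subset N.zero_closed by auto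
    have N_add: "h (m \<oplus>\<^bsub>M\<^esub> n) \<in> N"
      if "m \<in> carrier M" "n \<in> carrier M" "h m \<in> N" "h n \<in> N" for m n
      using N.a_closed[OF that(3,4)] that by simp
    have N_neg: "h (\<ominus>\<^bsub>M\<^esub> m) \<in> N" if "m \<in> carrier M" "h m \<in> N" for m
      using N.a_inv_closed[OF that(2)] that by (simp add: neg)
    have N_act: "h (a \<odot>\<^bsub>M\<^esub> m) \<in> N" if "a \<in> carrier A" "m \<in> carrier M" "h m \<in> N" for a m
      using 2 that unfolding right_submodule_def by force
    let ?N = "{m \<in> carrier M. h m \<in> N}"
    have "additive_subgroup ?N M"
      by (intro additive_subgroup.intro subgroup.intro)
        (auto simp: N N_add N_neg simp flip: a_inv_def)
    then have "right_submodule A M ?N"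
      by (auto simp: right_submodule_def act_closed N_act)
    from simple[OF this] show ?case
    proof
      assume "?N = {\<zero>\<^bsub>M\<^esub>}"
      then have "m = \<zero>\<^bsub>M\<^esub>" if "m \<in> carrier M" "h m \<in> N" for m using that by blast
      then have "N = {h \<zero>\<^bsub>M\<^esub>}" using N(1)[THEN subsetD] N(2) by (auto elim!: imageE)
      then show ?case by simp
    next
      assume "?N = carrier M"
      then have "h m \<in> N" if "m \<in> carrier M" for m using that by blast
      then have "N = h ` carrier M" using N(1) by (intro equalityI image_subsetI)
      then show ?case by simp
    qed
  qed
  have "h m = h \<zero>\<^bsub>M\<^esub> \<longleftrightarrow> m = \<zero>\<^bsub>M\<^esub>" if "m \<in> carrier M" for m
    using k[OF that] k[OF M.zero_closed] by metis
  then have "annihilator A M = annihilator A M'"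
    unfolding annihilator_def by (intro Collect_cong conj_cong refl) (simp add: act_closed)
  with simple_M' show ?thesis
    unfolding primitive_ideal_def by (intro exI[of _ M'] conjI)
qed


section \<open>The Martindale ring of quotients and rational ideals\<close>

definition right_module_homs :: "('a, 'r) ring_scheme \<Rightarrow> 'a set \<Rightarrow> ('a \<Rightarrow> 'a) set" where
  "right_module_homs A I =
     {f \<in> extensional I. (\<forall>x\<in>I. f x \<in> carrier A) \<and>
        (\<forall>x\<in>I. \<forall>y\<in>I. f (x \<oplus>\<^bsub>A\<^esub> y) = f x \<oplus>\<^bsub>A\<^esub> f y) \<and>
        (\<forall>x\<in>I. \<forall>a\<in>carrier A. f (x \<otimes>\<^bsub>A\<^esub> a) = f x \<otimes>\<^bsub>A\<^esub> a)}"

definition martindale_pairs :: "('a, 'r) ring_scheme \<Rightarrow> ('a set \<times> ('a \<Rightarrow> 'a)) set" where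
  "martindale_pairs A = {(I, f). ideal I A \<and> I \<noteq> {\<zero>\<^bsub>A\<^esub>} \<and> f \<in> right_module_homs A I}"

definition martindale_rel ::
  "('a, 'r) ring_scheme \<Rightarrow> (('a set \<times> ('a \<Rightarrow> 'a)) \<times> ('a set \<times> ('a \<Rightarrow> 'a))) set" where
  "martindale_rel A =
     {((I, f), (J, g)). (I, f) \<in> martindale_pairs A \<and> (J, g) \<in> martindale_pairs A \<and>
        (\<forall>x\<in>I \<inter> J. f x = g x)}"

definition martindale_class ::
  "('a, 'r) ring_scheme \<Rightarrow> 'a set \<Rightarrow> ('a \<Rightarrow> 'a) \<Rightarrow> ('a set \<times> ('a \<Rightarrow> 'a)) set" where
  "martindale_class A I f = martindale_rel A `` {(I, restrict f I)}"

definition martindale_ring :: "('a, 'r) ring_scheme \<Rightarrow> ('a set \<times> ('a \<Rightarrow> 'a)) set ring" where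
  "martindale_ring A =
     \<lparr>carrier = martindale_pairs A // martindale_rel A,
      mult = (\<lambda>p q. \<Union>(I, f)\<in>p. \<Union>(J, g)\<in>q. martindale_class A (J \<cdot>\<^bsub>A\<^esub> I) (\<lambda>x. f (g x))),
      one = martindale_class A (carrier A) (\<lambda>x. x),
      zero = martindale_class A (carrier A) (\<lambda>x. \<zero>\<^bsub>A\<^esub>),
      add = (\<lambda>p q. \<Union>(I, f)\<in>p. \<Union>(J, g)\<in>q. martindale_class A (I \<inter> J) (\<lambda>x. f x \<oplus>\<^bsub>A\<^esub> g x))\<rparr>"

definition ring_center :: "('a, 'r) ring_scheme \<Rightarrow> 'a set" where
  "ring_center R = {z \<in> carrier R. \<forall>x\<in>carrier R. z \<otimes>\<^bsub>R\<^esub> x = x \<otimes>\<^bsub>R\<^esub> z}"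

definition extended_centroid :: "('a, 'r) ring_scheme \<Rightarrow> ('a set \<times> ('a \<Rightarrow> 'a)) set ring" where
  "extended_centroid A = (martindale_ring A)\<lparr>carrier := ring_center (martindale_ring A)\<rparr>"

text \<open>The copy of \<open>K\<close> inside the extended centroid of a \<open>K\<close>-algebra.\<close>

definition scalars :: "('k, 'm) ring_scheme \<Rightarrow> ('k, 'a, 's) module_scheme \<Rightarrow>
    ('a set \<times> ('a \<Rightarrow> 'a)) set set" where
  "scalars K A = (\<lambda>k. martindale_class A (carrier A) (\<lambda>x. k \<odot>\<^bsub>A\<^esub> x)) ` carrier K"

definition rational_ideal ::
  "('k, 'm) ring_scheme \<Rightarrow> ('k, 'a, 's) module_scheme \<Rightarrow> 'a set \<Rightarrow> bool" where
  "rational_ideal K A P \<longleftrightarrow>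
     (let B = quotient_algebra A P; C = extended_centroid B
      in \<forall>c\<in>carrier C. ((ring.algebraic C) over scalars K B) c)"

end

theory Submission
  imports Defs "Graph_Theory.Arc_Walk"
begin

text \<open>
  Let \<open>B\<close> be the quotient of the Leavitt path algebra by a prime ideal. Primeness makes the set of
  vertices that survive in \<open>B\<close> downward directed, and finiteness yields a surviving vertex \<open>w\<close> which
  all of them reach. All three properties turn out to be equivalent to the condition that every
  nonzero ideal of \<open>B\<close> contains \<open>w\<close>, which is studied in the corner \<open>D = w B w\<close>.

  The centre of \<open>D\<close> embeds into the extended centroid of \<open>B\<close>, and is all of it if the condition holds.
  If there are two different closed walks of equal length at \<open>w\<close>, then for each \<open>N\<close> there is a closed
  walk without periods \<open>\<le> N\<close>; conjugating by it reduces every nonzero element of \<open>D\<close>, modulo an ideal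
  containing it, to a multiple of \<open>w\<close>, and shows that the centre of \<open>D\<close> is \<open>K w\<close>. So the condition
  and all three properties hold. Otherwise \<open>D\<close> is a commutative domain generated by
  a unit \<open>c\<close> and its inverse, and the condition and each of the properties say that \<open>c\<close> is algebraic over \<open>K\<close>.
  No grading and no normal form of the Leavitt path algebra is needed, since only the nonvanishing
  of vertices in \<open>B\<close> is used.
\<close>

section \<open>Prime rings and the Martindale ring of quotients\<close>

text \<open>In the quotient \<open>B\<close> monomials may vanish or become linearly dependent, and
  the ideals of \<open>B\<close> need not be graded, so coefficients cannot simply be compared. What
  survives is that \<open>ghost u p \<otimes> path u p\<close> is the end vertex of
  \<open>p\<close>, while walks of which neither is a prefix of the other are orthogonal.
  Sandwiching an element between suitable paths thus reads off a single coefficient, provided that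
  prolonging the walks does not make them comparable; a prolongation without short periods
  guarantees this.

  The condition \<open>full\<close> implies primitivity and local closedness in every corner, so
  only the converses and rationality depend on the alternative about closed walks. In the
  commutative case all edges leaving the walks at \<open>w\<close>, except one at each vertex, end
  in vanished vertices, so that paths become invertible, and all closed walks are powers of a
  shortest one. The corner is then an image of the Laurent polynomial ring, and the question is
  whether this image is a field. The obstruction for a transcendental \<open>c\<close> is that
  \<open>1 - q\<close>, with \<open>q\<close> a nonzero multiple of \<open>X\<close>, never divides
  a power of \<open>X\<close>.\<close>

lemma (in ring) ideal_intro:
  assumes "I \<subseteq> carrier R" "\<zero> \<in> I"
    and add: "\<And>x y. \<lbrakk>x \<in> I; y \<in> I\<rbrakk> \<Longrightarrow> x \<oplus> y \<in> I"
    and left: "\<And>a x. \<lbrakk>a \<in> carrier R; x \<in> I\<rbrakk> \<Longrightarrow> a \<otimes> x \<in> I"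
    and right: "\<And>a x. \<lbrakk>a \<in> carrier R; x \<in> I\<rbrakk> \<Longrightarrow> x \<otimes> a \<in> I"
  shows "ideal I R"
proof (rule idealI[OF ring_axioms])
  show "subgroup I (add_monoid R)"
  proof (intro subgroup.intro)
    fix x assume x: "x \<in> I"
    then have "\<ominus> x = (\<ominus> \<one>) \<otimes> x" using assms(1) by (auto simp: l_minus)
    then show "inv\<^bsub>add_monoid R\<^esub> x \<in> I" using left[of "\<ominus> \<one>" x] x by (simp add: a_inv_def)
  qed (use assms in auto)
qed (use left right in auto)

lemma (in ring) ideal_nonzeroE:
  assumes "ideal I R" "I \<noteq> {\<zero>}"
  obtains x where "x \<in> I" "x \<noteq> \<zero>" "x \<in> carrier R"
proof -
  have "\<zero> \<in> I" using assms(1) by (simp add: additive_subgroup.zero_closed ideal.axioms(1))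
  then obtain x where "x \<in> I" "x \<noteq> \<zero>" using assms(2) by blast
  then show ?thesis using that ideal.Icarr[OF assms(1)] by blast
qed

text \<open>This is primeness of the zero ideal in terms of elements;
  \<open>prime_ring_image\<close> derives it for the quotient by a prime ideal.\<close>

locale prime_ring = ring R for R (structure) +
  assumes one_neq_zero: "\<one> \<noteq> \<zero>"
    and prime: "\<lbrakk>a \<in> carrier R; b \<in> carrier R; \<And>x. x \<in> carrier R \<Longrightarrow> a \<otimes> x \<otimes> b = \<zero>\<rbrakk> \<Longrightarrow> a = \<zero> \<or> b = \<zero>"
begin

lemma ideal_prod_nonzero:
  assumes "ideal I R" "I \<noteq> {\<zero>}" "ideal J R" "J \<noteq> {\<zero>}"
  shows "I \<cdot> J \<noteq> {\<zero>}"
proof -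
  obtain i where i: "i \<in> I" "i \<noteq> \<zero>" "i \<in> carrier R" by (rule ideal_nonzeroE[OF assms(1,2)])
  obtain j where j: "j \<in> J" "j \<noteq> \<zero>" "j \<in> carrier R" by (rule ideal_nonzeroE[OF assms(3,4)])
  obtain x where x: "x \<in> carrier R" "i \<otimes> x \<otimes> j \<noteq> \<zero>" using prime i j by blast
  have "i \<otimes> x \<otimes> j \<in> I \<cdot> J"
    using i(1) j(1) x(1) by (intro ideal_prod.prod ideal.I_r_closed[OF assms(1)])
  then show ?thesis using x by auto
qed

lemma ideal_Int_nonzero:
  assumes "ideal I R" "I \<noteq> {\<zero>}" "ideal J R" "J \<noteq> {\<zero>}"
  shows "I \<inter> J \<noteq> {\<zero>}"
  using ideal_prod_nonzero[OF assms] ideal_prod_inter[OF assms(1,3)]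
    ideal_nonzeroE[OF ideal_prod_is_ideal[OF assms(1,3)]] by blast

text \<open>For \<open>h\<close> in \<open>H\<close> every \<open>x \<otimes> h\<close> lies in
  \<open>H\<close>, so \<open>y\<close> annihilates \<open>R h\<close> and primeness applies. Hence
  even a small nonzero ideal tells ring elements apart by their left action on it.\<close>

lemma left_annihilator_zero:
  assumes "ideal H R" "H \<noteq> {\<zero>}" "y \<in> carrier R" "\<And>h. h \<in> H \<Longrightarrow> y \<otimes> h = \<zero>"
  shows "y = \<zero>"
proof -
  obtain h where h: "h \<in> H" "h \<noteq> \<zero>" "h \<in> carrier R" by (rule ideal_nonzeroE[OF assms(1,2)])
  have "y \<otimes> x \<otimes> h = \<zero>" if "x \<in> carrier R" for x
    using assms(4)[OF ideal.I_l_closed[OF assms(1) h(1) that]] assms(3) that h(3)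
    by (simp add: m_assoc)
  then show ?thesis using prime h assms(3) by blast
qed

text \<open>The members of \<^const>\<open>martindale_pairs\<close> up to the extensionality convention.\<close>

definition partial_hom :: "'a set \<Rightarrow> ('a \<Rightarrow> 'a) \<Rightarrow> bool" where
  "partial_hom I f \<longleftrightarrow> ideal I R \<and> I \<noteq> {\<zero>} \<and> (\<forall>x\<in>I. f x \<in> carrier R) \<and>
     (\<forall>x\<in>I. \<forall>y\<in>I. f (x \<oplus> y) = f x \<oplus> f y) \<and> (\<forall>x\<in>I. \<forall>a\<in>carrier R. f (x \<otimes> a) = f x \<otimes> a)"

lemma partial_hom_restrict_iff: "(I, restrict f I) \<in> martindale_pairs R \<longleftrightarrow> partial_hom I f"
proof -
  have "x \<oplus> y \<in> I" if "ideal I R" "x \<in> I" "y \<in> I" for x y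
    using that additive_subgroup.a_closed[OF ideal.axioms(1)] by fastforce
  moreover have "x \<otimes> a \<in> I" if "ideal I R" "x \<in> I" "a \<in> carrier R" for x a
    using that ideal.I_r_closed by fastforce
  ultimately show ?thesis
    unfolding martindale_pairs_def right_module_homs_def partial_hom_def
    by (simp cong: ball_cong conj_cong)
qed

lemma partial_homD:
  assumes "partial_hom I f"
  shows "ideal I R" "I \<noteq> {\<zero>}" "\<And>x. x \<in> I \<Longrightarrow> f x \<in> carrier R" "\<And>x. x \<in> I \<Longrightarrow> x \<in> carrier R"
    "\<And>x y. \<lbrakk>x \<in> I; y \<in> I\<rbrakk> \<Longrightarrow> f (x \<oplus> y) = f x \<oplus> f y"
    "\<And>x a. \<lbrakk>x \<in> I; a \<in> carrier R\<rbrakk> \<Longrightarrow> f (x \<otimes> a) = f x \<otimes> a"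
  using assms ideal.Icarr[of I R] unfolding partial_hom_def by blast+

text \<open>For \<open>h\<close> in \<open>H\<close>, right linearity gives \<open>(f x \<ominus> g
  x) \<otimes> h = f (x \<otimes> h) \<ominus> g (x \<otimes> h) = \<zero>\<close>, since
  \<open>x \<otimes> h\<close> lies in \<open>H\<close>. So maps may be compared on any smaller
  nonzero ideal.\<close>

lemma partial_hom_agree:
  assumes f: "partial_hom I f" and g: "partial_hom J g"
    and H: "ideal H R" "H \<noteq> {\<zero>}" "H \<subseteq> I \<inter> J" "\<And>x. x \<in> H \<Longrightarrow> f x = g x"
    and x: "x \<in> I \<inter> J"
  shows "f x = g x"
proof -
  note F = partial_homD[OF f] and G = partial_homD[OF g]
  have "(f x \<ominus> g x) \<otimes> h = \<zero>" if h: "h \<in> H" for h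
  proof -
    have hc: "h \<in> carrier R" using h H(1) ideal.Icarr by fast
    have "x \<otimes> h \<in> H" using h H(1) x F(4) ideal.I_l_closed by fastforce
    then have "f x \<otimes> h = g x \<otimes> h" using H(4) x hc F(6)[of x h] G(6)[of x h] by auto
    then show ?thesis using x hc F(3) G(3) by (simp add: minus_eq l_distr l_minus r_neg)
  qed
  then have "f x \<ominus> g x = \<zero>"
    using left_annihilator_zero[OF H(1,2)] x F(3) G(3) by auto
  then show ?thesis using x F(3) G(3) by auto
qed

lemma equiv_martindale: "equiv (martindale_pairs R) (martindale_rel R)"
proof (rule equivI)
  show "refl_on (martindale_pairs R) (martindale_rel R)"
    unfolding refl_on_def martindale_rel_def by auto
  show "martindale_rel R \<subseteq> martindale_pairs R \<times> martindale_pairs R"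
    unfolding martindale_rel_def by auto
  show "sym (martindale_rel R)"
    unfolding sym_def martindale_rel_def by auto
  show "trans (martindale_rel R)"
  proof (rule transI)
    fix p q r assume "(p, q) \<in> martindale_rel R" "(q, r) \<in> martindale_rel R"
    then obtain I f J g H h where e: "p = (I, f)" "q = (J, g)" "r = (H, h)"
      and P: "(I, f) \<in> martindale_pairs R" "(J, g) \<in> martindale_pairs R" "(H, h) \<in> martindale_pairs R"
      and fg: "\<forall>x\<in>I \<inter> J. f x = g x" and gh: "\<forall>x\<in>J \<inter> H. g x = h x"
      unfolding martindale_rel_def by auto
    have ext: "restrict f I = f" "restrict g J = g" "restrict h H = h"
      using P by (auto simp: martindale_pairs_def right_module_homs_def extensional_restrict)
    have m: "partial_hom I f" "partial_hom J g" "partial_hom H h"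
      using P by (simp_all flip: partial_hom_restrict_iff add: ext)
    note I = partial_homD(1,2)[OF m(1)] and J = partial_homD(1,2)[OF m(2)]
      and H = partial_homD(1,2)[OF m(3)]
    \<comment> \<open>The hypotheses compare \<open>f\<close> and \<open>h\<close> only inside
      \<open>J\<close>. By primeness the triple intersection is nonzero, and from there the
      agreement spreads to all of \<open>I \<inter> H\<close>.\<close>
    have "f x = h x" if "x \<in> I \<inter> H" for x
    proof (rule partial_hom_agree[OF m(1,3) _ _ _ _ that])
      show "ideal (I \<inter> H \<inter> J) R" using I J H by (intro i_intersect) auto
      show "I \<inter> H \<inter> J \<noteq> {\<zero>}" using I J H by (intro ideal_Int_nonzero i_intersect) auto
    qed (use fg gh in auto)
    then show "(p, r) \<in> martindale_rel R"
      using P unfolding e martindale_rel_def by auto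
  qed
qed

lemma martindale_class_eq_iff:
  assumes "partial_hom I f" "partial_hom J g"
  shows "martindale_class R I f = martindale_class R J g \<longleftrightarrow> (\<forall>x\<in>I \<inter> J. f x = g x)"
  unfolding martindale_class_def
  using eq_equiv_class_iff[OF equiv_martindale] assms
  by (auto simp: partial_hom_restrict_iff) (auto simp: martindale_rel_def partial_hom_restrict_iff)

lemma martindale_class_eqI:
  assumes "partial_hom I f" "partial_hom J g" "\<And>x. \<lbrakk>x \<in> I; x \<in> J\<rbrakk> \<Longrightarrow> f x = g x"
  shows "martindale_class R I f = martindale_class R J g"
  using martindale_class_eq_iff assms by auto

lemma martindale_class_memE:
  assumes "partial_hom I f" "p \<in> martindale_class R I f"
  obtains J g where "p = (J, g)" "partial_hom J g" "\<And>x. \<lbrakk>x \<in> I; x \<in> J\<rbrakk> \<Longrightarrow> f x = g x"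
proof -
  obtain J g where p: "p = (J, g)" "(J, g) \<in> martindale_pairs R" "\<forall>x\<in>I \<inter> J. f x = g x"
    using assms(2) unfolding martindale_class_def martindale_rel_def by auto
  have "restrict g J = g"
    using p by (auto simp: martindale_pairs_def right_module_homs_def extensional_restrict)
  then have "partial_hom J g" using p(2) by (simp flip: partial_hom_restrict_iff)
  then show ?thesis using that p by auto
qed

lemma martindale_class_self:
  "partial_hom I f \<Longrightarrow> (I, restrict f I) \<in> martindale_class R I f"
  unfolding martindale_class_def by (auto simp: martindale_rel_def partial_hom_restrict_iff)

section \<open>Arithmetic of classes of partial maps\<close>

lemma martindale_carrier:
  "carrier (martindale_ring R) = {martindale_class R I f | I f. partial_hom I f}"
proof (intro equalityI subsetI)
  fix z assume "z \<in> carrier (martindale_ring R)"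
  then obtain I f where z: "(I, f) \<in> martindale_pairs R" "z = martindale_rel R `` {(I, f)}"
    unfolding martindale_ring_def quotient_def by auto
  moreover have "restrict f I = f"
    using z by (auto simp: martindale_pairs_def right_module_homs_def extensional_restrict)
  ultimately have "partial_hom I f" "z = martindale_class R I f"
    by (simp_all add: martindale_class_def flip: partial_hom_restrict_iff)
  then show "z \<in> {martindale_class R I f | I f. partial_hom I f}" by blast
next
  fix z assume "z \<in> {martindale_class R I f | I f. partial_hom I f}"
  then show "z \<in> carrier (martindale_ring R)"
    unfolding martindale_ring_def quotient_def martindale_class_def
    by (auto simp flip: partial_hom_restrict_iff)
qed

text \<open>\<open>g (j \<otimes> i) = g j \<otimes> i\<close> lies in \<open>I\<close>. This
  explains the domain \<open>J \<cdot> I\<close> of a composition: it is a two-sided ideal, whereas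
  the preimage of \<open>I\<close> under \<open>g\<close> is in general only a right ideal.\<close>

lemma partial_hom_prod_mem:
  assumes "partial_hom J g" "ideal I R" "x \<in> J \<cdot> I"
  shows "x \<in> J" "g x \<in> I"
proof -
  note G = partial_homD[OF assms(1)]
  show "x \<in> J" using assms ideal_prod_inter[OF G(1) assms(2)] by blast
  show "g x \<in> I" using assms(3)
  proof induction
    case (prod j i)
    then show ?case using G(3,6) ideal.Icarr[OF assms(2)] ideal.I_l_closed[OF assms(2)] by simp
  next
    case (sum s t)
    then have "s \<in> J" "t \<in> J" using ideal_prod_inter[OF G(1) assms(2)] by auto
    then show ?case using sum G(5) additive_subgroup.a_closed[OF ideal.axioms(1)[OF assms(2)]] by simp
  qed
qed

lemma partial_hom_comp:
  assumes "partial_hom I f" "partial_hom J g"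
  shows "partial_hom (J \<cdot> I) (\<lambda>x. f (g x))"
  using ideal_prod_is_ideal ideal_prod_nonzero partial_homD[OF assms(1)] partial_homD[OF assms(2)]
    partial_hom_prod_mem[OF assms(2) partial_homD(1)[OF assms(1)]]
  unfolding partial_hom_def by auto

lemma partial_hom_add:
  assumes "partial_hom I f" "partial_hom J g"
  shows "partial_hom (I \<inter> J) (\<lambda>x. f x \<oplus> g x)"
  using i_intersect ideal_Int_nonzero partial_homD[OF assms(1)] partial_homD[OF assms(2)]
  unfolding partial_hom_def by (auto simp: l_distr a_ac)

lemma UN_pair_eq:
  assumes "p \<in> A" "\<And>x y. (x, y) \<in> A \<Longrightarrow> F x y = c"
  shows "(\<Union>(x, y)\<in>A. F x y) = c"
  using assms by (intro UN_constant_eq[of p]) auto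

text \<open>The product is a union over all representatives. Compositions of agreeing maps agree
  where both are defined, so all members of the union are the same class and the union
  collapses.\<close>

lemma martindale_mult:
  assumes f: "partial_hom I f" and g: "partial_hom J g"
  shows "martindale_class R I f \<otimes>\<^bsub>martindale_ring R\<^esub> martindale_class R J g =
    martindale_class R (J \<cdot> I) (\<lambda>x. f (g x))"
proof -
  have "martindale_class R (J' \<cdot> I') (\<lambda>x. f' (g' x)) = martindale_class R (J \<cdot> I) (\<lambda>x. f (g x))"
    if mem: "(I', f') \<in> martindale_class R I f" "(J', g') \<in> martindale_class R J g" for I' f' J' g'
  proof -
    obtain f': "partial_hom I' f'" "\<And>x. \<lbrakk>x \<in> I; x \<in> I'\<rbrakk> \<Longrightarrow> f x = f' x"
      using martindale_class_memE[OF f mem(1)] by blast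
    obtain g': "partial_hom J' g'" "\<And>x. \<lbrakk>x \<in> J; x \<in> J'\<rbrakk> \<Longrightarrow> g x = g' x"
      using martindale_class_memE[OF g mem(2)] by blast
    show ?thesis
    proof (rule martindale_class_eqI[OF partial_hom_comp[OF f'(1) g'(1)] partial_hom_comp[OF f g]])
      fix x assume "x \<in> J' \<cdot> I'" "x \<in> J \<cdot> I"
      then show "f' (g' x) = f (g x)"
        using f'(2) g'(2) partial_hom_prod_mem[OF g partial_homD(1)[OF f]]
          partial_hom_prod_mem[OF g'(1) partial_homD(1)[OF f'(1)]] by metis
    qed
  qed
  then have "(\<Union>(I', f')\<in>martindale_class R I f. \<Union>(J', g')\<in>martindale_class R J g.
      martindale_class R (J' \<cdot> I') (\<lambda>x. f' (g' x))) = martindale_class R (J \<cdot> I) (\<lambda>x. f (g x))"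
    by (intro UN_pair_eq[OF martindale_class_self[OF f]] UN_pair_eq[OF martindale_class_self[OF g]])
  then show ?thesis by (simp add: martindale_ring_def)
qed

lemma martindale_add:
  assumes f: "partial_hom I f" and g: "partial_hom J g"
  shows "martindale_class R I f \<oplus>\<^bsub>martindale_ring R\<^esub> martindale_class R J g =
    martindale_class R (I \<inter> J) (\<lambda>x. f x \<oplus> g x)"
proof -
  have "martindale_class R (I' \<inter> J') (\<lambda>x. f' x \<oplus> g' x) = martindale_class R (I \<inter> J) (\<lambda>x. f x \<oplus> g x)"
    if mem: "(I', f') \<in> martindale_class R I f" "(J', g') \<in> martindale_class R J g" for I' f' J' g'
  proof -
    obtain f': "partial_hom I' f'" "\<And>x. \<lbrakk>x \<in> I; x \<in> I'\<rbrakk> \<Longrightarrow> f x = f' x"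
      using martindale_class_memE[OF f mem(1)] by blast
    obtain g': "partial_hom J' g'" "\<And>x. \<lbrakk>x \<in> J; x \<in> J'\<rbrakk> \<Longrightarrow> g x = g' x"
      using martindale_class_memE[OF g mem(2)] by blast
    show ?thesis
      by (rule martindale_class_eqI[OF partial_hom_add[OF f'(1) g'(1)] partial_hom_add[OF f g]])
        (simp add: f' g')
  qed
  then have "(\<Union>(I', f')\<in>martindale_class R I f. \<Union>(J', g')\<in>martindale_class R J g.
      martindale_class R (I' \<inter> J') (\<lambda>x. f' x \<oplus> g' x)) = martindale_class R (I \<inter> J) (\<lambda>x. f x \<oplus> g x)"
    by (intro UN_pair_eq[OF martindale_class_self[OF f]] UN_pair_eq[OF martindale_class_self[OF g]])
  then show ?thesis by (simp add: martindale_ring_def)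
qed

lemma carrier_nonzero: "carrier R \<noteq> {\<zero>}"
  using one_neq_zero by auto

lemma partial_hom_left_mult: "a \<in> carrier R \<Longrightarrow> partial_hom (carrier R) (\<lambda>x. a \<otimes> x)"
  using oneideal carrier_nonzero unfolding partial_hom_def by (auto simp: r_distr m_assoc)

lemma partial_hom_id: "partial_hom (carrier R) (\<lambda>x. x)"
  using oneideal carrier_nonzero unfolding partial_hom_def by auto

lemma partial_hom_zero: "partial_hom (carrier R) (\<lambda>x. \<zero>)"
  using oneideal carrier_nonzero unfolding partial_hom_def by auto

lemma partial_hom_uminus: "partial_hom I f \<Longrightarrow> partial_hom I (\<lambda>x. \<ominus> f x)"
  unfolding partial_hom_def by (auto simp: minus_add l_minus a_ac)

text \<open>Each law holds pointwise wherever both of its sides are defined, and equality of classes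
  asks for no more, even if the two sides have different domains.\<close>

lemma ring_martindale: "ring (martindale_ring R)" (is "ring ?Q")
proof -
  have C: "martindale_class R I f \<in> carrier ?Q" if "partial_hom I f" for I f
    using that unfolding martindale_carrier by auto
  have E: thesis if "z \<in> carrier ?Q"
    "\<And>I f. \<lbrakk>z = martindale_class R I f; partial_hom I f\<rbrakk> \<Longrightarrow> thesis" for z thesis
    using that unfolding martindale_carrier by blast
  have Z: "\<zero>\<^bsub>?Q\<^esub> = martindale_class R (carrier R) (\<lambda>x. \<zero>)"
    "\<one>\<^bsub>?Q\<^esub> = martindale_class R (carrier R) (\<lambda>x. x)" by (simp_all add: martindale_ring_def)
  note ph = partial_hom_comp partial_hom_add partial_hom_id partial_hom_zero partial_hom_uminus
  note ops = martindale_mult martindale_add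
  show ?thesis
  proof (rule ringI)
    show "abelian_group ?Q"
    proof (rule abelian_groupI, goal_cases)
      case (1 x y)
      then show ?case by (elim E) (simp add: martindale_add C ph)
    next
      case 2
      show ?case unfolding Z by (intro C ph)
    next
      case (3 x y z)
      then obtain I f J g H h where e: "x = martindale_class R I f" "y = martindale_class R J g"
        "z = martindale_class R H h" and m: "partial_hom I f" "partial_hom J g" "partial_hom H h"
        by (elim E) blast
      note F = partial_homD(3)[OF m(1)] partial_homD(3)[OF m(2)] partial_homD(3)[OF m(3)]
      show ?case
        unfolding e by (simp add: ops ph m, intro martindale_class_eqI ph m) (simp add: F a_assoc)
    next
      case (4 x y)
      then obtain I f J g where e: "x = martindale_class R I f" "y = martindale_class R J g"
        and m: "partial_hom I f" "partial_hom J g"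
        by (elim E) blast
      note F = partial_homD(3)[OF m(1)] partial_homD(3)[OF m(2)]
      show ?case
        unfolding e by (simp add: ops ph m, intro martindale_class_eqI ph m) (simp add: F a_comm)
    next
      case (5 x)
      then obtain I f where e: "x = martindale_class R I f" and m: "partial_hom I f" by (elim E)
      show ?case
        unfolding e Z by (simp add: ops ph m, intro martindale_class_eqI ph m) (simp add: partial_homD(3)[OF m])
    next
      case (6 x)
      then obtain I f where x: "x = martindale_class R I f" "partial_hom I f" by (elim E)
      have "martindale_class R I (\<lambda>x. \<ominus> f x) \<oplus>\<^bsub>?Q\<^esub> x = \<zero>\<^bsub>?Q\<^esub>"
        unfolding Z x(1)
        using partial_hom_add[OF partial_hom_uminus[OF x(2)] x(2)]
        by (simp add: ops ph x(2), intro martindale_class_eqI ph) (auto simp: partial_homD(3)[OF x(2)] l_neg)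
      then show ?case using C[OF partial_hom_uminus[OF x(2)]] by blast
    qed
    show "monoid ?Q"
    proof (rule monoidI, goal_cases)
      case (1 x y)
      then show ?case by (elim E) (simp add: martindale_mult C ph)
    next
      case 2
      show ?case unfolding Z by (intro C ph)
    next
      case (3 x y z)
      then obtain I f J g H h where e: "x = martindale_class R I f" "y = martindale_class R J g"
        "z = martindale_class R H h" and m: "partial_hom I f" "partial_hom J g" "partial_hom H h"
        by (elim E) blast
      show ?case
        unfolding e by (simp add: ops ph m, intro martindale_class_eqI ph m) simp
    next
      case (4 x)
      then obtain I f where e: "x = martindale_class R I f" and m: "partial_hom I f" by (elim E)
      show ?case
        unfolding e Z by (simp add: ops ph m, intro martindale_class_eqI ph m) simp
    next
      case (5 x)
      then obtain I f where e: "x = martindale_class R I f" and m: "partial_hom I f" by (elim E)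
      show ?case
        unfolding e Z by (simp add: ops ph m, intro martindale_class_eqI ph m) simp
    qed
  next
    fix x y z assume "x \<in> carrier ?Q" "y \<in> carrier ?Q" "z \<in> carrier ?Q"
    then obtain I f J g H h where e: "x = martindale_class R I f" "y = martindale_class R J g"
      "z = martindale_class R H h" and m: "partial_hom I f" "partial_hom J g" "partial_hom H h"
      by (elim E) blast
    show "(x \<oplus>\<^bsub>?Q\<^esub> y) \<otimes>\<^bsub>?Q\<^esub> z = x \<otimes>\<^bsub>?Q\<^esub> z \<oplus>\<^bsub>?Q\<^esub> y \<otimes>\<^bsub>?Q\<^esub> z"
      unfolding e by (simp add: ops ph m, intro martindale_class_eqI ph m) simp
    have I: "f x \<in> H" "g y \<in> H" if "x \<in> I \<cdot> H" "y \<in> J \<cdot> H" for x y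
      using that partial_hom_prod_mem[OF m(1) partial_homD(1)[OF m(3)]]
        partial_hom_prod_mem[OF m(2) partial_homD(1)[OF m(3)]] by blast+
    show "z \<otimes>\<^bsub>?Q\<^esub> (x \<oplus>\<^bsub>?Q\<^esub> y) = z \<otimes>\<^bsub>?Q\<^esub> x \<oplus>\<^bsub>?Q\<^esub> z \<otimes>\<^bsub>?Q\<^esub> y"
      unfolding e
      by (simp add: ops ph m, intro martindale_class_eqI ph m) (use I partial_homD(5)[OF m(3)] in blast)
  qed
qed

section \<open>The centre of the Martindale ring of quotients\<close>

text \<open>A central class commutes with the classes of left multiplications by ring elements.\<close>

lemma martindale_center_left_linear:
  assumes f: "partial_hom I f" and z: "martindale_class R I f \<in> ring_center (martindale_ring R)"
    and a: "a \<in> carrier R" and x: "x \<in> I"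
  shows "f (a \<otimes> x) = a \<otimes> f x"
proof -
  note F = partial_homD[OF f] and L = partial_hom_left_mult[OF a]
  have "martindale_class R (carrier R) (\<lambda>x. a \<otimes> x) \<in> carrier (martindale_ring R)"
    using L unfolding martindale_carrier by blast
  then have "martindale_class R (carrier R \<cdot> I) (\<lambda>x. f (a \<otimes> x)) =
      martindale_class R (I \<cdot> carrier R) (\<lambda>x. a \<otimes> f x)"
    using z f L by (simp add: ring_center_def flip: martindale_mult)
  then have "\<forall>x\<in>(carrier R \<cdot> I) \<inter> (I \<cdot> carrier R). f (a \<otimes> x) = a \<otimes> f x"
    using martindale_class_eq_iff[OF partial_hom_comp[OF f L] partial_hom_comp[OF L f]] by simp
  \<comment> \<open>As the ring is unital, both products are all of \<open>I\<close>: the element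
    \<open>x\<close> is \<open>\<one> \<otimes> x\<close> and
    \<open>x \<otimes> \<one>\<close>.\<close>
  moreover have "x \<in> carrier R \<cdot> I" "x \<in> I \<cdot> carrier R"
    using ideal_prod.prod[of \<one> "carrier R" x I R] ideal_prod.prod[of x I \<one> "carrier R" R] F(4)[OF x] x
    by auto
  ultimately show ?thesis by blast
qed

text \<open>On a product \<open>j \<otimes> i\<close> of elements of \<open>J \<inter> I\<close>
  both compositions give \<open>g j \<otimes> f i\<close>, by left linearity of \<open>f\<close> and
  right linearity of \<open>g\<close>. Such products span a nonzero ideal, which suffices for
  comparing the classes.\<close>

lemma bimodule_hom_in_martindale_center:
  assumes f: "partial_hom I f"
    and lin: "\<And>a x. \<lbrakk>a \<in> carrier R; x \<in> I\<rbrakk> \<Longrightarrow> f (a \<otimes> x) = a \<otimes> f x"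
  shows "martindale_class R I f \<in> ring_center (martindale_ring R)"
proof -
  note F = partial_homD[OF f]
  have "martindale_class R I f \<otimes>\<^bsub>martindale_ring R\<^esub> y = y \<otimes>\<^bsub>martindale_ring R\<^esub> martindale_class R I f"
    if yc: "y \<in> carrier (martindale_ring R)" for y
  proof -
    obtain J g where y: "y = martindale_class R J g" "partial_hom J g"
      using yc unfolding martindale_carrier by blast
    note G = partial_homD[OF y(2)]
    note FG = partial_hom_comp[OF f y(2)] and GF = partial_hom_comp[OF y(2) f]
    have sub: "(J \<inter> I) \<cdot> (J \<inter> I) \<subseteq> J \<cdot> I \<inter> I \<cdot> J"
    proof
      fix x assume "x \<in> (J \<inter> I) \<cdot> (J \<inter> I)"
      then show "x \<in> J \<cdot> I \<inter> I \<cdot> J"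
        by induction (auto intro: ideal_prod.intros)
    qed
    have eq: "f (g x) = g (f x)" if "x \<in> (J \<inter> I) \<cdot> (J \<inter> I)" for x
      using that
    proof induction
      case (prod j i)
      then have ij: "i \<in> carrier R" "j \<in> carrier R" "i \<in> I" "j \<in> J" "j \<in> I" using F(4) by auto
      have "f (g (j \<otimes> i)) = g j \<otimes> f i" using ij lin G(3,6) by simp
      moreover have "g (f (j \<otimes> i)) = g j \<otimes> f i" using ij lin F(3) G(6) by simp
      ultimately show ?case by simp
    next
      case (sum s t)
      then have "g s \<in> I" "g t \<in> I" "f s \<in> J" "f t \<in> J" "s \<in> I" "t \<in> I" "s \<in> J" "t \<in> J"
        using sub partial_hom_prod_mem[OF f G(1)] partial_hom_prod_mem[OF y(2) F(1)] by auto
      then show ?case using sum F(5) G(5) by simp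
    qed
    have JI: "ideal (J \<inter> I) R" "J \<inter> I \<noteq> {\<zero>}"
      using F(1,2) G(1,2) by (auto intro: i_intersect dest: ideal_Int_nonzero)
    have "f (g x) = g (f x)" if "x \<in> J \<cdot> I" "x \<in> I \<cdot> J" for x
      by (rule partial_hom_agree[OF FG GF, of "(J \<inter> I) \<cdot> (J \<inter> I)"])
        (use JI sub eq that in \<open>auto intro: ideal_prod_is_ideal dest: ideal_prod_nonzero\<close>)
    then have "martindale_class R (J \<cdot> I) (\<lambda>x. f (g x)) = martindale_class R (I \<cdot> J) (\<lambda>x. g (f x))"
      by (intro martindale_class_eqI FG GF)
    then show ?thesis using f y by (simp add: martindale_mult)
  qed
  then show ?thesis using f unfolding ring_center_def martindale_carrier by blast
qed

lemma extended_centroid_simps: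
  "carrier (extended_centroid R) = ring_center (martindale_ring R)"
  "mult (extended_centroid R) = mult (martindale_ring R)"
  "add (extended_centroid R) = add (martindale_ring R)"
  "one (extended_centroid R) = one (martindale_ring R)"
  "zero (extended_centroid R) = zero (martindale_ring R)"
  by (simp_all add: extended_centroid_def)

end

lemma (in ring) ring_center_subring: "subring (ring_center R) R"
proof (rule subringI)
  fix x y assume "x \<in> ring_center R" "y \<in> ring_center R"
  then have x: "x \<in> carrier R" "\<And>z. z \<in> carrier R \<Longrightarrow> x \<otimes> z = z \<otimes> x"
    and y: "y \<in> carrier R" "\<And>z. z \<in> carrier R \<Longrightarrow> y \<otimes> z = z \<otimes> y"
    by (auto simp: ring_center_def)
  have "x \<otimes> y \<otimes> z = z \<otimes> (x \<otimes> y)" if z: "z \<in> carrier R" for z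
  proof -
    have "x \<otimes> y \<otimes> z = x \<otimes> z \<otimes> y" using x(1) y z by (simp add: m_assoc)
    then show ?thesis using x(2)[OF z] x(1) y(1) z by (simp add: m_assoc)
  qed
  then show "x \<otimes> y \<in> ring_center R" using x(1) y(1) by (simp add: ring_center_def)
  show "x \<oplus> y \<in> ring_center R" using x y by (simp add: ring_center_def l_distr r_distr)
qed (auto simp: ring_center_def l_minus r_minus)

lemma (in prime_ring) ring_extended_centroid: "ring (extended_centroid R)"
  unfolding extended_centroid_def
  using ring.subring_is_ring[OF ring_martindale ring.ring_center_subring[OF ring_martindale]] .

section \<open>Corners of prime rings\<close>

text \<open>Polynomials are coefficient lists, and \<open>map h\<close> is a bijection from those
  over \<open>K\<close> to those over its image which commutes with evaluation. This carries
  algebraicity from the centre of the corner to the extended centroid.\<close>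

lemma transcendental_inj_hom_iff:
  assumes "ring_hom_ring R S h" "inj_on h (carrier R)" "K \<subseteq> carrier R" "x \<in> carrier R"
  shows "ring.transcendental S (h ` K) (h x) \<longleftrightarrow> ring.transcendental R K x"
proof -
  interpret h: ring_hom_ring R S h by fact
  have z: "h a = \<zero>\<^bsub>S\<^esub> \<longleftrightarrow> a = \<zero>\<^bsub>R\<^esub>" if "a \<in> carrier R" for a
    using inj_onD[OF assms(2), of a "\<zero>\<^bsub>R\<^esub>"] that by auto
  \<comment> \<open>The leading coefficient has to stay nonzero, which is ensured by
    injectivity.\<close>
  have poly: "polynomial\<^bsub>S\<^esub> (h ` K) (map h p) \<longleftrightarrow> polynomial\<^bsub>R\<^esub> K p" if "set p \<subseteq> K" for p
    using that z assms(3) by (cases p) (auto simp: polynomial_def)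
  have carr: "carrier ((h ` K)[X]\<^bsub>S\<^esub>) = map h ` carrier (K[X]\<^bsub>R\<^esub>)"
  proof (intro equalityI subsetI)
    fix q assume "q \<in> carrier ((h ` K)[X]\<^bsub>S\<^esub>)"
    then have q: "polynomial\<^bsub>S\<^esub> (h ` K) q" by (simp add: univ_poly_def)
    then have "q \<in> lists (h ` K)" by (auto simp: polynomial_def)
    then obtain p where p: "set p \<subseteq> K" "q = map h p" unfolding lists_image by auto
    then show "q \<in> map h ` carrier (K[X]\<^bsub>R\<^esub>)" using poly q by (auto simp: univ_poly_def)
  next
    fix q assume "q \<in> map h ` carrier (K[X]\<^bsub>R\<^esub>)"
    then obtain p where p: "q = map h p" "polynomial\<^bsub>R\<^esub> K p" by (auto simp: univ_poly_def)
    then have "set p \<subseteq> K" by (auto simp: polynomial_def)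
    then show "q \<in> carrier ((h ` K)[X]\<^bsub>S\<^esub>)"
      using poly p by (simp add: univ_poly_def)
  qed
  have sub: "set p \<subseteq> carrier R" if "p \<in> carrier (K[X]\<^bsub>R\<^esub>)" for p
    using that assms(3) by (auto simp: univ_poly_def polynomial_def)
  have ev: "h.S.eval (map h p) (h x) = h (h.R.eval p x)" if "p \<in> carrier (K[X]\<^bsub>R\<^esub>)" for p
    using h.eval_hom'[OF assms(4) sub[OF that]] by simp
  have inj: "inj_on (map h) (carrier (K[X]\<^bsub>R\<^esub>))"
    by (rule inj_on_subset[OF inj_on_mapI[of _ "carrier (K[X]\<^bsub>R\<^esub>)"] subset_refl], rule inj_on_subset[OF assms(2)])
      (use sub in auto)
  have comp: "inj_on (\<lambda>p. h.S.eval (map h p) (h x)) (carrier (K[X]\<^bsub>R\<^esub>)) \<longleftrightarrow>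
      inj_on (\<lambda>p. h.R.eval p x) (carrier (K[X]\<^bsub>R\<^esub>))"
  proof -
    have "h.S.eval (map h p) (h x) = h.S.eval (map h q) (h x) \<longleftrightarrow> h.R.eval p x = h.R.eval q x"
      if "p \<in> carrier (K[X]\<^bsub>R\<^esub>)" "q \<in> carrier (K[X]\<^bsub>R\<^esub>)" for p q
      using ev that inj_on_eq_iff[OF assms(2)] h.R.eval_in_carrier sub assms(4) by simp
    then show ?thesis unfolding inj_on_def by blast
  qed
  have "ring.transcendental S (h ` K) (h x) \<longleftrightarrow>
      inj_on ((\<lambda>q. h.S.eval q (h x)) \<circ> map h) (carrier (K[X]\<^bsub>R\<^esub>))"
    unfolding h.S.transcendental_def carr using comp_inj_on_iff[OF inj] by blast
  then show ?thesis using comp by (simp add: h.R.transcendental_def comp_def)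
qed

locale corner = prime_ring +
  fixes w
  assumes w_closed [simp]: "w \<in> carrier R" and w_idem [simp]: "w \<otimes> w = w" and w_nonzero: "w \<noteq> \<zero>"
begin

definition D where "D = R\<lparr>carrier := {x \<in> carrier R. w \<otimes> x = x \<and> x \<otimes> w = x}, one := w\<rparr>"

lemma D_simps [simp]:
  "mult D = mult R" "add D = add R" "one D = w" "zero D = \<zero>"
  by (simp_all add: D_def)

lemma D_iff: "x \<in> carrier D \<longleftrightarrow> x \<in> carrier R \<and> w \<otimes> x = x \<and> x \<otimes> w = x"
  by (simp add: D_def)

lemma DD: "x \<in> carrier D \<Longrightarrow> x \<in> carrier R"
  "x \<in> carrier D \<Longrightarrow> w \<otimes> x = x" "x \<in> carrier D \<Longrightarrow> x \<otimes> w = x"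
  by (simp_all add: D_iff)

lemma w_D: "w \<in> carrier D"
  by (simp add: D_iff)

lemma corner_mem: "b \<in> carrier R \<Longrightarrow> w \<otimes> b \<otimes> w \<in> carrier D"
  by (simp add: D_iff m_assoc) (simp flip: m_assoc)

lemma ring_D: "ring D"
proof (rule ringI)
  show "abelian_group D"
  proof (rule abelian_groupI, goal_cases)
    case (6 x)
    then have "\<ominus> x \<in> carrier D" "\<ominus> x \<oplus> x = \<zero>" by (auto simp: D_iff l_minus r_minus l_neg)
    then show ?case by auto
  qed (auto simp: D_iff a_ac l_distr r_distr)
  show "monoid D"
  proof (rule monoidI, goal_cases)
    case (1 x y)
    then show ?case by (auto simp: D_iff m_assoc) (simp flip: m_assoc)
  qed (auto simp: D_iff m_assoc)
qed (auto simp: D_iff l_distr r_distr)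

text \<open>Since \<open>a = a \<otimes> w\<close> and \<open>b = w \<otimes> b\<close>, the product
  \<open>a \<otimes> x \<otimes> b\<close> depends on \<open>w \<otimes> x \<otimes> w\<close>
  only.\<close>

lemma corner_prime:
  assumes "a \<in> carrier D" "b \<in> carrier D" "\<And>x. x \<in> carrier D \<Longrightarrow> a \<otimes> x \<otimes> b = \<zero>"
  shows "a = \<zero> \<or> b = \<zero>"
proof (rule prime)
  fix x assume x: "x \<in> carrier R"
  have "a \<otimes> x \<otimes> b = (a \<otimes> w) \<otimes> x \<otimes> (w \<otimes> b)" using assms by (simp add: DD)
  also have "\<dots> = a \<otimes> (w \<otimes> x \<otimes> w) \<otimes> b" using assms x DD(1) by (simp add: m_assoc)
  finally show "a \<otimes> x \<otimes> b = \<zero>" using assms(3) corner_mem[OF x] by simp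
qed (use assms DD in auto)

text \<open>Primeness is applied twice, first between \<open>w\<close> and \<open>i\<close>, then
  between \<open>w \<otimes> x \<otimes> i\<close> and \<open>w\<close>.\<close>

lemma nonzero_corner_multiple:
  assumes "i \<in> carrier R" "i \<noteq> \<zero>"
  obtains x y where "x \<in> carrier R" "y \<in> carrier R" "w \<otimes> x \<otimes> i \<otimes> y \<otimes> w \<noteq> \<zero>"
proof -
  obtain x where x: "x \<in> carrier R" "w \<otimes> x \<otimes> i \<noteq> \<zero>"
    using prime[of w i] assms w_nonzero by auto
  then obtain y where "y \<in> carrier R" "w \<otimes> x \<otimes> i \<otimes> y \<otimes> w \<noteq> \<zero>"
    using prime[of "w \<otimes> x \<otimes> i" w] assms w_nonzero by auto
  then show ?thesis using that x by blast
qed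

lemma ideal_corner_nonzero:
  assumes I: "ideal I R" "I \<noteq> {\<zero>}"
  obtains a where "a \<in> I" "a \<in> carrier D" "a \<noteq> \<zero>"
proof -
  obtain i where i: "i \<in> I" "i \<noteq> \<zero>" "i \<in> carrier R" by (rule ideal_nonzeroE[OF I])
  obtain x y where xy: "x \<in> carrier R" "y \<in> carrier R" "w \<otimes> x \<otimes> i \<otimes> y \<otimes> w \<noteq> \<zero>"
    by (rule nonzero_corner_multiple[OF i(3,2)])
  have "w \<otimes> x \<otimes> i \<otimes> y \<otimes> w \<in> I"
    using i xy by (intro ideal.I_r_closed[OF I(1)] ideal.I_l_closed[OF I(1)]) auto
  moreover have "w \<otimes> x \<otimes> i \<otimes> y \<otimes> w \<in> carrier D"
    using corner_mem[of "x \<otimes> i \<otimes> y"] i xy by (simp add: m_assoc)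
  ultimately show ?thesis using that xy by blast
qed

subsection \<open>The extended centroid\<close>

text \<open>
  The central element \<open>d\<close> of the corner extends to the bimodule map on \<open>R w R\<close> taking
  \<open>\<Sum> a\<^sub>i w b\<^sub>i\<close> to \<open>\<Sum> a\<^sub>i d b\<^sub>i\<close>. The image \<open>y\<close> of \<open>x\<close> is determined by \<open>y b w = x b d\<close> for all \<open>b\<close>,
  which avoids choosing a representation of \<open>x\<close>.
\<close>

definition ext_dom where
  "ext_dom d = {x \<in> carrier R. \<exists>y\<in>carrier R. \<forall>b\<in>carrier R. y \<otimes> b \<otimes> w = x \<otimes> b \<otimes> d}"

definition ext_map where
  "ext_map d x = (THE y. y \<in> carrier R \<and> (\<forall>b\<in>carrier R. y \<otimes> b \<otimes> w = x \<otimes> b \<otimes> d))"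

definition ext_class where
  "ext_class d = martindale_class R (ext_dom d) (ext_map d)"

definition Z where "Z = ring_center D"

lemma Z_iff: "z \<in> Z \<longleftrightarrow> z \<in> carrier D \<and> (\<forall>x\<in>carrier D. z \<otimes> x = x \<otimes> z)"
  by (simp add: Z_def ring_center_def)

lemma subring_Z: "subring Z D"
  unfolding Z_def by (rule ring.ring_center_subring[OF ring_D])

lemma Z_D: "z \<in> Z \<Longrightarrow> z \<in> carrier D" "z \<in> Z \<Longrightarrow> z \<in> carrier R"
  by (auto simp: Z_iff DD)

text \<open>Centrality speaks of \<open>w \<otimes> b \<otimes> w\<close> only; the missing outer
  factors \<open>w\<close> are supplied by \<open>z\<close>. The result is the equation that
  characterises \<open>z\<close> as the value at \<open>w\<close> of the extension of
  \<open>z\<close>.\<close>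

lemma Z_commute:
  assumes z: "z \<in> Z" and b: "b \<in> carrier R"
  shows "z \<otimes> b \<otimes> w = w \<otimes> b \<otimes> z"
proof -
  have zD: "z \<in> carrier R" "w \<otimes> z = z" "z \<otimes> w = z" using z by (auto simp: Z_iff DD)
  have "z \<otimes> b \<otimes> w = z \<otimes> (w \<otimes> b \<otimes> w)" using zD b by (simp flip: m_assoc)
  also have "\<dots> = (w \<otimes> b \<otimes> w) \<otimes> z" using z corner_mem[OF b] by (simp add: Z_iff)
  finally show ?thesis using zD b by (simp add: m_assoc)
qed

text \<open>The difference \<open>y \<ominus> y'\<close> annihilates \<open>R w\<close> from the
  left, and \<open>w\<close> is nonzero.\<close>

lemma ext_unique:
  assumes "y \<in> carrier R" "y' \<in> carrier R" "\<And>b. b \<in> carrier R \<Longrightarrow> y \<otimes> b \<otimes> w = y' \<otimes> b \<otimes> w"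
  shows "y = y'"
proof -
  have "(y \<ominus> y') \<otimes> b \<otimes> w = \<zero>" if b: "b \<in> carrier R" for b
    using assms(1,2) b assms(3)[OF b] by (simp add: minus_eq l_distr l_minus r_neg)
  then have "y \<ominus> y' = \<zero>" using prime[of "y \<ominus> y'" w] w_nonzero assms by auto
  then show ?thesis using assms by simp
qed

lemma ext_mapI:
  assumes "x \<in> carrier R" "y \<in> carrier R" "\<And>b. b \<in> carrier R \<Longrightarrow> y \<otimes> b \<otimes> w = x \<otimes> b \<otimes> d"
  shows "x \<in> ext_dom d" "ext_map d x = y"
proof -
  show "x \<in> ext_dom d" using assms by (auto simp: ext_dom_def)
  show "ext_map d x = y"
    unfolding ext_map_def using assms by (intro the_equality) (auto intro: ext_unique)
qed

lemma ext_mapD: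
  assumes "x \<in> ext_dom d"
  shows "x \<in> carrier R" "ext_map d x \<in> carrier R"
    "\<And>b. b \<in> carrier R \<Longrightarrow> ext_map d x \<otimes> b \<otimes> w = x \<otimes> b \<otimes> d"
proof -
  show "x \<in> carrier R" using assms by (simp add: ext_dom_def)
  obtain y where y: "y \<in> carrier R" "\<And>b. b \<in> carrier R \<Longrightarrow> y \<otimes> b \<otimes> w = x \<otimes> b \<otimes> d"
    using assms by (auto simp: ext_dom_def)
  have "ext_map d x = y" using assms y by (intro ext_mapI) (simp_all add: ext_dom_def)
  then show "ext_map d x \<in> carrier R" "\<And>b. b \<in> carrier R \<Longrightarrow> ext_map d x \<otimes> b \<otimes> w = x \<otimes> b \<otimes> d"
    using y by simp_all
qed

lemma ext_w: "d \<in> Z \<Longrightarrow> w \<in> ext_dom d" "d \<in> Z \<Longrightarrow> ext_map d w = d"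
  using ext_mapI[of w d d] Z_commute by (simp_all add: Z_D)

lemma ext_add:
  assumes "d \<in> carrier R" "x \<in> ext_dom d" "y \<in> ext_dom d"
  shows "x \<oplus> y \<in> ext_dom d" "ext_map d (x \<oplus> y) = ext_map d x \<oplus> ext_map d y"
  using ext_mapI[of "x \<oplus> y" "ext_map d x \<oplus> ext_map d y" d] assms(1)
    ext_mapD[OF assms(2)] ext_mapD[OF assms(3)]
  by (simp_all add: l_distr)

lemma ext_left:
  assumes "d \<in> carrier R" "x \<in> ext_dom d" "a \<in> carrier R"
  shows "a \<otimes> x \<in> ext_dom d" "ext_map d (a \<otimes> x) = a \<otimes> ext_map d x"
  using ext_mapI[of "a \<otimes> x" "a \<otimes> ext_map d x" d] assms(1,3) ext_mapD[OF assms(2)]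
  by (simp_all add: m_assoc)

lemma ext_right:
  assumes "d \<in> carrier R" "x \<in> ext_dom d" "a \<in> carrier R"
  shows "x \<otimes> a \<in> ext_dom d" "ext_map d (x \<otimes> a) = ext_map d x \<otimes> a"
proof -
  have "ext_map d x \<otimes> a \<otimes> b \<otimes> w = x \<otimes> a \<otimes> b \<otimes> d" if "b \<in> carrier R" for b
    using ext_mapD[OF assms(2)] ext_mapD(3)[OF assms(2), of "a \<otimes> b"] assms that
    by (simp add: m_assoc)
  then show "x \<otimes> a \<in> ext_dom d" "ext_map d (x \<otimes> a) = ext_map d x \<otimes> a"
    using ext_mapI[of "x \<otimes> a" "ext_map d x \<otimes> a" d] assms(3) ext_mapD[OF assms(2)] by simp_all
qed

lemma partial_hom_ext:
  assumes d: "d \<in> Z"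
  shows "partial_hom (ext_dom d) (ext_map d)"
proof -
  note c = Z_D(2)[OF d]
  have z: "\<zero> \<in> ext_dom d" using ext_mapI[of \<zero> \<zero> d] c by simp
  have "ideal (ext_dom d) R"
    by (rule ideal_intro)
      (auto intro: z ext_mapD(1) ext_add(1)[OF c] ext_left(1)[OF c] ext_right(1)[OF c])
  moreover have "ext_dom d \<noteq> {\<zero>}" using ext_w(1)[OF d] w_nonzero by auto
  ultimately show ?thesis
    unfolding partial_hom_def by (simp add: ext_mapD(2) ext_add(2)[OF c] ext_right(2)[OF c])
qed

lemma ext_class_center: "d \<in> Z \<Longrightarrow> ext_class d \<in> carrier (extended_centroid R)"
  unfolding ext_class_def extended_centroid_simps
  by (rule bimodule_hom_in_martindale_center[OF partial_hom_ext]) (simp_all add: ext_left Z_D)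

text \<open>By uniqueness, a map that obeys the equation characterising \<open>ext_map d\<close>
  agrees with it on its own domain, whatever that is. Sums, products, the unit, scalars and
  arbitrary central classes are all identified in this way.\<close>

lemma ext_class_eqI:
  assumes "partial_hom I f" "d \<in> Z"
    and "\<And>x b. \<lbrakk>x \<in> I; b \<in> carrier R\<rbrakk> \<Longrightarrow> f x \<otimes> b \<otimes> w = x \<otimes> b \<otimes> d"
  shows "martindale_class R I f = ext_class d"
  unfolding ext_class_def
proof (rule martindale_class_eqI[OF assms(1) partial_hom_ext[OF assms(2)]])
  fix x assume "x \<in> I"
  then show "f x = ext_map d x"
    using ext_mapI(2)[of x "f x" d] partial_homD[OF assms(1)] assms(3) by simp
qed

text \<open>With \<open>f\<close> the multiplication by a scalar, this identifies the copy of
  \<open>K\<close> in the extended centroid with the scalar multiples of \<open>w\<close> in the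
  corner.\<close>

lemma ext_class_scalar:
  assumes "a \<in> ring_center R" "\<And>x. x \<in> carrier R \<Longrightarrow> f x = a \<otimes> x"
  shows "martindale_class R (carrier R) f = ext_class (a \<otimes> w)"
proof (rule ext_class_eqI)
  have a: "a \<in> carrier R" "\<And>x. x \<in> carrier R \<Longrightarrow> a \<otimes> x = x \<otimes> a"
    using assms(1) by (auto simp: ring_center_def)
  show "partial_hom (carrier R) f"
    using partial_hom_left_mult[OF a(1)] assms(2) unfolding partial_hom_def by simp
  have "a \<otimes> w \<in> carrier D"
  proof -
    have "w \<otimes> (a \<otimes> w) = w \<otimes> a \<otimes> w" using a(1) by (simp add: m_assoc)
    also have "\<dots> = a \<otimes> w" using a(1) a(2)[of w] by (simp add: m_assoc flip: a(2)[of w])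
    finally have "w \<otimes> (a \<otimes> w) = a \<otimes> w" .
    then show ?thesis using a by (simp add: D_iff m_assoc)
  qed
  moreover have "a \<otimes> w \<otimes> x = x \<otimes> (a \<otimes> w)" if "x \<in> carrier D" for x
  proof -
    note x = DD[OF that]
    have "a \<otimes> w \<otimes> x = a \<otimes> x" using x a(1) by (simp add: m_assoc)
    also have "\<dots> = x \<otimes> a" using a(2) x(1) .
    also have "\<dots> = x \<otimes> (w \<otimes> a)" using x a(1) by (simp flip: m_assoc)
    finally show ?thesis using a(2)[of w] by simp
  qed
  ultimately show "a \<otimes> w \<in> Z" by (simp add: Z_iff)
  show "f x \<otimes> b \<otimes> w = x \<otimes> b \<otimes> (a \<otimes> w)" if "x \<in> carrier R" "b \<in> carrier R" for x b
  proof -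
    have "f x \<otimes> b \<otimes> w = a \<otimes> (x \<otimes> b) \<otimes> w" using that a(1) assms(2) by (simp add: m_assoc)
    also have "\<dots> = x \<otimes> b \<otimes> a \<otimes> w" using a(2)[of "x \<otimes> b"] that by simp
    finally show ?thesis using that a(1) by (simp add: m_assoc)
  qed
qed

lemma ring_DZ: "ring (D\<lparr>carrier := Z\<rparr>)"
  by (rule ring.subring_is_ring[OF ring_D subring_Z])

lemma ext_class_hom: "ring_hom_ring (D\<lparr>carrier := Z\<rparr>) (extended_centroid R) ext_class"
proof (rule ring_hom_ringI[OF ring_DZ ring_extended_centroid])
  fix x y assume "x \<in> carrier (D\<lparr>carrier := Z\<rparr>)" "y \<in> carrier (D\<lparr>carrier := Z\<rparr>)"
  then have xy: "x \<in> Z" "y \<in> Z" by auto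
  note c = Z_D(2)[OF xy(1)] Z_D(2)[OF xy(2)]
  have Zc: "x \<oplus> y \<in> Z" "x \<otimes> y \<in> Z"
    using subringE(6,7)[OF subring_Z] xy by simp_all
  note P = partial_hom_ext[OF xy(1)] partial_hom_ext[OF xy(2)]
  have "martindale_class R (ext_dom y \<cdot> ext_dom x) (\<lambda>u. ext_map x (ext_map y u)) = ext_class (x \<otimes> y)"
  proof (rule ext_class_eqI[OF partial_hom_comp[OF P] Zc(2)])
    fix u b assume u: "u \<in> ext_dom y \<cdot> ext_dom x" and b: "b \<in> carrier R"
    note m = partial_hom_prod_mem[OF P(2) partial_homD(1)[OF P(1)] u]
    \<comment> \<open>Writing \<open>x\<close> as \<open>w \<otimes> x\<close> exposes the factor
      \<open>w\<close> to which the equation for \<open>ext_map y\<close> applies next.\<close>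
    have "ext_map x (ext_map y u) \<otimes> b \<otimes> w = ext_map y u \<otimes> b \<otimes> (w \<otimes> x)"
      using ext_mapD(3)[OF m(2) b] xy(1) by (simp add: Z_D DD)
    also have "\<dots> = ext_map y u \<otimes> b \<otimes> w \<otimes> x"
      using ext_mapD(2)[OF m(1)] b c by (simp add: m_assoc)
    also have "\<dots> = u \<otimes> b \<otimes> y \<otimes> x" using ext_mapD(3)[OF m(1) b] by simp
    also have "\<dots> = u \<otimes> b \<otimes> (y \<otimes> x)" using ext_mapD(1)[OF m(1)] b c by (simp add: m_assoc)
    also have "y \<otimes> x = x \<otimes> y" using xy unfolding Z_iff by blast
    finally show "ext_map x (ext_map y u) \<otimes> b \<otimes> w = u \<otimes> b \<otimes> (x \<otimes> y)" .
  qed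
  then show "ext_class (x \<otimes>\<^bsub>D\<lparr>carrier := Z\<rparr>\<^esub> y) = ext_class x \<otimes>\<^bsub>extended_centroid R\<^esub> ext_class y"
    using P by (simp add: extended_centroid_simps ext_class_def martindale_mult)
  have "martindale_class R (ext_dom x \<inter> ext_dom y) (\<lambda>u. ext_map x u \<oplus> ext_map y u) = ext_class (x \<oplus> y)"
  proof (rule ext_class_eqI[OF partial_hom_add[OF P] Zc(1)])
    fix u b assume u: "u \<in> ext_dom x \<inter> ext_dom y" and b: "b \<in> carrier R"
    then show "(ext_map x u \<oplus> ext_map y u) \<otimes> b \<otimes> w = u \<otimes> b \<otimes> (x \<oplus> y)"
      using ext_mapD[of u x] ext_mapD[of u y] c by (simp add: l_distr r_distr)
  qed
  then show "ext_class (x \<oplus>\<^bsub>D\<lparr>carrier := Z\<rparr>\<^esub> y) = ext_class x \<oplus>\<^bsub>extended_centroid R\<^esub> ext_class y"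
    using P by (simp add: extended_centroid_simps ext_class_def martindale_add)
next
  have "martindale_class R (carrier R) (\<lambda>x. x) = ext_class w"
    by (rule ext_class_eqI[OF partial_hom_id]) (auto simp: Z_iff D_iff)
  then show "ext_class \<one>\<^bsub>D\<lparr>carrier := Z\<rparr>\<^esub> = \<one>\<^bsub>extended_centroid R\<^esub>"
    unfolding extended_centroid_simps by (simp add: martindale_ring_def)
qed (simp add: ext_class_center)

text \<open>Evaluation at \<open>w\<close>, which lies in every domain \<open>ext_dom d\<close>,
  gives back the central element.\<close>

lemma ext_class_inj: "inj_on ext_class Z"
proof (rule inj_onI)
  fix x y assume xy: "x \<in> Z" "y \<in> Z" "ext_class x = ext_class y"
  then have "\<forall>u\<in>ext_dom x \<inter> ext_dom y. ext_map x u = ext_map y u"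
    using martindale_class_eq_iff[OF partial_hom_ext partial_hom_ext] unfolding ext_class_def by blast
  then show "x = y" using ext_w xy by (metis IntI)
qed

lemma algebraic_ext_class_iff:
  assumes "S \<subseteq> Z" "z \<in> Z"
  shows "(ring.algebraic (extended_centroid R) over (ext_class ` S)) (ext_class z) \<longleftrightarrow>
    (ring.algebraic D over S) z"
proof -
  have "ring.transcendental (D\<lparr>carrier := Z\<rparr>) = ring.transcendental D"
    using ring.transcendental_consistent[OF ring_D subring_Z] by simp
  then show ?thesis
    using transcendental_inj_hom_iff[OF ext_class_hom, of S z] ext_class_inj assms
    by (simp add: over_def)
qed

text \<open>Equivalently, the ideal generated by \<open>w\<close> is the least nonzero ideal of the
  ring.\<close>

definition full where
  "full \<longleftrightarrow> (\<forall>I. ideal I R \<longrightarrow> I \<noteq> {\<zero>} \<longrightarrow> w \<in> I)"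

text \<open>Now \<open>w\<close> lies in the domain \<open>I\<close>, so \<open>f w\<close> can be
  formed. Linearity on both sides gives \<open>f x \<otimes> b \<otimes> w = f (x \<otimes> b
  \<otimes> w) = x \<otimes> b \<otimes> f w\<close>, the equation of the extension of
  \<open>f w\<close>.\<close>

lemma full_ext_class_surj:
  assumes full and c: "c \<in> carrier (extended_centroid R)"
  obtains z where "z \<in> Z" "c = ext_class z"
proof -
  have cc: "c \<in> ring_center (martindale_ring R)" "c \<in> carrier (martindale_ring R)"
    using c by (auto simp: extended_centroid_simps ring_center_def)
  then obtain I f where e: "c = martindale_class R I f" and f: "partial_hom I f"
    unfolding martindale_carrier by blast
  note F = partial_homD[OF f]
  have w: "w \<in> I" using assms(1) F(1,2) by (simp add: full_def)
  have left: "f (a \<otimes> x) = a \<otimes> f x" if "a \<in> carrier R" "x \<in> I" for a x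
    using martindale_center_left_linear[OF f _ that] cc e by simp
  have "w \<otimes> f w = f w" "f w \<otimes> w = f w"
    using left[OF w_closed w] F(6)[OF w w_closed] by simp_all
  then have "f w \<in> carrier D" using F(3)[OF w] by (simp add: D_iff)
  moreover have "f w \<otimes> x = x \<otimes> f w" if "x \<in> carrier D" for x
    using left[OF _ w, of x] F(6)[OF w, of x] that by (simp add: DD)
  ultimately have z: "f w \<in> Z" unfolding Z_iff by blast
  have "c = ext_class (f w)"
    unfolding e
  proof (rule ext_class_eqI[OF f z])
    fix x b assume x: "x \<in> I" "b \<in> carrier R"
    have "f x \<otimes> b \<otimes> w = f (x \<otimes> b \<otimes> w)"
      using F(6)[of x b] F(6)[of "x \<otimes> b" w] x F(1) ideal.I_r_closed by fastforce
    then show "f x \<otimes> b \<otimes> w = x \<otimes> b \<otimes> f w" using left[OF _ w, of "x \<otimes> b"] x F(4) by simp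
  qed
  then show ?thesis using that z by blast
qed

end

section \<open>Primitive and locally closed prime ideals\<close>

context ring
begin

definition right_ideal where
  "right_ideal N \<longleftrightarrow> N \<subseteq> carrier R \<and> \<zero> \<in> N \<and> (\<forall>x\<in>N. \<forall>y\<in>N. x \<oplus> y \<in> N) \<and>
     (\<forall>x\<in>N. \<forall>a\<in>carrier R. x \<otimes> a \<in> N)"

lemma right_ideal_additive_subgroup:
  assumes "right_ideal N"
  shows "additive_subgroup N R"
proof (intro additive_subgroup.intro subgroup.intro)
  fix x assume x: "x \<in> N"
  then have "\<ominus> x = x \<otimes> (\<ominus> \<one>)" using assms by (auto simp: right_ideal_def r_minus)
  moreover have "x \<otimes> (\<ominus> \<one>) \<in> N" using assms x unfolding right_ideal_def by blast
  ultimately show "inv\<^bsub>add_monoid R\<^esub> x \<in> N" by (simp add: a_inv_def)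
qed (use assms in \<open>auto simp: right_ideal_def\<close>)

text \<open>The module is the quotient of the ring by the maximal right ideal \<open>m\<close>. Its
  elements are cosets and so have the type that \<open>primitive_ideal\<close> prescribes.\<close>

lemma simple_right_module_quotient:
  assumes m: "right_ideal m" "\<one> \<notin> m"
    and max: "\<And>N. \<lbrakk>right_ideal N; m \<subseteq> N\<rbrakk> \<Longrightarrow> N = m \<or> N = carrier R"
  shows "\<exists>M :: ('a, 'a set) module. simple_right_module R M \<and>
    annihilator R M = {a \<in> carrier R. \<forall>x\<in>carrier R. x \<otimes> a \<in> m}"
proof -
  interpret m: abelian_subgroup m R
    by (rule abelian_subgroupI3[OF right_ideal_additive_subgroup[OF m(1)] abelian_group_axioms])
  have sub: "subgroup m (add_monoid R)" by (rule m.a_subgroup)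
  have mr: "x \<otimes> a \<in> m" if "x \<in> m" "a \<in> carrier R" for x a
    using m(1) that unfolding right_ideal_def by blast
  define q where "q x = m +> x" for x
  have q_eq: "q x = q y \<longleftrightarrow> x \<ominus> y \<in> m" if "x \<in> carrier R" "y \<in> carrier R" for x y
  proof -
    have "q x = q y \<longleftrightarrow> x \<in> q y"
      using m.a_rcos_self[OF that(1)] a_repr_independence[OF _ that(2) sub] unfolding q_def by blast
    also have "\<dots> \<longleftrightarrow> x \<ominus> y \<in> m"
      using m.a_rcos_module[OF that(2,1)] unfolding q_def minus_eq by simp
    finally show ?thesis .
  qed
  have q0: "q \<zero> = m" unfolding q_def by (rule a_coset_add_zero) (rule m.a_subset)
  have qm: "q x = m \<longleftrightarrow> x \<in> m" if "x \<in> carrier R" for x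
    using q_eq[OF that zero_closed] that by (simp add: q0 minus_eq)
  \<comment> \<open>The action on a coset goes through a chosen representative; as \<open>m\<close>
    absorbs right factors, \<open>Mact\<close> holds for every representative.\<close>
  define r where "r A = (SOME x. x \<in> carrier R \<and> q x = A)" for A
  have r: "r (q x) \<in> carrier R" "q (r (q x)) = q x" if "x \<in> carrier R" for x
    using someI[of "\<lambda>y. y \<in> carrier R \<and> q y = q x" x] that unfolding r_def by auto
  define M :: "('a, 'a set) module" where
    "M = \<lparr>carrier = q ` carrier R, mult = undefined, one = undefined, zero = m,
          add = (\<lambda>A B. A <+> B), smult = (\<lambda>a A. q (r A \<otimes> a))\<rparr>"
  have M [simp]: "carrier M = q ` carrier R" "zero M = m" by (simp_all add: M_def)
  have Madd [simp]: "q x \<oplus>\<^bsub>M\<^esub> q y = q (x \<oplus> y)" if "x \<in> carrier R" "y \<in> carrier R" for x y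
    using m.a_rcos_sum[OF that] by (simp add: M_def q_def)
  have Mact [simp]: "a \<odot>\<^bsub>M\<^esub> q x = q (x \<otimes> a)" if "x \<in> carrier R" "a \<in> carrier R" for x a
  proof -
    have "(r (q x) \<ominus> x) \<otimes> a \<in> m" using q_eq[of "r (q x)" x] r that mr by simp
    then have "r (q x) \<otimes> a \<ominus> x \<otimes> a \<in> m" using that r by (simp add: minus_eq l_distr l_minus)
    then show ?thesis using q_eq r that by (simp add: M_def)
  qed
  interpret M: abelian_group M
  proof (rule abelian_groupI, goal_cases)
    case (6 A)
    then obtain x where "x \<in> carrier R" "A = q x" by auto
    then show ?case by (auto simp: l_neg q0 intro!: bexI[of _ "\<ominus> x"])
  qed (auto simp: a_ac simp flip: q0)
  interpret M: right_module R M
    by unfold_locales (auto simp: r_distr l_distr m_assoc)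
  have neg: "\<ominus>\<^bsub>M\<^esub> q x = q (\<ominus> x)" if "x \<in> carrier R" for x
    using that by (intro M.minus_equality) (auto simp: l_neg q0)
  have "simple_right_module R M"
  proof (unfold_locales, goal_cases)
    case 1
    have "q \<one> \<noteq> m" using qm[OF one_closed] m(2) by simp
    then show ?case by auto
  next
    case (2 N)
    then interpret N: additive_subgroup N M by (simp add: right_submodule_def)
    have act: "q (x \<otimes> a) \<in> N" if "q x \<in> N" "x \<in> carrier R" "a \<in> carrier R" for x a
      using 2 that unfolding right_submodule_def by force
    let ?N = "{x \<in> carrier R. q x \<in> N}"
    have sum: "q (x \<oplus> y) \<in> N" if "q x \<in> N" "q y \<in> N" "x \<in> carrier R" "y \<in> carrier R" for x y
      using N.a_closed[OF that(1,2)] that by simp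
    have "right_ideal ?N"
      unfolding right_ideal_def using N.zero_closed by (auto simp: q0 sum act)
    moreover have "m \<subseteq> ?N" using qm m.a_subset N.zero_closed by auto
    ultimately consider "?N = m" | "?N = carrier R" using max by blast
    then show ?case
    proof cases
      case 1
      have "A = m" if "A \<in> N" for A
      proof -
        obtain x where x: "x \<in> carrier R" "A = q x" using \<open>A \<in> N\<close> N.a_subset by auto
        then have "x \<in> m" using 1 \<open>A \<in> N\<close> by blast
        then show ?thesis using qm x by simp
      qed
      moreover have "m \<in> N" using N.zero_closed by simp
      ultimately have "N = {m}" by blast
      then show ?thesis by simp
    next
      case 2
      then have "q x \<in> N" if "x \<in> carrier R" for x using that by blast
      then have "q ` carrier R \<subseteq> N" by blast
      then have "N = carrier M" using N.a_subset by simp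
      then show ?thesis by simp
    qed
  qed
  moreover have "annihilator R M = {a \<in> carrier R. \<forall>x\<in>carrier R. x \<otimes> a \<in> m}"
    unfolding annihilator_def by (intro Collect_cong conj_cong refl) (simp add: qm)
  ultimately show ?thesis by blast
qed

end

section \<open>Primitivity and prime ideals seen from the corner\<close>

context corner
begin

text \<open>A right ideal containing both \<open>\<one> \<ominus> w\<close> and \<open>w\<close> is
  everything. So a right ideal that is maximal among those containing the former and missing the
  latter is maximal among all proper ones. The annihilator of its quotient module is a two-sided
  ideal missing \<open>w\<close>, hence zero by \<open>full\<close>.\<close>

lemma full_imp_primitive:
  assumes full
  shows "primitive_ideal R {\<zero>}"
proof -
  define A where "A = {N. right_ideal N \<and> \<one> \<ominus> w \<in> N \<and> w \<notin> N}"
  \<comment> \<open>The right annihilator of \<open>w\<close> starts Zorn's lemma: it contains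
    \<open>\<one> \<ominus> w\<close>, but not the nonzero idempotent \<open>w\<close>.\<close>
  have "{x \<in> carrier R. w \<otimes> x = \<zero>} \<in> A"
    unfolding A_def using w_nonzero by (auto simp: right_ideal_def r_distr minus_eq r_minus r_neg simp flip: m_assoc)
  then have ne: "A \<noteq> {}" by blast
  have "\<exists>m\<in>A. \<forall>B\<in>A. m \<subseteq> B \<longrightarrow> B = m"
  proof (rule subset_Zorn_nonempty[OF ne])
    fix C assume C: "C \<noteq> {}" "subset.chain A C"
    have mem: "B \<in> A" if "B \<in> C" for B using C(2) that unfolding subset.chain_def A_def by blast
    have "x \<oplus> y \<in> \<Union>C" if xy: "x \<in> \<Union>C" "y \<in> \<Union>C" for x y
    proof -
      obtain B E where "B \<in> C" "E \<in> C" "x \<in> B" "y \<in> E" using xy by blast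
      moreover from this have "B \<subseteq> E \<or> E \<subseteq> B" using C(2) unfolding subset.chain_def by blast
      ultimately obtain U where U: "U \<in> C" "x \<in> U" "y \<in> U" by blast
      then have "x \<oplus> y \<in> U" using mem[OF U(1)] by (simp add: right_ideal_def A_def)
      then show ?thesis using U(1) by blast
    qed
    moreover have "x \<otimes> a \<in> \<Union>C" if "x \<in> \<Union>C" "a \<in> carrier R" for x a
      using mem that unfolding right_ideal_def A_def by blast
    moreover have "\<Union>C \<subseteq> carrier R" using mem unfolding right_ideal_def A_def by blast
    moreover obtain B where "B \<in> C" using C(1) by blast
    then have "\<zero> \<in> \<Union>C" "\<one> \<ominus> w \<in> \<Union>C" using mem unfolding right_ideal_def A_def by blast+
    moreover have "w \<notin> \<Union>C" using mem unfolding A_def by blast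
    ultimately show "\<Union>C \<in> A" unfolding right_ideal_def A_def by simp
  qed
  then obtain m where m: "right_ideal m" "\<one> \<ominus> w \<in> m" "w \<notin> m"
    and max: "\<And>B. \<lbrakk>right_ideal B; \<one> \<ominus> w \<in> B; w \<notin> B; m \<subseteq> B\<rbrakk> \<Longrightarrow> B = m"
    unfolding A_def by blast
  have one: "B = carrier R" if B: "right_ideal B" "\<one> \<in> B" for B
  proof -
    have "a \<in> B" if "a \<in> carrier R" for a
    proof -
      have "\<one> \<otimes> a \<in> B" using B that unfolding right_ideal_def by blast
      then show ?thesis using that by simp
    qed
    then show ?thesis using B unfolding right_ideal_def by blast
  qed
  have "\<one> \<notin> m" using one[OF m(1)] m(3) by auto
  moreover have "N = m \<or> N = carrier R" if N: "right_ideal N" "m \<subseteq> N" for N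
  proof (cases "w \<in> N")
    case True
    then have "(\<one> \<ominus> w) \<oplus> w \<in> N" using N m(2) unfolding right_ideal_def by blast
    then have "\<one> \<in> N" by (simp add: minus_eq a_assoc l_neg)
    then show ?thesis using one N(1) by blast
  qed (use max[OF N(1)] N m(2) in blast)
  ultimately obtain M :: "('a, 'a set) module" where M: "simple_right_module R M"
    and ann: "annihilator R M = {a \<in> carrier R. \<forall>x\<in>carrier R. x \<otimes> a \<in> m}"
    using simple_right_module_quotient[OF m(1)] by blast
  have "ideal (annihilator R M) R"
    unfolding ann
  proof (rule ideal_intro, goal_cases)
    case (5 a x)
    then have "y \<otimes> x \<otimes> a \<in> m" if "y \<in> carrier R" for y
      using m(1) that unfolding right_ideal_def by blast
    then show ?case using 5 by (simp add: m_assoc)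
  qed (use m(1) in \<open>auto simp: right_ideal_def r_distr simp flip: m_assoc\<close>)
  moreover have "w \<notin> annihilator R M"
  proof
    assume "w \<in> annihilator R M"
    then have "\<one> \<otimes> w \<in> m" unfolding ann by blast
    then show False using m(3) by simp
  qed
  ultimately have "annihilator R M = {\<zero>}" using assms unfolding full_def by blast
  then show ?thesis using M unfolding primitive_ideal_def by blast
qed

text \<open>As \<open>d\<close> acts nontrivially, there is \<open>n\<close> in \<open>M w\<close>
  with \<open>n d\<close> nonzero, and simplicity yields \<open>u\<close> in the corner with
  \<open>n d u = n\<close>. Then \<open>e = d u - w\<close> kills \<open>n\<close>. Since
  \<open>n\<close> generates \<open>M\<close> and the corner is commutative,
  \<open>n c e = n (w c w) e = n e (w c w) = 0\<close> for all \<open>c\<close>, so \<open>e\<close>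
  kills \<open>M\<close> and vanishes by faithfulness.\<close>

lemma primitive_imp_corner_field:
  assumes prim: "primitive_ideal R {\<zero>}"
    and comm: "\<And>x y. \<lbrakk>x \<in> carrier D; y \<in> carrier D\<rbrakk> \<Longrightarrow> x \<otimes> y = y \<otimes> x"
    and d: "d \<in> carrier D" "d \<noteq> \<zero>"
  shows "\<exists>u\<in>carrier D. d \<otimes> u = w"
proof -
  obtain M :: "('a, 'a set) module" where M: "simple_right_module R M" "{\<zero>} = annihilator R M"
    using prim unfolding primitive_ideal_def by blast
  interpret M: simple_right_module R M by (rule M(1))
  note dR = DD[OF d(1)]
  have "d \<notin> annihilator R M" using M(2) d(2) by blast
  then obtain m where m: "m \<in> carrier M" "d \<odot>\<^bsub>M\<^esub> m \<noteq> \<zero>\<^bsub>M\<^esub>"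
    using dR(1) unfolding annihilator_def by blast
  define n where "n = w \<odot>\<^bsub>M\<^esub> m"
  have n: "n \<in> carrier M" "w \<odot>\<^bsub>M\<^esub> n = n" "d \<odot>\<^bsub>M\<^esub> m = d \<odot>\<^bsub>M\<^esub> n"
    using m(1) dR by (simp_all add: n_def M.act_closed flip: M.act_assoc)
  then have "n \<noteq> \<zero>\<^bsub>M\<^esub>" using m(2) M.act_zero[OF dR(1)] by auto
  obtain b where b: "b \<in> carrier R" "b \<odot>\<^bsub>M\<^esub> (d \<odot>\<^bsub>M\<^esub> n) = n"
    using M.cyclic[OF M.act_closed[OF dR(1) n(1)] m(2)[unfolded n(3)] n(1)] by blast
  define u where "u = w \<otimes> b \<otimes> w"
  have u: "u \<in> carrier D" unfolding u_def by (rule corner_mem[OF b(1)])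
  have "(d \<otimes> u) \<odot>\<^bsub>M\<^esub> n = ((d \<otimes> w) \<otimes> b \<otimes> w) \<odot>\<^bsub>M\<^esub> n"
    using dR(1) b(1) by (simp add: u_def m_assoc)
  also have "\<dots> = n" using dR b n(1,2) by (simp add: M.act_assoc M.act_closed)
  finally have dun: "(d \<otimes> u) \<odot>\<^bsub>M\<^esub> n = n" .
  note uR = DD[OF u]
  define e where "e = d \<otimes> u \<ominus> w"
  have e: "e \<in> carrier D"
    unfolding e_def using dR uR by (simp add: D_iff minus_eq r_distr l_distr r_minus l_minus m_assoc)
      (simp flip: m_assoc)
  note eR = DD[OF e]
  have "e \<odot>\<^bsub>M\<^esub> n \<oplus>\<^bsub>M\<^esub> w \<odot>\<^bsub>M\<^esub> n = (d \<otimes> u) \<odot>\<^bsub>M\<^esub> n"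
    using dR(1) uR(1) n(1) eR(1) by (simp flip: M.act_add_ring add: e_def minus_eq a_assoc l_neg)
  then have en: "e \<odot>\<^bsub>M\<^esub> n = \<zero>\<^bsub>M\<^esub>"
    using dun n(1,2) M.act_closed[OF eR(1) n(1)] by simp
  have "e \<odot>\<^bsub>M\<^esub> m' = \<zero>\<^bsub>M\<^esub>" if m': "m' \<in> carrier M" for m'
  proof -
    obtain c where c: "c \<in> carrier R" "c \<odot>\<^bsub>M\<^esub> n = m'"
      using M.cyclic[OF n(1) \<open>n \<noteq> \<zero>\<^bsub>M\<^esub>\<close> m'] by blast
    define c' where "c' = w \<otimes> c \<otimes> w"
    have c': "c' \<in> carrier D" unfolding c'_def by (rule corner_mem[OF c(1)])
    have "e \<odot>\<^bsub>M\<^esub> m' = (w \<otimes> e) \<odot>\<^bsub>M\<^esub> (c \<odot>\<^bsub>M\<^esub> (w \<odot>\<^bsub>M\<^esub> n))" using c n(2) eR(2) by simp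
    also have "\<dots> = (c' \<otimes> e) \<odot>\<^bsub>M\<^esub> n"
      using n(1) c(1) eR(1) by (simp add: c'_def M.act_closed M.act_assoc)
    also have "\<dots> = (e \<otimes> c') \<odot>\<^bsub>M\<^esub> n" using comm[OF c' e] by simp
    also have "\<dots> = c' \<odot>\<^bsub>M\<^esub> (e \<odot>\<^bsub>M\<^esub> n)" using DD(1)[OF c'] eR(1) n(1) by (simp add: M.act_assoc)
    finally show ?thesis using en M.act_zero DD(1)[OF c'] by simp
  qed
  then have "e \<in> annihilator R M" using eR(1) by (simp add: annihilator_def)
  then have "e = \<zero>" using M(2) by blast
  then have "d \<otimes> u = w" using dR(1) uR(1) by (simp add: e_def)
  then show ?thesis using u by blast
qed

text \<open>A nonzero ideal meets the corner in a nonzero element, which is now a unit of the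
  corner.\<close>

lemma corner_field_imp_full:
  assumes "\<And>d. \<lbrakk>d \<in> carrier D; d \<noteq> \<zero>\<rbrakk> \<Longrightarrow> \<exists>u\<in>carrier D. d \<otimes> u = w"
  shows full
  unfolding full_def
proof (intro allI impI)
  fix I assume I: "ideal I R" "I \<noteq> {\<zero>}"
  obtain a where a: "a \<in> I" "a \<in> carrier D" "a \<noteq> \<zero>" by (rule ideal_corner_nonzero[OF I])
  then obtain u where "u \<in> carrier D" "a \<otimes> u = w" using assms by blast
  then show "w \<in> I" using ideal.I_r_closed[OF I(1) a(1), of u] DD(1) by simp
qed

text \<open>An ideal that is maximal among those containing \<open>t\<close> and missing the
  idempotent \<open>w\<close> is prime: two ideals not below it yield \<open>w\<close> modulo it,
  and so would their product, as \<open>w = w \<otimes> w\<close>. Commutativity of the corner and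
  non-invertibility of \<open>t\<close> provide an ideal to start from.\<close>

lemma exists_prime_avoiding:
  assumes comm: "\<And>x y. \<lbrakk>x \<in> carrier D; y \<in> carrier D\<rbrakk> \<Longrightarrow> x \<otimes> y = y \<otimes> x"
    and t: "t \<in> carrier D" and nonunit: "\<And>v. v \<in> carrier D \<Longrightarrow> t \<otimes> v \<noteq> w"
  obtains Q where "Q \<in> Spec R" "t \<in> Q" "w \<notin> Q"
proof -
  note tR = DD[OF t]
  define A where "A = {N. ideal N R \<and> t \<in> N \<and> w \<notin> N}"
  \<comment> \<open>This is the largest ideal whose compression by \<open>w\<close> on both sides
    falls into the principal ideal \<open>t D\<close> of the corner.\<close>
  let ?I = "{x \<in> carrier R. \<forall>a\<in>carrier R. \<forall>b\<in>carrier R.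
     w \<otimes> (a \<otimes> x \<otimes> b) \<otimes> w \<in> (\<lambda>v. t \<otimes> v) ` carrier D}"
  have add: "t \<otimes> u \<oplus> t \<otimes> v \<in> (\<lambda>v. t \<otimes> v) ` carrier D" if "u \<in> carrier D" "v \<in> carrier D" for u v
    using that tR(1) ring.ring_simprules(1)[OF ring_D that] DD(1)[OF that(1)] DD(1)[OF that(2)]
    by (auto simp: r_distr intro!: image_eqI[of _ _ "u \<oplus> v"])
  have "ideal ?I R"
  proof (rule ideal_intro, goal_cases)
    case 2
    have "\<zero> \<in> carrier D" by (simp add: D_iff)
    moreover have "t \<otimes> \<zero> = \<zero>" using tR by simp
    ultimately have "\<zero> \<in> (\<lambda>v. t \<otimes> v) ` carrier D" by (metis imageI)
    then show ?case by simp
  next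
    case (3 x y)
    have "w \<otimes> (a \<otimes> (x \<oplus> y) \<otimes> b) \<otimes> w \<in> (\<lambda>v. t \<otimes> v) ` carrier D"
      if ab: "a \<in> carrier R" "b \<in> carrier R" for a b
    proof -
      obtain u v where uv: "u \<in> carrier D" "v \<in> carrier D"
        "w \<otimes> (a \<otimes> x \<otimes> b) \<otimes> w = t \<otimes> u" "w \<otimes> (a \<otimes> y \<otimes> b) \<otimes> w = t \<otimes> v"
        using 3 ab by blast
      have "w \<otimes> (a \<otimes> (x \<oplus> y) \<otimes> b) \<otimes> w = t \<otimes> u \<oplus> t \<otimes> v"
        using 3 ab by (simp add: r_distr l_distr flip: uv(3,4))
      then show ?thesis using add uv by simp
    qed
    then show ?case using 3 by simp
  next
    case (4 c x)
    have "w \<otimes> (a \<otimes> (c \<otimes> x) \<otimes> b) \<otimes> w \<in> (\<lambda>v. t \<otimes> v) ` carrier D"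
      if ab: "a \<in> carrier R" "b \<in> carrier R" for a b
    proof -
      have "a \<otimes> c \<in> carrier R" using 4 ab by simp
      then have "w \<otimes> (a \<otimes> c \<otimes> x \<otimes> b) \<otimes> w \<in> (\<lambda>v. t \<otimes> v) ` carrier D" using 4 ab by blast
      then show ?thesis using 4 ab by (simp add: m_assoc)
    qed
    then show ?case using 4 by simp
  next
    case (5 c x)
    have "w \<otimes> (a \<otimes> (x \<otimes> c) \<otimes> b) \<otimes> w \<in> (\<lambda>v. t \<otimes> v) ` carrier D"
      if ab: "a \<in> carrier R" "b \<in> carrier R" for a b
    proof -
      have "c \<otimes> b \<in> carrier R" using 5 ab by simp
      then have "w \<otimes> (a \<otimes> x \<otimes> (c \<otimes> b)) \<otimes> w \<in> (\<lambda>v. t \<otimes> v) ` carrier D" using 5 ab by blast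
      then show ?thesis using 5 ab by (simp add: m_assoc)
    qed
    then show ?case using 5 by simp
  qed auto
  moreover have "t \<in> ?I"
  proof -
    have "w \<otimes> (a \<otimes> t \<otimes> b) \<otimes> w \<in> (\<lambda>v. t \<otimes> v) ` carrier D"
      if ab: "a \<in> carrier R" "b \<in> carrier R" for a b
    proof -
      \<comment> \<open>The factors \<open>w\<close> hidden in \<open>t\<close> split the product
        into three corner elements, and commutativity moves \<open>t\<close> to the front.\<close>
      have "w \<otimes> (a \<otimes> t \<otimes> b) \<otimes> w = w \<otimes> (a \<otimes> (w \<otimes> t \<otimes> w) \<otimes> b) \<otimes> w" using tR by simp
      also have "\<dots> = (w \<otimes> a \<otimes> w) \<otimes> t \<otimes> (w \<otimes> b \<otimes> w)" using ab tR(1) by (simp add: m_assoc)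
      also have "\<dots> = t \<otimes> ((w \<otimes> a \<otimes> w) \<otimes> (w \<otimes> b \<otimes> w))"
        using comm[OF corner_mem[OF ab(1)] t] ab tR(1) by (simp add: m_assoc)
      finally show ?thesis
        using ring.ring_simprules(5)[OF ring_D corner_mem[OF ab(1)] corner_mem[OF ab(2)]] by simp
    qed
    then show ?thesis using tR(1) by simp
  qed
  moreover have "w \<notin> ?I"
  proof
    assume "w \<in> ?I"
    then have "w \<otimes> (\<one> \<otimes> w \<otimes> \<one>) \<otimes> w \<in> (\<lambda>v. t \<otimes> v) ` carrier D" by blast
    then show False using nonunit by auto
  qed
  ultimately have ne: "A \<noteq> {}" unfolding A_def by blast
  have "\<exists>Q\<in>A. \<forall>B\<in>A. Q \<subseteq> B \<longrightarrow> B = Q"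
  proof (rule subset_Zorn_nonempty[OF ne])
    fix C assume C: "C \<noteq> {}" "subset.chain A C"
    have mem: "ideal B R" "t \<in> B" "w \<notin> B" if "B \<in> C" for B
      using C(2) that unfolding subset.chain_def A_def by blast+
    obtain B where B: "B \<in> C" using C(1) by blast
    have "ideal (\<Union>C) R"
    proof (rule ideal_intro)
      show "\<Union>C \<subseteq> carrier R" using ideal.Icarr[OF mem(1)] by blast
      have "\<zero> \<in> B" using additive_subgroup.zero_closed[OF ideal.axioms(1)[OF mem(1)[OF B]]] .
      then show "\<zero> \<in> \<Union>C" using B by blast
      show "x \<oplus> y \<in> \<Union>C" if xy: "x \<in> \<Union>C" "y \<in> \<Union>C" for x y
      proof -
        obtain B E where "B \<in> C" "E \<in> C" "x \<in> B" "y \<in> E" using xy by blast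
        moreover from this have "B \<subseteq> E \<or> E \<subseteq> B" using C(2) unfolding subset.chain_def by blast
        ultimately obtain U where U: "U \<in> C" "x \<in> U" "y \<in> U" by blast
        then have "x \<oplus> y \<in> U"
          using additive_subgroup.a_closed[OF ideal.axioms(1)[OF mem(1)[OF U(1)]]] by blast
        then show ?thesis using U(1) by blast
      qed
      show "a \<otimes> x \<in> \<Union>C" "x \<otimes> a \<in> \<Union>C" if "a \<in> carrier R" "x \<in> \<Union>C" for a x
        using that ideal.I_l_closed[OF mem(1)] ideal.I_r_closed[OF mem(1)] by blast+
    qed
    then show "\<Union>C \<in> A" unfolding A_def using mem B by blast
  qed
  then obtain Q where Q: "ideal Q R" "t \<in> Q" "w \<notin> Q"
    and max: "\<And>B. \<lbrakk>ideal B R; t \<in> B; w \<notin> B; Q \<subseteq> B\<rbrakk> \<Longrightarrow> B = Q"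
    unfolding A_def by blast
  interpret Q: ideal Q R by (rule Q(1))
  have above: "\<exists>q\<in>Q. \<exists>i\<in>I. w = q \<oplus> i" if I: "ideal I R" "\<not> I \<subseteq> Q" for I
  proof -
    have sum: "q \<oplus> i \<in> Q <+> I" if "q \<in> Q" "i \<in> I" for q i
      using that by (auto simp: set_add_defs)
    have "Q \<subseteq> Q <+> I"
      using sum[OF _ additive_subgroup.zero_closed[OF ideal.axioms(1)[OF I(1)]]] Q.Icarr by fastforce
    moreover have "I \<subseteq> Q <+> I"
      using sum[OF Q.zero_closed] ideal.Icarr[OF I(1)] by fastforce
    ultimately have "w \<in> Q <+> I" using max[OF add_ideals[OF Q(1) I(1)]] Q(2) I(2) by blast
    then show ?thesis by (auto simp: set_add_defs)
  qed
  have "prime_ideal R Q"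
    unfolding prime_ideal_def
  proof (intro conjI allI impI)
    show "Q \<noteq> carrier R" using Q(3) by auto
    fix I J assume I: "ideal I R" and J: "ideal J R" and IJ: "I \<cdot> J \<subseteq> Q"
    show "I \<subseteq> Q \<or> J \<subseteq> Q"
    proof (rule ccontr)
      assume "\<not> ?thesis"
      then obtain q i q' j where w: "q \<in> Q" "i \<in> I" "w = q \<oplus> i" "q' \<in> Q" "j \<in> J" "w = q' \<oplus> j"
        using above[OF I] above[OF J] by blast
      have c: "q \<in> carrier R" "i \<in> carrier R" "q' \<in> carrier R" "j \<in> carrier R"
        using w Q.Icarr ideal.Icarr[OF I] ideal.Icarr[OF J] by auto
      have "i \<otimes> j \<in> Q" using IJ ideal_prod.prod[OF w(2,5), of R] by blast
      \<comment> \<open>After expansion every term has a factor in \<open>Q\<close>, except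
        \<open>i \<otimes> j\<close>, which lies in \<open>Q\<close> by the assumption on the
        product.\<close>
      have "w = (q \<oplus> i) \<otimes> (q' \<oplus> j)" using w_idem w(3,6) by simp
      also have "\<dots> = q \<otimes> (q' \<oplus> j) \<oplus> (i \<otimes> q' \<oplus> i \<otimes> j)" using c by (simp add: l_distr r_distr a_ac)
      finally have "w = q \<otimes> (q' \<oplus> j) \<oplus> (i \<otimes> q' \<oplus> i \<otimes> j)" .
      moreover have "\<dots> \<in> Q"
        using c \<open>i \<otimes> j \<in> Q\<close> Q.I_r_closed[OF w(1), of "q' \<oplus> j"] Q.I_l_closed[OF w(4), of i]
        by (simp add: Q.a_closed)
      ultimately show False using Q(3) by simp
    qed
  qed (rule Q(1))
  then show ?thesis using that Q by (simp add: Spec_def)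
qed

end

text \<open>An element witnessing that the nonzero primes intersect in more than zero. If there are
  no nonzero primes, every nonzero element qualifies, in accordance with the empty intersection
  being the whole ring.\<close>

definition (in ring) zero_locally_closed where
  "zero_locally_closed \<longleftrightarrow> (\<exists>d\<in>carrier R. d \<noteq> \<zero> \<and> (\<forall>Q\<in>Spec R. Q \<noteq> {\<zero>} \<longrightarrow> d \<in> Q))"

context corner
begin

lemma full_imp_locally_closed: "full \<Longrightarrow> zero_locally_closed"
  unfolding zero_locally_closed_def full_def Spec_def prime_ideal_def
  using w_closed w_nonzero by blast

text \<open>The element \<open>d\<close> is a corner multiple of an element common to all nonzero
  primes, and behaves almost like a member of the Jacobson radical: a nonzero non-unit
  \<open>w \<ominus> d \<otimes> u\<close> would lie in a prime missing \<open>w\<close>, and this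
  prime would contain \<open>d\<close> and hence \<open>w\<close>.\<close>

lemma locally_closed_imp_corner_units:
  assumes lc: zero_locally_closed
    and comm: "\<And>x y. \<lbrakk>x \<in> carrier D; y \<in> carrier D\<rbrakk> \<Longrightarrow> x \<otimes> y = y \<otimes> x"
  obtains d where "d \<in> carrier D" "d \<noteq> \<zero>"
    "\<And>u. u \<in> carrier D \<Longrightarrow> w \<ominus> d \<otimes> u = \<zero> \<or> (\<exists>v\<in>carrier D. (w \<ominus> d \<otimes> u) \<otimes> v = w)"
proof -
  obtain c where c: "c \<in> carrier R" "c \<noteq> \<zero>" "\<And>Q. \<lbrakk>Q \<in> Spec R; Q \<noteq> {\<zero>}\<rbrakk> \<Longrightarrow> c \<in> Q"
    using lc unfolding zero_locally_closed_def by blast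
  obtain x y where xy: "x \<in> carrier R" "y \<in> carrier R" "w \<otimes> x \<otimes> c \<otimes> y \<otimes> w \<noteq> \<zero>"
    by (rule nonzero_corner_multiple[OF c(1,2)])
  define d where "d = w \<otimes> x \<otimes> c \<otimes> y \<otimes> w"
  have dD: "d \<in> carrier D"
    unfolding d_def using corner_mem[of "x \<otimes> c \<otimes> y"] c(1) xy by (simp add: m_assoc)
  have dQ: "d \<in> Q" if Q: "Q \<in> Spec R" "Q \<noteq> {\<zero>}" for Q
  proof -
    have I: "ideal Q R" using Q by (simp add: Spec_def prime_ideal_def)
    show ?thesis
      unfolding d_def
      using ideal.I_r_closed[OF I ideal.I_l_closed[OF I c(3)[OF Q], of "w \<otimes> x"], of "y \<otimes> w"] xy c(1)
      by (simp add: m_assoc)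
  qed
  have "w \<ominus> d \<otimes> u = \<zero> \<or> (\<exists>v\<in>carrier D. (w \<ominus> d \<otimes> u) \<otimes> v = w)" if u: "u \<in> carrier D" for u
  proof (rule ccontr)
    assume neg: "\<not> ?thesis"
    have cR: "d \<in> carrier R" "u \<in> carrier R" using dD u DD by auto
    have t: "w \<ominus> d \<otimes> u \<in> carrier D"
      using DD[OF dD] DD[OF u]
      by (simp add: D_iff minus_eq r_distr l_distr r_minus l_minus m_assoc) (simp flip: m_assoc)
    obtain Q where Q: "Q \<in> Spec R" "w \<ominus> d \<otimes> u \<in> Q" "w \<notin> Q"
      using exists_prime_avoiding[OF comm t] neg by blast
    \<comment> \<open>Here the alternative \<open>w \<ominus> d \<otimes> u = \<zero>\<close> has to
      be excluded, as the prime might otherwise be the zero ideal.\<close>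
    then have "Q \<noteq> {\<zero>}" using neg by blast
    then have "d \<in> Q" using dQ Q(1) by blast
    have I: "ideal Q R" using Q by (simp add: Spec_def prime_ideal_def)
    have "(w \<ominus> d \<otimes> u) \<oplus> d \<otimes> u \<in> Q"
      using additive_subgroup.a_closed[OF ideal.axioms(1)[OF I] Q(2) ideal.I_r_closed[OF I \<open>d \<in> Q\<close> cR(2)]] .
    moreover have "(w \<ominus> d \<otimes> u) \<oplus> d \<otimes> u = w" using cR by (simp add: minus_eq a_assoc l_neg)
    ultimately show False using Q(3) by simp
  qed
  then show ?thesis using that[OF dD] xy(3) by (simp add: d_def)
qed

end

section \<open>Passing to the quotient by a prime ideal\<close>

text \<open>The closure of \<open>{P}\<close> consists of the primes above \<open>P\<close>. An open
  set that cuts out \<open>P\<close> from it is given by an ideal not below \<open>P\<close>, and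
  any element of this ideal outside \<open>P\<close> will do.\<close>

lemma (in ring) locally_closed_prime_iff:
  assumes P: "P \<in> Spec R"
  shows "locally_closed_prime R P \<longleftrightarrow> (\<exists>d\<in>carrier R. d \<notin> P \<and> (\<forall>Q\<in>Spec R. P \<subset> Q \<longrightarrow> d \<in> Q))"
proof -
  have id: "ideal Q R" if "Q \<in> Spec R" for Q using that by (simp add: Spec_def prime_ideal_def)
  have op: "openin (zariski R) (Spec R - {Q \<in> Spec R. I \<subseteq> Q})" if "ideal I R" for I
    unfolding openin_zariski using that by blast
  have mem: "Q \<in> zariski R closure_of {P} \<longleftrightarrow> Q \<in> Spec R \<and> (\<forall>T. Q \<in> T \<and> openin (zariski R) T \<longrightarrow> P \<in> T)" for Q
    by (simp add: in_closure_of topspace_zariski)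
  have cl: "zariski R closure_of {P} = {Q \<in> Spec R. P \<subseteq> Q}"
  proof (intro equalityI subsetI)
    fix Q assume Q: "Q \<in> zariski R closure_of {P}"
    then have QS: "Q \<in> Spec R" and all: "\<And>T. \<lbrakk>Q \<in> T; openin (zariski R) T\<rbrakk> \<Longrightarrow> P \<in> T"
      unfolding mem by auto
    have "P \<subseteq> Q"
    proof (rule ccontr)
      assume "\<not> P \<subseteq> Q"
      then have "Q \<in> Spec R - {Q \<in> Spec R. P \<subseteq> Q}" using QS by simp
      then have "P \<in> Spec R - {Q \<in> Spec R. P \<subseteq> Q}"
        by (rule all[OF _ op[OF id[OF P]]])
      then show False by simp
    qed
    then show "Q \<in> {Q \<in> Spec R. P \<subseteq> Q}" using QS by simp
  next
    fix Q assume "Q \<in> {Q \<in> Spec R. P \<subseteq> Q}"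
    then have Q: "Q \<in> Spec R" "P \<subseteq> Q" by auto
    have "P \<in> T" if T: "Q \<in> T" "openin (zariski R) T" for T
    proof -
      obtain I where I: "T = Spec R - {P \<in> Spec R. I \<subseteq> P}" using T(2) unfolding openin_zariski by auto
      then have "\<not> I \<subseteq> Q" using T(1) by simp
      then have "\<not> I \<subseteq> P" using Q(2) by auto
      then show ?thesis using I P by simp
    qed
    then show "Q \<in> zariski R closure_of {P}" using Q(1) unfolding mem by simp
  qed
  show ?thesis
  proof
    assume "locally_closed_prime R P"
    then obtain T where T: "openin (zariski R) T" "{P} = T \<inter> {Q \<in> Spec R. P \<subseteq> Q}"
      unfolding locally_closed_prime_def openin_subtopology cl by auto
    obtain I where I: "ideal I R" "T = Spec R - {P \<in> Spec R. I \<subseteq> P}"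
      using T(1) unfolding openin_zariski by auto
    have "P \<in> T" using T(2) by auto
    then have "\<not> I \<subseteq> P" using I(2) P by simp
    then obtain d where d: "d \<in> I" "d \<notin> P" by blast
    have "d \<in> Q" if "Q \<in> Spec R" "P \<subset> Q" for Q using that T(2) I(2) d(1) by blast
    then show "\<exists>d\<in>carrier R. d \<notin> P \<and> (\<forall>Q\<in>Spec R. P \<subset> Q \<longrightarrow> d \<in> Q)"
      using d ideal.Icarr[OF I(1)] by blast
  next
    assume "\<exists>d\<in>carrier R. d \<notin> P \<and> (\<forall>Q\<in>Spec R. P \<subset> Q \<longrightarrow> d \<in> Q)"
    then obtain d where d: "d \<in> carrier R" "d \<notin> P" "\<And>Q. \<lbrakk>Q \<in> Spec R; P \<subset> Q\<rbrakk> \<Longrightarrow> d \<in> Q" by blast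
    \<comment> \<open>The basic open set of the primes that miss \<open>d\<close>.\<close>
    let ?T = "Spec R - {Q \<in> Spec R. Idl {d} \<subseteq> Q}"
    have T: "?T = {Q \<in> Spec R. d \<notin> Q}"
    proof -
      have "Idl {d} \<subseteq> Q \<longleftrightarrow> d \<in> Q" if "Q \<in> Spec R" for Q
        using Idl_subset_ideal[OF id[OF that], of "{d}"] d(1) by simp
      then show ?thesis by auto
    qed
    have "openin (zariski R) ?T"
      using d(1) by (intro op genideal_ideal) simp
    moreover have "{P} = ?T \<inter> {Q \<in> Spec R. P \<subseteq> Q}" unfolding T using d P by blast
    ultimately show "locally_closed_prime R P"
      unfolding locally_closed_prime_def openin_subtopology cl by (intro exI[of _ ?T] conjI)
  qed
qed

text \<open>The rings are linked by a relation \<open>c\<close> instead of a map, so that one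
  argument serves both directions along a surjection: inflation of modules, and descent of modules
  that the kernel annihilates.\<close>

lemma primitive_ideal_transport:
  fixes M :: "('a, 'm, 's) module_scheme" and S :: "('b, 't) ring_scheme"
  assumes M: "simple_right_module R M" and S: "ring S"
    and total: "\<And>s. s \<in> carrier S \<Longrightarrow> \<exists>r\<in>carrier R. c s r"
      "\<And>r. r \<in> carrier R \<Longrightarrow> \<exists>s\<in>carrier S. c s r"
    and ops: "\<And>s s' r r'. \<lbrakk>s \<in> carrier S; s' \<in> carrier S; r \<in> carrier R; r' \<in> carrier R; c s r; c s' r'\<rbrakk> \<Longrightarrow>
        c (s \<oplus>\<^bsub>S\<^esub> s') (r \<oplus>\<^bsub>R\<^esub> r') \<and> c (s \<otimes>\<^bsub>S\<^esub> s') (r \<otimes>\<^bsub>R\<^esub> r')" "c \<one>\<^bsub>S\<^esub> \<one>\<^bsub>R\<^esub>"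
    and act: "\<And>s r m. \<lbrakk>s \<in> carrier S; r \<in> carrier R; c s r; m \<in> carrier M\<rbrakk> \<Longrightarrow> act s m = r \<odot>\<^bsub>M\<^esub> m"
  shows "primitive_ideal S {s \<in> carrier S. \<forall>m\<in>carrier M. act s m = \<zero>\<^bsub>M\<^esub>}"
proof -
  interpret R: simple_right_module R M by (rule M)
  interpret S: ring S by (rule S)
  define M' :: "('b, 'm) module" where
    "M' = \<lparr>carrier = carrier M, mult = undefined, one = undefined, zero = \<zero>\<^bsub>M\<^esub>,
       add = add M, smult = act\<rparr>"
  have M' [simp]: "carrier M' = carrier M" "zero M' = zero M" "add M' = add M" "smult M' = act"
    by (simp_all add: M'_def)
  interpret M': abelian_group M'
  proof (rule abelian_groupI, goal_cases)
    case (6 x)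
    then show ?case by (auto intro!: bexI[of _ "\<ominus>\<^bsub>M\<^esub> x"] R.M.l_neg)
  qed (auto simp: R.M.a_ac)
  have neg: "\<ominus>\<^bsub>M'\<^esub> x = \<ominus>\<^bsub>M\<^esub> x" if "x \<in> carrier M" for x
    using that by (intro M'.minus_equality) (auto simp: R.M.l_neg)
  interpret M': right_module S M'
  proof (unfold_locales, goal_cases)
    case (1 a m)
    then show ?case using total(1) act R.act_closed by fastforce
  next
    case (2 a b m)
    then obtain r r' where r: "r \<in> carrier R" "c a r" "r' \<in> carrier R" "c b r'" using total(1) by metis
    then have "act (a \<oplus>\<^bsub>S\<^esub> b) m = (r \<oplus>\<^bsub>R\<^esub> r') \<odot>\<^bsub>M\<^esub> m" using 2 ops(1) by (intro act) auto
    then show ?case using 2 r act by (simp add: R.act_add_ring)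
  next
    case (3 a m n)
    then obtain r where r: "r \<in> carrier R" "c a r" using total(1) by metis
    then show ?case using 3 act by (simp add: R.act_add_module)
  next
    case (4 a b m)
    then obtain r r' where r: "r \<in> carrier R" "c a r" "r' \<in> carrier R" "c b r'" using total(1) by metis
    then have "act (a \<otimes>\<^bsub>S\<^esub> b) m = (r \<otimes>\<^bsub>R\<^esub> r') \<odot>\<^bsub>M\<^esub> m" using 4 ops(1) by (intro act) auto
    then show ?case using 4 r act by (simp add: R.act_assoc R.act_closed)
  next
    case (5 m)
    then show ?case using act[OF _ _ ops(2)] R.act_one by simp
  qed
  have "simple_right_module S M'"
  proof (unfold_locales, goal_cases)
    case 1
    then show ?case using R.nonzero by simp
  next
    case (2 N)
    then interpret N: additive_subgroup N M' by (simp add: right_submodule_def)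
    have sub: "N \<subseteq> carrier M" using N.a_subset by simp
    have "additive_subgroup N M"
    proof (intro additive_subgroup.intro subgroup.intro)
      fix x assume x: "x \<in> N"
      then have "x \<in> carrier M" using sub by blast
      then have "\<ominus>\<^bsub>M\<^esub> x \<in> N" using N.a_inv_closed[OF x] unfolding neg[OF \<open>x \<in> carrier M\<close>] by simp
      then show "inv\<^bsub>add_monoid M\<^esub> x \<in> N" by (simp add: a_inv_def)
    qed (use sub N.a_closed N.zero_closed in auto)
    moreover have "a \<odot>\<^bsub>M\<^esub> m \<in> N" if am: "a \<in> carrier R" "m \<in> N" for a m
    proof -
      obtain s where s: "s \<in> carrier S" "c s a" using total(2) am by blast
      have "act s m \<in> N" using 2 am s(1) unfolding right_submodule_def by simp
      moreover have "m \<in> carrier M" using am(2) sub by blast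
      ultimately show ?thesis using act[OF s(1) am(1) s(2)] by simp
    qed
    ultimately have "right_submodule R M N" by (simp add: right_submodule_def)
    then show ?case using R.simple by simp
  qed
  from primitive_idealI[OF this] show ?thesis by (simp add: annihilator_def)
qed

section \<open>Primes, primitivity and local closedness along a surjective homomorphism\<close>

locale surj_ring_hom = ring_hom_ring R S h for R (structure) and S (structure) and h +
  assumes surj: "h ` carrier R = carrier S"
begin

definition Ker where "Ker = {x \<in> carrier R. h x = \<zero>\<^bsub>S\<^esub>}"

lemma surjE:
  assumes "y \<in> carrier S"
  obtains x where "x \<in> carrier R" "y = h x"
  using assms surj by blast

lemma Ker_diff:
  assumes "x \<in> carrier R" "y \<in> carrier R" "h x = h y"
  shows "x \<ominus>\<^bsub>R\<^esub> y \<in> Ker"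
  using assms by (simp add: Ker_def R.minus_eq S.r_neg)

lemma vimage_ideal:
  assumes "ideal J S"
  shows "ideal {x \<in> carrier R. h x \<in> J} R"
proof -
  interpret J: ideal J S by (rule assms)
  show ?thesis
    by (rule R.ideal_intro) (auto intro: J.I_l_closed J.I_r_closed)
qed

lemma image_ideal:
  assumes "ideal I R"
  shows "ideal (h ` I) S"
proof -
  interpret I: ideal I R by (rule assms)
  show ?thesis
  proof (rule S.ideal_intro)
    show "h ` I \<subseteq> carrier S" using I.Icarr by auto
    have "h \<zero>\<^bsub>R\<^esub> \<in> h ` I" by (intro imageI I.zero_closed)
    then show "\<zero>\<^bsub>S\<^esub> \<in> h ` I" by simp
  next
    fix x y assume "x \<in> h ` I" "y \<in> h ` I"
    then obtain u v where uv: "u \<in> I" "v \<in> I" "x = h u" "y = h v" by blast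
    then have "x \<oplus>\<^bsub>S\<^esub> y = h (u \<oplus>\<^bsub>R\<^esub> v)" using I.Icarr by simp
    then show "x \<oplus>\<^bsub>S\<^esub> y \<in> h ` I" using I.a_closed uv by blast
  next
    fix a x assume "a \<in> carrier S" "x \<in> h ` I"
    then obtain b u where bu: "b \<in> carrier R" "a = h b" "u \<in> I" "x = h u" by (auto elim: surjE)
    then have "a \<otimes>\<^bsub>S\<^esub> x = h (b \<otimes>\<^bsub>R\<^esub> u)" "x \<otimes>\<^bsub>S\<^esub> a = h (u \<otimes>\<^bsub>R\<^esub> b)" using I.Icarr by simp_all
    then show "a \<otimes>\<^bsub>S\<^esub> x \<in> h ` I" "x \<otimes>\<^bsub>S\<^esub> a \<in> h ` I"
      using I.I_l_closed[OF bu(3,1)] I.I_r_closed[OF bu(3,1)] by simp_all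
  qed
qed

lemma image_mem_iff:
  assumes "ideal I R" "Ker \<subseteq> I" "x \<in> carrier R"
  shows "h x \<in> h ` I \<longleftrightarrow> x \<in> I"
proof
  interpret I: ideal I R by (rule assms)
  assume "h x \<in> h ` I"
  then obtain u where u: "u \<in> I" "h x = h u" by blast
  then have uc: "u \<in> carrier R" using I.Icarr by blast
  have "(x \<ominus>\<^bsub>R\<^esub> u) \<oplus>\<^bsub>R\<^esub> u \<in> I"
    using Ker_diff[OF assms(3) uc u(2)] assms(2) u(1) by (intro I.a_closed) auto
  then show "x \<in> I" using uc assms(3) by (simp add: R.minus_eq R.a_assoc R.l_neg)
qed auto

lemma ideal_prod_image:
  assumes "s \<in> I \<cdot>\<^bsub>R\<^esub> J" "I \<subseteq> carrier R" "J \<subseteq> carrier R"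
  shows "s \<in> carrier R \<and> h s \<in> h ` I \<cdot>\<^bsub>S\<^esub> h ` J"
  using assms(1)
proof induction
  case (prod i j)
  then have "i \<in> carrier R" "j \<in> carrier R" using assms(2,3) by blast+
  then show ?case using prod ideal_prod.prod[of "h i" "h ` I" "h j" "h ` J" S] by simp
next
  case (sum s t)
  then show ?case by (auto intro: ideal_prod.sum)
qed

lemma ideal_prod_image':
  assumes "s \<in> h ` I \<cdot>\<^bsub>S\<^esub> h ` J" "I \<subseteq> carrier R" "J \<subseteq> carrier R"
  shows "\<exists>r\<in>I \<cdot>\<^bsub>R\<^esub> J. s = h r"
  using assms(1)
proof induction
  case (prod i j)
  then obtain i' j' where ij: "i' \<in> I" "j' \<in> J" "i = h i'" "j = h j'" by blast
  then have "i' \<in> carrier R" "j' \<in> carrier R" using assms(2,3) by blast+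
  then have "i \<otimes>\<^bsub>S\<^esub> j = h (i' \<otimes>\<^bsub>R\<^esub> j')" using ij by simp
  then show ?case using ideal_prod.prod[OF ij(1,2), of R] by blast
next
  case (sum s t)
  then obtain r r' where r: "r \<in> I \<cdot>\<^bsub>R\<^esub> J" "r' \<in> I \<cdot>\<^bsub>R\<^esub> J" "s = h r" "t = h r'" by blast
  then have "s \<oplus>\<^bsub>S\<^esub> t = h (r \<oplus>\<^bsub>R\<^esub> r')" using ideal_prod_image[OF _ assms(2,3)] by auto
  then show ?case using ideal_prod.sum[OF r(1,2)] by blast
qed

lemma vimage_prime:
  assumes "Q \<in> Spec S"
  shows "{x \<in> carrier R. h x \<in> Q} \<in> Spec R"
proof -
  let ?Q = "{x \<in> carrier R. h x \<in> Q}"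
  have Q: "ideal Q S" "Q \<noteq> carrier S"
    and prime: "\<And>I J. \<lbrakk>ideal I S; ideal J S; I \<cdot>\<^bsub>S\<^esub> J \<subseteq> Q\<rbrakk> \<Longrightarrow> I \<subseteq> Q \<or> J \<subseteq> Q"
    using assms by (auto simp: Spec_def prime_ideal_def)
  have "?Q \<noteq> carrier R"
  proof
    assume eq: "?Q = carrier R"
    have "y \<in> Q" if "y \<in> carrier S" for y
    proof -
      obtain x where "x \<in> carrier R" "y = h x" by (rule surjE[OF \<open>y \<in> carrier S\<close>])
      then show ?thesis using eq by blast
    qed
    then show False using Q ideal.Icarr[OF Q(1)] by blast
  qed
  moreover have "I \<subseteq> ?Q \<or> J \<subseteq> ?Q" if I: "ideal I R" and J: "ideal J R" and IJ: "I \<cdot>\<^bsub>R\<^esub> J \<subseteq> ?Q" for I J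
  proof -
    have sub: "I \<subseteq> carrier R" "J \<subseteq> carrier R" using ideal.Icarr[OF I] ideal.Icarr[OF J] by auto
    have "h ` I \<cdot>\<^bsub>S\<^esub> h ` J \<subseteq> Q" using ideal_prod_image'[OF _ sub] IJ by blast
    then have "h ` I \<subseteq> Q \<or> h ` J \<subseteq> Q" using prime image_ideal I J by blast
    then show ?thesis using sub by blast
  qed
  ultimately show ?thesis
    using vimage_ideal[OF Q(1)] by (simp add: Spec_def prime_ideal_def)
qed

lemma image_prime:
  assumes "P \<in> Spec R" "Ker \<subseteq> P"
  shows "h ` P \<in> Spec S"
proof -
  have P: "ideal P R" "P \<noteq> carrier R"
    and prime: "\<And>I J. \<lbrakk>ideal I R; ideal J R; I \<cdot>\<^bsub>R\<^esub> J \<subseteq> P\<rbrakk> \<Longrightarrow> I \<subseteq> P \<or> J \<subseteq> P"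
    using assms by (auto simp: Spec_def prime_ideal_def)
  have "h ` P \<noteq> carrier S"
  proof
    assume eq: "h ` P = carrier S"
    have "x \<in> P" if "x \<in> carrier R" for x
      using image_mem_iff[OF P(1) assms(2) that] eq that by simp
    then have "P = carrier R" using ideal.Icarr[OF P(1)] by (intro equalityI subsetI)
    then show False using P(2) by simp
  qed
  moreover have "I \<subseteq> h ` P \<or> J \<subseteq> h ` P" if I: "ideal I S" and J: "ideal J S" and IJ: "I \<cdot>\<^bsub>S\<^esub> J \<subseteq> h ` P" for I J
  proof -
    let ?I = "{x \<in> carrier R. h x \<in> I}" and ?J = "{x \<in> carrier R. h x \<in> J}"
    have im: "h ` {x \<in> carrier R. h x \<in> I} = I" if I: "ideal I S" for I
    proof (intro equalityI subsetI)
      fix y assume y: "y \<in> I"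
      obtain x where "x \<in> carrier R" "y = h x" by (rule surjE[OF ideal.Icarr[OF I y]])
      then show "y \<in> h ` {x \<in> carrier R. h x \<in> I}" using y by simp
    qed auto
    have "s \<in> P" if "s \<in> ?I \<cdot>\<^bsub>R\<^esub> ?J" for s
    proof -
      have "s \<in> carrier R \<and> h s \<in> h ` ?I \<cdot>\<^bsub>S\<^esub> h ` ?J" by (rule ideal_prod_image[OF that]) auto
      then have "s \<in> carrier R" "h s \<in> h ` P" using IJ unfolding im[OF I] im[OF J] by auto
      then show ?thesis using image_mem_iff[OF P(1) assms(2)] by blast
    qed
    then have "?I \<subseteq> P \<or> ?J \<subseteq> P" using prime[OF vimage_ideal[OF I] vimage_ideal[OF J]] by blast
    then have "h ` ?I \<subseteq> h ` P \<or> h ` ?J \<subseteq> h ` P" by (meson image_mono)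
    then show ?thesis unfolding im[OF I] im[OF J] .
  qed
  ultimately show ?thesis
    using image_ideal[OF P(1)] by (simp add: Spec_def prime_ideal_def)
qed

text \<open>Images and preimages match the primes properly above the kernel with the nonzero primes
  of \<open>S\<close>, and a witness \<open>d\<close> with \<open>h d\<close>.\<close>

lemma locally_closed_iff:
  assumes K: "Ker \<in> Spec R"
  shows "locally_closed_prime R Ker \<longleftrightarrow> S.zero_locally_closed"
  unfolding R.locally_closed_prime_iff[OF K]
proof
  assume "\<exists>d\<in>carrier R. d \<notin> Ker \<and> (\<forall>Q\<in>Spec R. Ker \<subset> Q \<longrightarrow> d \<in> Q)"
  then obtain d where d: "d \<in> carrier R" "d \<notin> Ker" "\<And>Q. \<lbrakk>Q \<in> Spec R; Ker \<subset> Q\<rbrakk> \<Longrightarrow> d \<in> Q" by blast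
  have "h d \<in> Q" if Q: "Q \<in> Spec S" "Q \<noteq> {\<zero>\<^bsub>S\<^esub>}" for Q
  proof -
    have I: "ideal Q S" using Q by (simp add: Spec_def prime_ideal_def)
    obtain q where q: "q \<in> Q" "q \<noteq> \<zero>\<^bsub>S\<^esub>" "q \<in> carrier S" by (rule S.ideal_nonzeroE[OF I Q(2)])
    obtain x where x: "x \<in> carrier R" "q = h x" by (rule surjE[OF q(3)])
    have z: "\<zero>\<^bsub>S\<^esub> \<in> Q" using I by (simp add: additive_subgroup.zero_closed ideal.axioms(1))
    have "Ker \<subset> {x \<in> carrier R. h x \<in> Q}"
      using x q z by (auto simp: Ker_def)
    then show ?thesis using d(3)[OF vimage_prime[OF Q(1)]] by blast
  qed
  moreover have "h d \<noteq> \<zero>\<^bsub>S\<^esub>" using d(1,2) by (simp add: Ker_def)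
  ultimately show "S.zero_locally_closed"
    using hom_closed[OF d(1)] unfolding S.zero_locally_closed_def by blast
next
  assume "S.zero_locally_closed"
  then obtain e where e: "e \<in> carrier S" "e \<noteq> \<zero>\<^bsub>S\<^esub>" "\<And>Q. \<lbrakk>Q \<in> Spec S; Q \<noteq> {\<zero>\<^bsub>S\<^esub>}\<rbrakk> \<Longrightarrow> e \<in> Q"
    unfolding S.zero_locally_closed_def by blast
  obtain d where d: "d \<in> carrier R" "e = h d" by (rule surjE[OF e(1)])
  have "d \<in> Q" if Q: "Q \<in> Spec R" "Ker \<subset> Q" for Q
  proof -
    have I: "ideal Q R" using Q by (simp add: Spec_def prime_ideal_def)
    obtain x where x: "x \<in> Q" "x \<notin> Ker" using Q(2) by blast
    then have "h x \<noteq> \<zero>\<^bsub>S\<^esub>" using ideal.Icarr[OF I] by (simp add: Ker_def)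
    then have "h ` Q \<noteq> {\<zero>\<^bsub>S\<^esub>}" using x(1) by blast
    then have "h d \<in> h ` Q" using e(3)[OF image_prime] Q d(2) by blast
    then show ?thesis using image_mem_iff[OF I _ d(1)] Q(2) by blast
  qed
  moreover have "d \<notin> Ker" using d e(2) by (simp add: Ker_def)
  ultimately show "\<exists>d\<in>carrier R. d \<notin> Ker \<and> (\<forall>Q\<in>Spec R. Ker \<subset> Q \<longrightarrow> d \<in> Q)"
    using d(1) by blast
qed

lemma primitive_iff: "primitive_ideal R Ker \<longleftrightarrow> primitive_ideal S {\<zero>\<^bsub>S\<^esub>}"
proof
  assume "primitive_ideal R Ker"
  then obtain M :: "('a, 'a set) module" where M: "simple_right_module R M" "Ker = annihilator R M"
    unfolding primitive_ideal_def by blast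
  interpret M: simple_right_module R M by (rule M(1))
  define l where "l s = (SOME r. r \<in> carrier R \<and> h r = s)" for s
  have l: "l s \<in> carrier R \<and> h (l s) = s" if "s \<in> carrier S" for s
    unfolding l_def by (rule someI_ex) (use surjE[OF that] in metis)
  \<comment> \<open>The kernel annihilates \<open>M\<close>, so the action through the lift
    \<open>l\<close> does not depend on the lift.\<close>
  have eq: "x \<odot>\<^bsub>M\<^esub> m = y \<odot>\<^bsub>M\<^esub> m"
    if xy: "x \<in> carrier R" "y \<in> carrier R" "h x = h y" and m: "m \<in> carrier M" for x y m
  proof -
    have "(x \<ominus>\<^bsub>R\<^esub> y) \<odot>\<^bsub>M\<^esub> m = \<zero>\<^bsub>M\<^esub>"
      using Ker_diff[OF xy] m unfolding M(2) annihilator_def by blast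
    moreover have "x = (x \<ominus>\<^bsub>R\<^esub> y) \<oplus>\<^bsub>R\<^esub> y" using xy by (simp add: R.minus_eq R.a_assoc R.l_neg)
    ultimately show ?thesis
      using M.act_add_ring[of "x \<ominus>\<^bsub>R\<^esub> y" y m] M.act_closed[OF xy(2) m] xy m by simp
  qed
  have "primitive_ideal S {s \<in> carrier S. \<forall>m\<in>carrier M. l s \<odot>\<^bsub>M\<^esub> m = \<zero>\<^bsub>M\<^esub>}"
  proof (rule primitive_ideal_transport[OF M(1) S.ring_axioms, where c = "\<lambda>s r. s = h r"])
    show "l s \<odot>\<^bsub>M\<^esub> m = r \<odot>\<^bsub>M\<^esub> m"
      if "s \<in> carrier S" "r \<in> carrier R" "s = h r" "m \<in> carrier M" for s r m
      using eq l that by blast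
  qed (auto elim: surjE)
  moreover have "{s \<in> carrier S. \<forall>m\<in>carrier M. l s \<odot>\<^bsub>M\<^esub> m = \<zero>\<^bsub>M\<^esub>} = {\<zero>\<^bsub>S\<^esub>}"
  proof (intro equalityI subsetI)
    fix s assume s: "s \<in> {s \<in> carrier S. \<forall>m\<in>carrier M. l s \<odot>\<^bsub>M\<^esub> m = \<zero>\<^bsub>M\<^esub>}"
    then have "l s \<in> Ker" unfolding M(2) annihilator_def using l by blast
    then show "s \<in> {\<zero>\<^bsub>S\<^esub>}" using l[of s] s by (simp add: Ker_def)
  next
    fix s assume "s \<in> {\<zero>\<^bsub>S\<^esub>}"
    moreover have "l \<zero>\<^bsub>S\<^esub> \<in> Ker" using l[OF S.zero_closed] by (simp add: Ker_def)
    ultimately show "s \<in> {s \<in> carrier S. \<forall>m\<in>carrier M. l s \<odot>\<^bsub>M\<^esub> m = \<zero>\<^bsub>M\<^esub>}"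
      unfolding M(2) annihilator_def by auto
  qed
  ultimately show "primitive_ideal S {\<zero>\<^bsub>S\<^esub>}" by simp
next
  assume "primitive_ideal S {\<zero>\<^bsub>S\<^esub>}"
  then obtain M :: "('c, 'c set) module" where M: "simple_right_module S M" "{\<zero>\<^bsub>S\<^esub>} = annihilator S M"
    unfolding primitive_ideal_def by blast
  interpret M: simple_right_module S M by (rule M(1))
  have "primitive_ideal R {r \<in> carrier R. \<forall>m\<in>carrier M. h r \<odot>\<^bsub>M\<^esub> m = \<zero>\<^bsub>M\<^esub>}"
    by (rule primitive_ideal_transport[OF M(1) R.ring_axioms, where c = "\<lambda>r s. s = h r"])
      (auto elim: surjE)
  moreover have "{r \<in> carrier R. \<forall>m\<in>carrier M. h r \<odot>\<^bsub>M\<^esub> m = \<zero>\<^bsub>M\<^esub>} = Ker"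
  proof -
    have "h r \<in> annihilator S M \<longleftrightarrow> (\<forall>m\<in>carrier M. h r \<odot>\<^bsub>M\<^esub> m = \<zero>\<^bsub>M\<^esub>)" if "r \<in> carrier R" for r
      using that by (simp add: annihilator_def)
    then show ?thesis unfolding Ker_def M(2)[symmetric] by auto
  qed
  ultimately show "primitive_ideal R Ker" by simp
qed

text \<open>\<open>J\<close> collects all \<open>y\<close> with \<open>a S y = 0\<close>, and
  \<open>I\<close> all \<open>z\<close> with \<open>z S J = 0\<close>. Both are two-sided ideals
  without any generation process, \<open>a\<close> lies in \<open>I\<close> and \<open>b\<close> in
  \<open>J\<close>, and \<open>I J = 0\<close>; primeness of the kernel applies to their
  preimages.\<close>

lemma prime_ring_image:
  assumes K: "Ker \<in> Spec R"
  shows "prime_ring S"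
proof
  have I: "ideal Ker R" "Ker \<noteq> carrier R"
    and prime: "\<And>I J. \<lbrakk>ideal I R; ideal J R; I \<cdot>\<^bsub>R\<^esub> J \<subseteq> Ker\<rbrakk> \<Longrightarrow> I \<subseteq> Ker \<or> J \<subseteq> Ker"
    using K by (auto simp: Spec_def prime_ideal_def)
  show "\<one>\<^bsub>S\<^esub> \<noteq> \<zero>\<^bsub>S\<^esub>"
  proof
    assume z: "\<one>\<^bsub>S\<^esub> = \<zero>\<^bsub>S\<^esub>"
    have "y = \<zero>\<^bsub>S\<^esub>" if "y \<in> carrier S" for y using S.l_one[OF that] that by (simp add: z)
    then have "carrier R = Ker" by (auto simp: Ker_def)
    then show False using I by simp
  qed
  fix a b assume a: "a \<in> carrier S" and b: "b \<in> carrier S"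
    and ab: "\<And>x. x \<in> carrier S \<Longrightarrow> a \<otimes>\<^bsub>S\<^esub> x \<otimes>\<^bsub>S\<^esub> b = \<zero>\<^bsub>S\<^esub>"
  define J where "J = {y \<in> carrier S. \<forall>x\<in>carrier S. a \<otimes>\<^bsub>S\<^esub> x \<otimes>\<^bsub>S\<^esub> y = \<zero>\<^bsub>S\<^esub>}"
  define I where "I = {z \<in> carrier S. \<forall>x\<in>carrier S. \<forall>y\<in>J. z \<otimes>\<^bsub>S\<^esub> x \<otimes>\<^bsub>S\<^esub> y = \<zero>\<^bsub>S\<^esub>}"
  have Jc: "y \<in> carrier S" if "y \<in> J" for y using that by (simp add: J_def)
  have J: "ideal J S"
  proof (rule S.ideal_intro)
    fix c y assume c: "c \<in> carrier S" and y: "y \<in> J"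
    have "a \<otimes>\<^bsub>S\<^esub> x \<otimes>\<^bsub>S\<^esub> (c \<otimes>\<^bsub>S\<^esub> y) = \<zero>\<^bsub>S\<^esub>" if "x \<in> carrier S" for x
    proof -
      have "a \<otimes>\<^bsub>S\<^esub> (x \<otimes>\<^bsub>S\<^esub> c) \<otimes>\<^bsub>S\<^esub> y = \<zero>\<^bsub>S\<^esub>" using c y that by (simp add: J_def)
      then show ?thesis using c y that a by (simp add: J_def S.m_assoc)
    qed
    then show "c \<otimes>\<^bsub>S\<^esub> y \<in> J" using c y by (simp add: J_def)
    show "y \<otimes>\<^bsub>S\<^esub> c \<in> J" using c y a by (simp add: J_def flip: S.m_assoc)
  qed (use a in \<open>auto simp: J_def S.r_distr\<close>)
  have I': "ideal I S"
  proof (rule S.ideal_intro)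
    fix c z assume c: "c \<in> carrier S" and z: "z \<in> I"
    then have zc: "z \<in> carrier S" by (simp add: I_def)
    have "c \<otimes>\<^bsub>S\<^esub> z \<otimes>\<^bsub>S\<^esub> x \<otimes>\<^bsub>S\<^esub> y = \<zero>\<^bsub>S\<^esub>" "z \<otimes>\<^bsub>S\<^esub> c \<otimes>\<^bsub>S\<^esub> x \<otimes>\<^bsub>S\<^esub> y = \<zero>\<^bsub>S\<^esub>"
      if x: "x \<in> carrier S" and y: "y \<in> J" for x y
    proof -
      have "z \<otimes>\<^bsub>S\<^esub> x \<otimes>\<^bsub>S\<^esub> y = \<zero>\<^bsub>S\<^esub>" "z \<otimes>\<^bsub>S\<^esub> (c \<otimes>\<^bsub>S\<^esub> x) \<otimes>\<^bsub>S\<^esub> y = \<zero>\<^bsub>S\<^esub>"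
        using z c x y by (simp_all add: I_def)
      then show "c \<otimes>\<^bsub>S\<^esub> z \<otimes>\<^bsub>S\<^esub> x \<otimes>\<^bsub>S\<^esub> y = \<zero>\<^bsub>S\<^esub>" "z \<otimes>\<^bsub>S\<^esub> c \<otimes>\<^bsub>S\<^esub> x \<otimes>\<^bsub>S\<^esub> y = \<zero>\<^bsub>S\<^esub>"
        using zc c x Jc[OF y] by (simp_all add: S.m_assoc)
    qed
    then show "c \<otimes>\<^bsub>S\<^esub> z \<in> I" "z \<otimes>\<^bsub>S\<^esub> c \<in> I" using c zc by (simp_all add: I_def)
  qed (auto simp: I_def S.l_distr Jc)
  let ?I0 = "{x \<in> carrier R. h x \<in> I}" and ?J0 = "{x \<in> carrier R. h x \<in> J}"
  have "s \<in> Ker" if "s \<in> ?I0 \<cdot>\<^bsub>R\<^esub> ?J0" for s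
    using that
  proof induction
    case (prod i j)
    then have "h i \<otimes>\<^bsub>S\<^esub> \<one>\<^bsub>S\<^esub> \<otimes>\<^bsub>S\<^esub> h j = \<zero>\<^bsub>S\<^esub>" unfolding I_def using S.one_closed by blast
    then show ?case using prod by (simp add: Ker_def)
  qed (simp add: Ker_def)
  then have "?I0 \<subseteq> Ker \<or> ?J0 \<subseteq> Ker" using prime[OF vimage_ideal[OF I'] vimage_ideal[OF J]] by blast
  moreover obtain a' where a': "a' \<in> carrier R" "a = h a'" by (rule surjE[OF a])
  moreover obtain b' where b': "b' \<in> carrier R" "b = h b'" by (rule surjE[OF b])
  moreover have "a \<in> I" using a by (simp add: I_def J_def)
  moreover have "b \<in> J" using b ab by (simp add: J_def)
  ultimately have "a' \<in> Ker \<or> b' \<in> Ker" by blast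
  then show "a = \<zero>\<^bsub>S\<^esub> \<or> b = \<zero>\<^bsub>S\<^esub>" using a' b' by (auto simp: Ker_def)
qed

end

section \<open>Domains generated by one element and its inverse\<close>

lemma (in domain) nat_pow_nonzero:
  "\<lbrakk>x \<in> carrier R; x \<noteq> \<zero>\<rbrakk> \<Longrightarrow> x [^] (n :: nat) \<noteq> \<zero>"
  by (induction n) (auto simp: integral_iff)

text \<open>Induction on \<open>m\<close>: for positive exponent the constant term of the product is
  zero, so that of \<open>r\<close> is zero, and a factor \<open>X\<close> can be cancelled until
  \<open>p\<close> divides one.\<close>

lemma (in domain) var_power_factor_unit:
  assumes K: "subfield K R" and p: "p \<in> carrier (K[X])" "const_term p \<noteq> \<zero>"
    and r: "r \<in> carrier (K[X])" "p \<otimes>\<^bsub>K[X]\<^esub> r = X [^]\<^bsub>K[X]\<^esub> (m :: nat)"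
  shows "p \<in> Units (K[X])"
proof -
  note sub = subfieldE(1)[OF K]
  interpret UP: domain "K[X]" by (rule univ_poly_is_domain[OF sub])
  have x: "X \<in> carrier (K[X])" by (rule var_closed(1)[OF sub])
  from r show ?thesis
  proof (induction m arbitrary: r)
    case 0
    then have "p \<otimes>\<^bsub>K[X]\<^esub> r = \<one>\<^bsub>K[X]\<^esub>" by simp
    moreover have "r \<otimes>\<^bsub>K[X]\<^esub> p = \<one>\<^bsub>K[X]\<^esub>" using calculation UP.m_comm[OF p(1) 0(1)] by simp
    ultimately show ?case using p(1) 0(1) unfolding Units_def by blast
  next
    case (Suc m)
    have "const_term p \<otimes> const_term r = const_term (X [^]\<^bsub>K[X]\<^esub> Suc m)"
      using Suc.prems p(1) const_term_simprules_shell(2)[OF sub] by metis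
    also have "\<dots> = const_term (X [^]\<^bsub>K[X]\<^esub> m) \<otimes> const_term X"
      using const_term_simprules_shell(2)[OF sub _ x] x by simp
    also have "const_term X = \<zero>"
      unfolding const_term_def by (simp add: eval_var)
    also have "const_term (X [^]\<^bsub>K[X]\<^esub> m) \<otimes> \<zero> = \<zero>"
      using const_term_simprules_shell(1)[OF sub, of "X [^]\<^bsub>K[X]\<^esub> m"] x subfieldE(3)[OF K]
      by (intro r_null) auto
    finally have r0: "const_term r = \<zero>"
      using p const_term_simprules_shell(1)[OF sub] Suc.prems(1) subfieldE(3)[OF K] integral by blast
    have "r \<noteq> []"
    proof
      assume "r = []"
      then have "r = \<zero>\<^bsub>K[X]\<^esub>" by (simp add: univ_poly_zero)
      then have "X [^]\<^bsub>K[X]\<^esub> Suc m = \<zero>\<^bsub>K[X]\<^esub>" using Suc.prems(2) p(1) by simp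
      moreover have "X \<noteq> \<zero>\<^bsub>K[X]\<^esub>" by (simp add: univ_poly_zero var_def)
      ultimately show False using UP.nat_pow_nonzero[OF x] by blast
    qed
    \<comment> \<open>Coefficients are listed from the highest degree down, so a vanishing constant
      term is a final zero in the list, and appending a zero is multiplication by
      \<open>X\<close>.\<close>
    then obtain r' where r': "polynomial K r'" "r = r' @ [\<zero>]"
      using const_term_zero[OF sub _ _ r0] Suc.prems(1) univ_poly_carrier by blast
    have r'c: "r' \<in> carrier (K[X])" "set r' \<subseteq> carrier R"
      using r'(1) univ_poly_carrier polynomial_in_carrier[OF sub] by blast+
    have "r' \<otimes>\<^bsub>K[X]\<^esub> X = X \<otimes>\<^bsub>K[X]\<^esub> r'" using r'c(1) x by (rule UP.m_comm)
    also have "\<dots> = poly_mult ([\<one>] @ [\<zero>]) r'" unfolding univ_poly_mult var_def by simp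
    also have "\<dots> = normalize (poly_mult [\<one>] r' @ [\<zero>])"
      by (rule poly_mult_append_zero) (use r'c in auto)
    also have "\<dots> = normalize r" unfolding poly_mult_one[OF sub r'(1)] r'(2) ..
    also have "\<dots> = r" using Suc.prems(1) by (intro normalize_polynomial) (simp add: univ_poly_carrier)
    finally have "p \<otimes>\<^bsub>K[X]\<^esub> r' \<otimes>\<^bsub>K[X]\<^esub> X = X [^]\<^bsub>K[X]\<^esub> m \<otimes>\<^bsub>K[X]\<^esub> X"
      using Suc.prems(2) p(1) r'c(1) x by (simp add: UP.m_assoc)
    then have "p \<otimes>\<^bsub>K[X]\<^esub> r' = X [^]\<^bsub>K[X]\<^esub> m"
      using UP.m_rcancel[of X] p(1) r'c(1) x by (simp add: univ_poly_zero var_def)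
    then show ?case using Suc.IH r'c(1) by blast
  qed
qed

text \<open>By \<open>gen\<close> every element is a polynomial in \<open>c\<close> divided by a
  power of \<open>c\<close>. The ring is thus an image of the Laurent polynomial ring over
  \<open>K\<close>, and a copy of it if \<open>c\<close> is transcendental.\<close>

locale laurent_domain = domain R for R (structure) +
  fixes K c c'
  assumes K: "subfield K R" and c: "c \<in> carrier R" "c' \<in> carrier R" "c \<otimes> c' = \<one>"
    and gen: "\<And>d. d \<in> carrier R \<Longrightarrow> \<exists>n::nat. d \<otimes> c [^] n \<in> simple_extension K c"
begin

lemma subring_K: "subring K R"
  by (rule subfieldE(1)[OF K])

lemma simple_extension_eval:
  "y \<in> simple_extension K c \<longleftrightarrow> (\<exists>p\<in>carrier (K[X]). y = eval p c)"
  using simple_extension_as_eval_img[OF subfieldE(3)[OF K] c(1)] by auto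

lemma pow_cancel: "c [^] (n::nat) \<otimes> c' [^] n = \<one>"
  using c by (simp flip: pow_mult_distrib[OF m_comm] add: nat_pow_distrib[symmetric])

text \<open>If \<open>c\<close> is transcendental, identities between polynomials in
  \<open>c\<close> lift to \<open>K[X]\<close>. A suitable multiple of \<open>d\<close> becomes a
  polynomial \<open>q\<close> without constant term; if \<open>1 - q\<close> is invertible in the
  ring, it divides a power of \<open>X\<close>, so it is a unit of \<open>K[X]\<close>, hence the
  constant one, and \<open>d\<close> is zero.\<close>

lemma algebraic_of_units:
  assumes d: "d \<in> carrier R" "d \<noteq> \<zero>"
    and unit: "\<And>u. u \<in> carrier R \<Longrightarrow> \<one> \<ominus> d \<otimes> u = \<zero> \<or> (\<exists>v\<in>carrier R. (\<one> \<ominus> d \<otimes> u) \<otimes> v = \<one>)"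
  shows "(algebraic over K) c"
proof (rule ccontr)
  interpret UP: domain "K[X]" by (rule univ_poly_is_domain[OF subring_K])
  have x: "X \<in> carrier (K[X])" by (rule var_closed(1)[OF subring_K])
  interpret ev: ring_hom_ring "K[X]" R "\<lambda>p. eval p c" by (rule eval_ring_hom[OF subring_K c(1)])
  interpret ev0: ring_hom_ring "K[X]" R const_term
    unfolding const_term_def by (rule eval_ring_hom[OF subring_K zero_closed])
  have evx: "eval X c = c" "const_term X = \<zero>"
    using c(1) by (simp_all add: eval_var const_term_def)
  assume "\<not> (algebraic over K) c"
  then have "(transcendental over K) c" by (simp add: over_def)
  then have inj: "p = q" if "p \<in> carrier (K[X])" "q \<in> carrier (K[X])" "eval p c = eval q c" for p q
    using that unfolding over_def transcendental_def inj_on_def by blast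
  obtain n :: nat and p where p: "p \<in> carrier (K[X])" "d \<otimes> c [^] n = eval p c"
    using gen[OF d(1)] simple_extension_eval by blast
  \<comment> \<open>The additional factor \<open>X\<close> makes the constant term of
    \<open>q\<close> vanish, so that \<open>t\<close> has constant term one and differs from
    zero.\<close>
  define q where "q = p \<otimes>\<^bsub>K[X]\<^esub> X"
  have q: "q \<in> carrier (K[X])" "const_term q = \<zero>" using p(1) x evx by (simp_all add: q_def)
  have dq: "d \<otimes> (c [^] n \<otimes> c) = eval q c"
    using p d(1) c(1) x evx(1) by (simp add: q_def flip: m_assoc)
  define t where "t = \<one>\<^bsub>K[X]\<^esub> \<ominus>\<^bsub>K[X]\<^esub> q"
  have t: "t \<in> carrier (K[X])" "const_term t = \<one>" "eval t c = \<one> \<ominus> d \<otimes> (c [^] n \<otimes> c)"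
    using q by (simp_all add: t_def dq UP.minus_eq minus_eq)
  have "t \<in> Units (K[X])"
    using unit[of "c [^] n \<otimes> c"]
  proof
    assume "\<one> \<ominus> d \<otimes> (c [^] n \<otimes> c) = \<zero>"
    then have "t = \<zero>\<^bsub>K[X]\<^esub>" using inj[OF t(1) UP.zero_closed] t(3) by simp
    then show ?thesis using t(2) by simp
  next
    assume "\<exists>v\<in>carrier R. (\<one> \<ominus> d \<otimes> (c [^] n \<otimes> c)) \<otimes> v = \<one>"
    then obtain v where v: "v \<in> carrier R" "eval t c \<otimes> v = \<one>" unfolding t(3) by blast
    obtain m :: nat and r where r: "r \<in> carrier (K[X])" "v \<otimes> c [^] m = eval r c"
      using gen[OF v(1)] simple_extension_eval by blast
    have "eval (t \<otimes>\<^bsub>K[X]\<^esub> r) c = eval t c \<otimes> (v \<otimes> c [^] m)" using t(1) r by simp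
    also have "\<dots> = c [^] m" using v t(1) c(1) by (simp flip: m_assoc)
    also have "\<dots> = eval (X [^]\<^bsub>K[X]\<^esub> m) c" using x evx(1) ev.hom_nat_pow by simp
    finally have "t \<otimes>\<^bsub>K[X]\<^esub> r = X [^]\<^bsub>K[X]\<^esub> m" using inj t(1) r(1) x by simp
    then show ?thesis using var_power_factor_unit[OF K t(1)] t(2) r(1) by simp
  qed (use c(1) in simp)
  then obtain k where k: "k \<in> K" "t = [k]" using univ_poly_units[OF K] by auto
  then have kR: "k \<in> carrier R" using subfieldE(3)[OF K] by blast
  have "k = \<one>" using t(2) kR unfolding k(2) const_term_def by simp
  then have "eval t c = \<one>" unfolding k(2) using c(1) by simp
  then have e: "\<one> \<ominus> d \<otimes> (c [^] n \<otimes> c) = \<one>" unfolding t(3) .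
  have yc: "d \<otimes> (c [^] n \<otimes> c) \<in> carrier R" using d(1) c(1) by simp
  then have "(\<one> \<ominus> d \<otimes> (c [^] n \<otimes> c)) \<oplus> d \<otimes> (c [^] n \<otimes> c) = \<one> \<oplus> \<zero>"
    by (simp add: minus_eq a_assoc l_neg)
  then have "d \<otimes> (c [^] n \<otimes> c) = \<zero>"
    unfolding e by (rule add.l_cancel[OF _ yc zero_closed one_closed])
  then have "c [^] n \<otimes> c = \<zero>" using d c(1) integral by blast
  then have "c [^] Suc n \<otimes> c' [^] Suc n = \<zero>" using c by simp
  then show False using pow_cancel[of "Suc n"] by simp
qed

text \<open>For algebraic \<open>c\<close> the simple extension is a field, so it contains the
  inverse of \<open>c\<close> and with it the denominators in \<open>gen\<close>.\<close>

lemma algebraic_imp_simple_extension: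
  assumes "(algebraic over K) c"
  shows "simple_extension K c = carrier R" "subfield (carrier R) R"
proof -
  have F: "subfield (simple_extension K c) R"
    using simple_extension_is_subfield[OF K c(1)] assms by simp
  have cF: "c \<in> simple_extension K c" by (rule simple_extension_mem[OF subring_K c(1)])
  have "c \<noteq> \<zero>" using c(2,3) by auto
  then obtain e where e: "e \<in> simple_extension K c" "c \<otimes> e = \<one>"
    using subfield_m_inv(1,2)[OF F, of c] cF by blast
  have FR: "simple_extension K c \<subseteq> carrier R" by (rule subfieldE(3)[OF F])
  have "c' = e"
  proof -
    have "c' = c' \<otimes> (c \<otimes> e)" using c(2) e(2) by simp
    also have "\<dots> = (c \<otimes> c') \<otimes> e" using c e(1) FR m_comm[of c c'] by (simp add: subset_iff flip: m_assoc)
    also have "\<dots> = e" using c(3) e(1) FR by (simp add: subset_iff)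
    finally show ?thesis .
  qed
  then have c'F: "c' [^] (n::nat) \<in> simple_extension K c" for n
    using e(1) subringE(3,6)[OF subfieldE(1)[OF F]] by (induction n) auto
  have "d \<in> simple_extension K c" if d: "d \<in> carrier R" for d
  proof -
    obtain n :: nat where n: "d \<otimes> c [^] n \<in> simple_extension K c" using gen[OF d] by blast
    have "d = d \<otimes> c [^] n \<otimes> c' [^] n" using d c pow_cancel by (simp add: m_assoc)
    then show ?thesis using subringE(6)[OF subfieldE(1)[OF F] n c'F] by metis
  qed
  then show "simple_extension K c = carrier R" using FR by blast
  then show "subfield (carrier R) R" using F by simp
qed

lemma algebraic_imp_unit:
  assumes "(algebraic over K) c" "d \<in> carrier R" "d \<noteq> \<zero>"
  shows "\<exists>u\<in>carrier R. d \<otimes> u = \<one>"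
  using subfield_m_inv(1,2)[OF algebraic_imp_simple_extension(2)[OF assms(1)], of d] assms by blast

lemma algebraic_imp_algebraic:
  assumes "(algebraic over K) c" "d \<in> carrier R"
  shows "(algebraic over K) d"
  using simple_extesion_mem_imp_algebraic[OF K c(1) assms(1)] assms
  by (simp add: algebraic_imp_simple_extension(1))

end

section \<open>Leavitt families\<close>

context ring
begin

text \<open>Scalars act through a map \<open>\<iota>\<close> into the ring. The inductive form turns
  statements about linear combinations into inductions over their terms, without finite index
  sets.\<close>

inductive_set lin_span :: "('k, 'm) ring_scheme \<Rightarrow> ('k \<Rightarrow> 'a) \<Rightarrow> 'a set \<Rightarrow> 'a set" for K \<iota> M where
  zero: "\<zero> \<in> lin_span K \<iota> M"
| add: "\<lbrakk>k \<in> carrier K; m \<in> M; y \<in> lin_span K \<iota> M\<rbrakk> \<Longrightarrow> \<iota> k \<otimes> m \<oplus> y \<in> lin_span K \<iota> M"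

end

text \<open>
  Generation as an algebra is expressed by closure under left multiplication by generators. Since
  \<open>e = e r(e)\<close> and \<open>e\<^sup>* = e\<^sup>* s(e)\<close>, it suffices to start from the vertices.
\<close>

locale leavitt_family = R?: ring R + G: fin_digraph G + K: field K
  for R :: "('a, 'r) ring_scheme" (structure) and G :: "('v, 'e) pre_digraph" and K :: "('k, 'm) ring_scheme" +
  fixes \<iota> :: "'k \<Rightarrow> 'a" and V :: "'v \<Rightarrow> 'a" and E H :: "'e \<Rightarrow> 'a"
  assumes \<iota>_hom: "ring_hom_ring K R \<iota>"
    and \<iota>_central: "\<lbrakk>k \<in> carrier K; x \<in> carrier R\<rbrakk> \<Longrightarrow> \<iota> k \<otimes> x = x \<otimes> \<iota> k"
    and V_closed [simp]: "v \<in> verts G \<Longrightarrow> V v \<in> carrier R"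
    and E_closed [simp]: "a \<in> arcs G \<Longrightarrow> E a \<in> carrier R"
    and H_closed [simp]: "a \<in> arcs G \<Longrightarrow> H a \<in> carrier R"
    and VV: "\<lbrakk>u \<in> verts G; v \<in> verts G\<rbrakk> \<Longrightarrow> V u \<otimes> V v = (if u = v then V u else \<zero>)"
    and VE: "a \<in> arcs G \<Longrightarrow> V (tail G a) \<otimes> E a = E a"
    and EV: "a \<in> arcs G \<Longrightarrow> E a \<otimes> V (head G a) = E a"
    and VH: "a \<in> arcs G \<Longrightarrow> V (head G a) \<otimes> H a = H a"
    and HV: "a \<in> arcs G \<Longrightarrow> H a \<otimes> V (tail G a) = H a"
    and HE: "\<lbrakk>a \<in> arcs G; b \<in> arcs G\<rbrakk> \<Longrightarrow> H a \<otimes> E b = (if a = b then V (head G a) else \<zero>)"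
    and CK: "\<lbrakk>v \<in> verts G; out_arcs G v \<noteq> {}\<rbrakk> \<Longrightarrow> V v = (\<Oplus>a\<in>out_arcs G v. E a \<otimes> H a)"
    and V_sum: "\<one> = (\<Oplus>v\<in>verts G. V v)"
    and generated: "\<And>W. \<lbrakk>\<zero> \<in> W; \<And>v. v \<in> verts G \<Longrightarrow> V v \<in> W;
        \<And>x y. \<lbrakk>x \<in> W; y \<in> W\<rbrakk> \<Longrightarrow> x \<oplus> y \<in> W;
        \<And>k x. \<lbrakk>k \<in> carrier K; x \<in> W\<rbrakk> \<Longrightarrow> \<iota> k \<otimes> x \<in> W;
        \<And>v x. \<lbrakk>v \<in> verts G; x \<in> W\<rbrakk> \<Longrightarrow> V v \<otimes> x \<in> W;
        \<And>a x. \<lbrakk>a \<in> arcs G; x \<in> W\<rbrakk> \<Longrightarrow> E a \<otimes> x \<in> W;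
        \<And>a x. \<lbrakk>a \<in> arcs G; x \<in> W\<rbrakk> \<Longrightarrow> H a \<otimes> x \<in> W\<rbrakk> \<Longrightarrow> carrier R \<subseteq> W"
begin

sublocale \<iota>: ring_hom_ring K R \<iota>
  by (rule \<iota>_hom)

abbreviation awalk where "awalk \<equiv> G.awalk"

lemma \<iota>_center: "k \<in> carrier K \<Longrightarrow> \<iota> k \<in> ring_center R"
  using \<iota>_central by (simp add: ring_center_def)

subsection \<open>Linear spans\<close>

abbreviation span where "span \<equiv> lin_span K \<iota>"

lemma span_closed: "x \<in> span M \<Longrightarrow> M \<subseteq> carrier R \<Longrightarrow> x \<in> carrier R"
  by (induction rule: lin_span.induct) auto

lemma span_base: "m \<in> M \<Longrightarrow> M \<subseteq> carrier R \<Longrightarrow> m \<in> span M"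
  using lin_span.add[OF K.one_closed _ lin_span.zero, of m M \<iota>] by auto

lemma span_add:
  assumes "x \<in> span M" "y \<in> span M" "M \<subseteq> carrier R"
  shows "x \<oplus> y \<in> span M"
  using assms(1)
proof (induction rule: lin_span.induct)
  case zero
  then show ?case using assms span_closed by simp
next
  case (add k m z)
  then have "\<iota> k \<otimes> m \<in> carrier R" "z \<in> carrier R" "y \<in> carrier R"
    using assms span_closed by auto
  then show ?case using lin_span.add[OF add(1,2,4)] by (simp add: a_assoc)
qed

lemma span_smult:
  assumes "k \<in> carrier K" "x \<in> span M" "M \<subseteq> carrier R"
  shows "\<iota> k \<otimes> x \<in> span M"
  using assms(2)
proof (induction rule: lin_span.induct)
  case zero
  then show ?case using assms by (simp add: lin_span.zero)
next
  case (add l m z)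
  then have c: "m \<in> carrier R" "z \<in> carrier R" using assms span_closed by auto
  have "\<iota> (k \<otimes>\<^bsub>K\<^esub> l) \<otimes> m \<oplus> \<iota> k \<otimes> z \<in> span M"
    using add assms by (intro lin_span.add) auto
  then show ?case using c assms add(1) by (simp add: r_distr m_assoc)
qed

text \<open>Scalars are central, so \<open>x \<mapsto> a \<otimes> x \<otimes> b\<close> is linear
  and may be examined on the spanning set.\<close>

lemma span_sandwich:
  assumes "x \<in> span M" "M \<subseteq> carrier R" "N \<subseteq> carrier R" "a \<in> carrier R" "b \<in> carrier R"
    and "\<And>m. m \<in> M \<Longrightarrow> a \<otimes> m \<otimes> b \<in> span N"
  shows "a \<otimes> x \<otimes> b \<in> span N"
  using assms(1)
proof (induction rule: lin_span.induct)
  case zero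
  then show ?case using assms by (simp add: lin_span.zero)
next
  case (add k m z)
  then have c: "m \<in> carrier R" "z \<in> carrier R" "\<iota> k \<in> carrier R" using assms span_closed by auto
  have "a \<otimes> (\<iota> k \<otimes> m) \<otimes> b = a \<otimes> \<iota> k \<otimes> (m \<otimes> b)" using c assms(4,5) by (simp add: m_assoc)
  also have "\<dots> = \<iota> k \<otimes> (a \<otimes> m \<otimes> b)"
    using c assms(4,5) \<iota>_central[OF add(1) assms(4)] by (simp flip: m_assoc)
  finally have "a \<otimes> (\<iota> k \<otimes> m \<oplus> z) \<otimes> b = \<iota> k \<otimes> (a \<otimes> m \<otimes> b) \<oplus> a \<otimes> z \<otimes> b"
    using c assms(4,5) by (simp add: r_distr l_distr)
  then show ?case
    using span_add[OF span_smult[OF add(1) assms(6)[OF add(2)] assms(3)] add(4) assms(3)] by simp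
qed

lemma span_commute:
  assumes "x \<in> span M" "M \<subseteq> carrier R" "b \<in> carrier R" "\<And>m. m \<in> M \<Longrightarrow> m \<otimes> b = b \<otimes> m"
  shows "x \<otimes> b = b \<otimes> x"
  using assms(1)
proof (induction rule: lin_span.induct)
  case zero
  then show ?case using assms by simp
next
  case (add k m z)
  then have c: "m \<in> carrier R" "z \<in> carrier R" "\<iota> k \<in> carrier R" using assms span_closed by auto
  have "\<iota> k \<otimes> m \<otimes> b = \<iota> k \<otimes> (b \<otimes> m)" using c assms(3) assms(4)[OF add(2)] by (simp add: m_assoc)
  also have "\<dots> = b \<otimes> \<iota> k \<otimes> m" using c assms(3) \<iota>_central[OF add(1) assms(3)] by (simp flip: m_assoc)
  finally show ?case using add c assms(3) by (simp add: l_distr r_distr m_assoc)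
qed

subsection \<open>Path elements\<close>

text \<open>The start vertex is an argument because the empty list does not determine its vertex;
  for nonempty walks the value depends on the edges alone.\<close>

primrec path :: "'v \<Rightarrow> 'e list \<Rightarrow> 'a" where
  "path u [] = V u"
| "path u (a # p) = E a \<otimes> path (head G a) p"

primrec ghost :: "'v \<Rightarrow> 'e list \<Rightarrow> 'a" where
  "ghost u [] = V u"
| "ghost u (a # p) = ghost (head G a) p \<otimes> H a"

lemma awalk_append: "awalk u (p @ q) v \<longleftrightarrow> (\<exists>x. awalk u p x \<and> awalk x q v)"
  by (induction p arbitrary: u) (auto simp: G.awalk_simps dest: G.awalk_hd_in_verts)

lemma awalk_verts: "awalk u p v \<Longrightarrow> u \<in> verts G" "awalk u p v \<Longrightarrow> v \<in> verts G"
  by (auto dest: G.awalk_hd_in_verts G.awalk_last_in_verts)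

lemma awalk_end_unique: "\<lbrakk>awalk u p v; awalk u p x\<rbrakk> \<Longrightarrow> v = x"
  by (induction p arbitrary: u) (auto simp: G.awalk_simps)

lemma path_closed [simp]: "awalk u p v \<Longrightarrow> path u p \<in> carrier R"
  by (induction p arbitrary: u) (auto simp: G.awalk_simps)

lemma ghost_closed [simp]: "awalk u p v \<Longrightarrow> ghost u p \<in> carrier R"
  by (induction p arbitrary: u) (auto simp: G.awalk_simps)

lemma V_path: "awalk u p v \<Longrightarrow> V u \<otimes> path u p = path u p"
  by (cases p) (auto simp: G.awalk_simps VV VE simp flip: m_assoc)

lemma path_V: "awalk u p v \<Longrightarrow> path u p \<otimes> V v = path u p"
proof (induction p arbitrary: u)
  case (Cons a p)
  then have "a \<in> arcs G" "awalk (head G a) p v" "v \<in> verts G"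
    by (auto simp: G.awalk_simps dest: awalk_verts(2))
  then show ?case using Cons.IH by (simp add: m_assoc)
qed (auto simp: G.awalk_simps VV)

lemma V_ghost: "awalk u p v \<Longrightarrow> V v \<otimes> ghost u p = ghost u p"
proof (induction p arbitrary: u)
  case (Cons a p)
  then have "a \<in> arcs G" "awalk (head G a) p v" "v \<in> verts G"
    by (auto simp: G.awalk_simps dest: awalk_verts(2))
  then show ?case using Cons.IH by (simp flip: m_assoc)
qed (auto simp: G.awalk_simps VV)

lemma ghost_V: "awalk u p v \<Longrightarrow> ghost u p \<otimes> V u = ghost u p"
  by (cases p) (auto simp: G.awalk_simps VV HV m_assoc)

lemma path_append: "\<lbrakk>awalk u p v; awalk v q x\<rbrakk> \<Longrightarrow> path u (p @ q) = path u p \<otimes> path v q"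
  by (induction p arbitrary: u) (auto simp: G.awalk_simps V_path m_assoc)

lemma ghost_append: "\<lbrakk>awalk u p v; awalk v q x\<rbrakk> \<Longrightarrow> ghost u (p @ q) = ghost v q \<otimes> ghost u p"
  by (induction p arbitrary: u) (auto simp: G.awalk_simps ghost_V m_assoc)

text \<open>The innermost factor \<open>H a \<otimes> E a\<close> is a vertex, so the product
  telescopes. It is the source of all nonvanishing: a walk to a surviving vertex has a nonzero
  path.\<close>

lemma ghost_path: "awalk u p v \<Longrightarrow> ghost u p \<otimes> path u p = V v"
proof (induction p arbitrary: u)
  case Nil
  then show ?case by (auto simp: G.awalk_simps VV)
next
  case (Cons a p)
  then have a: "a \<in> arcs G" "awalk (head G a) p v" by (auto simp: G.awalk_simps)
  have "ghost u (a # p) \<otimes> path u (a # p) = ghost (head G a) p \<otimes> (H a \<otimes> E a) \<otimes> path (head G a) p"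
    using a by (simp add: m_assoc)
  also have "\<dots> = V v" using a Cons.IH by (simp add: HE ghost_V)
  finally show ?case .
qed

lemma ghost_path_append:
  assumes "awalk u p v" "awalk v r x"
  shows "ghost u p \<otimes> path u (p @ r) = path v r" "ghost u (p @ r) \<otimes> path u p = ghost v r"
  using assms ghost_path[OF assms(1)]
  by (simp_all add: path_append ghost_append V_path ghost_V m_assoc) (simp add: V_path flip: m_assoc)

text \<open>The walks agree up to some position and then continue with different edges, where
  \<open>H a \<otimes> E b = \<zero>\<close>.\<close>

lemma ghost_path_incomparable:
  assumes "awalk u p v" "awalk u q x" "\<And>r. q \<noteq> p @ r" "\<And>r. p \<noteq> q @ r"
  shows "ghost u p \<otimes> path u q = \<zero>"
  using assms
proof (induction p arbitrary: u q)
  case Nil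
  then show ?case using Nil.prems(3)[of q] by simp
next
  case (Cons a p)
  then obtain b q' where q: "q = b # q'" by (cases q) auto
  have a: "a \<in> arcs G" "awalk (head G a) p v" and b: "b \<in> arcs G" "awalk (head G b) q' x"
    using Cons.prems(1,2) by (auto simp: q G.awalk_simps)
  have "ghost u (a # p) \<otimes> path u q = ghost (head G a) p \<otimes> (H a \<otimes> E b) \<otimes> path (head G b) q'"
    using a b by (simp add: q m_assoc)
  also have "\<dots> = \<zero>"
  proof (cases "a = b")
    case True
    then have "ghost (head G a) p \<otimes> path (head G a) q' = \<zero>"
      using Cons.prems(3,4) a b by (intro Cons.IH) (auto simp: q)
    then show ?thesis using True a by (simp add: HE ghost_V)
  qed (use a b in \<open>simp add: HE\<close>)
  finally show ?case .
qed

definition monomials where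
  "monomials = {path u p \<otimes> ghost u' q | u p u' q v. awalk u p v \<and> awalk u' q v}"

lemma monomials_closed: "monomials \<subseteq> carrier R"
  by (auto simp: monomials_def)

text \<open>A vertex or an edge acts on the first factor only. A ghost edge cancels the first edge
  of the path or gives zero; if the path is empty, it prolongs the ghost part instead. No case
  produces a proper sum.\<close>

lemma generator_times_monomial:
  assumes m: "m \<in> monomials"
  shows "v \<in> verts G \<Longrightarrow> V v \<otimes> m \<in> insert \<zero> monomials"
    and "a \<in> arcs G \<Longrightarrow> E a \<otimes> m \<in> insert \<zero> monomials"
    and "a \<in> arcs G \<Longrightarrow> H a \<otimes> m \<in> insert \<zero> monomials"
proof -
  obtain u p u' q x where e: "m = path u p \<otimes> ghost u' q" and w: "awalk u p x" "awalk u' q x"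
    using m unfolding monomials_def by blast
  have uv: "u \<in> verts G" "u' \<in> verts G" "x \<in> verts G" using w awalk_verts by auto
  have c: "path u p \<in> carrier R" "ghost u' q \<in> carrier R" using w by auto
  {
    fix v assume v: "v \<in> verts G"
    have "V v \<otimes> m = V v \<otimes> (V u \<otimes> path u p) \<otimes> ghost u' q"
      unfolding V_path[OF w(1)] e using v c by (simp add: m_assoc)
    also have "\<dots> = (V v \<otimes> V u) \<otimes> m" unfolding e using c v uv by (simp add: m_assoc)
    also have "\<dots> \<in> insert \<zero> monomials"
    proof (cases "v = u")
      case True
      have "V u \<otimes> m = m" unfolding e using c uv V_path[OF w(1)] by (simp flip: m_assoc)
      then show ?thesis using True m uv by (simp add: VV)
    qed (use v uv c in \<open>simp add: VV e\<close>)
    finally show "V v \<otimes> m \<in> insert \<zero> monomials" .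
  }
  {
    assume a: "a \<in> arcs G"
    have "E a \<otimes> m = (E a \<otimes> V (head G a)) \<otimes> (V u \<otimes> path u p) \<otimes> ghost u' q"
      unfolding V_path[OF w(1)] EV[OF a] e using a c by (simp add: m_assoc)
    also have "\<dots> = E a \<otimes> (V (head G a) \<otimes> V u) \<otimes> m" unfolding e using c a uv by (simp add: m_assoc)
    also have "\<dots> \<in> insert \<zero> monomials"
    proof (cases "head G a = u")
      case True
      have "E a \<otimes> (V (head G a) \<otimes> V u) = E a" using True EV[OF a] uv by (simp add: VV)
      then have "E a \<otimes> (V (head G a) \<otimes> V u) \<otimes> m = path (tail G a) (a # p) \<otimes> ghost u' q"
        using True a c by (simp add: e m_assoc)
      moreover have "awalk (tail G a) (a # p) x" using a w True by (simp add: G.awalk_simps)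
      ultimately show ?thesis using w unfolding monomials_def by blast
    qed (use a uv c in \<open>simp add: VV e\<close>)
    finally show "E a \<otimes> m \<in> insert \<zero> monomials" .
  }
  {
    assume a: "a \<in> arcs G"
    show "H a \<otimes> m \<in> insert \<zero> monomials"
    proof (cases p)
      case Nil
      have xu: "x = u" using w(1) Nil by (simp add: G.awalk_simps)
      have "H a \<otimes> m = (H a \<otimes> V (tail G a)) \<otimes> (V u \<otimes> ghost u' q)"
        unfolding HV[OF a] e Nil by simp
      also have "\<dots> = H a \<otimes> (V (tail G a) \<otimes> V u) \<otimes> ghost u' q" using a c uv by (simp add: m_assoc)
      also have "\<dots> \<in> insert \<zero> monomials"
      proof (cases "tail G a = u")
        case True
        have a': "awalk x [a] (head G a)" using a True xu by (simp add: G.awalk_simps)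
        have "ghost u' (q @ [a]) = V (head G a) \<otimes> H a \<otimes> ghost u' q"
          using ghost_append[OF w(2) a'] by simp
        moreover have "H a \<otimes> (V (tail G a) \<otimes> V u) = H a" using True HV[OF a] uv by (simp add: VV)
        ultimately have "H a \<otimes> (V (tail G a) \<otimes> V u) \<otimes> ghost u' q = path (head G a) [] \<otimes> ghost u' (q @ [a])"
          using a c by (simp add: VH) (simp add: VH flip: m_assoc)
        moreover have "awalk u' (q @ [a]) (head G a)" using w(2) a' by (auto simp: awalk_append)
        moreover have "awalk (head G a) [] (head G a)" using a by (simp add: G.awalk_simps)
        ultimately show ?thesis unfolding monomials_def by blast
      qed (use a uv c in \<open>simp add: VV\<close>)
      finally show ?thesis .
    next
      case (Cons b p')
      have b: "b \<in> arcs G" "awalk (head G b) p' x" using w(1) by (auto simp: Cons G.awalk_simps)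
      have "H a \<otimes> m = (H a \<otimes> E b) \<otimes> path (head G b) p' \<otimes> ghost u' q"
        using a b c by (simp add: e Cons m_assoc)
      also have "\<dots> \<in> insert \<zero> monomials"
      proof (cases "a = b")
        case True
        then have "(H a \<otimes> E b) \<otimes> path (head G b) p' \<otimes> ghost u' q = path (head G b) p' \<otimes> ghost u' q"
          using a b by (simp add: HE V_path)
        then show ?thesis using b w unfolding monomials_def by blast
      qed (use a b c in \<open>simp add: HE\<close>)
      finally show ?thesis .
    qed
  }
qed

text \<open>The span contains the vertices and is closed under left multiplication by generators,
  which is all that \<open>generated\<close> asks for.\<close>

lemma carrier_span: "carrier R \<subseteq> span monomials"
proof (rule generated)
  note mc = monomials_closed
  have ins: "x \<in> span monomials" if "x \<in> insert \<zero> monomials" for x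
    using that lin_span.zero span_base[OF _ mc] by blast
  have left: "g \<otimes> x \<in> span monomials"
    if g: "g \<in> carrier R" "\<And>m. m \<in> monomials \<Longrightarrow> g \<otimes> m \<in> insert \<zero> monomials" and x: "x \<in> span monomials" for g x
  proof -
    have "g \<otimes> x \<otimes> \<one> \<in> span monomials"
    proof (rule span_sandwich[OF x mc mc g(1) one_closed])
      fix m assume m: "m \<in> monomials"
      then show "g \<otimes> m \<otimes> \<one> \<in> span monomials" using ins[OF g(2)[OF m]] g(1) mc by (simp add: subset_iff)
    qed
    then show ?thesis using g(1) span_closed[OF x mc] by simp
  qed
  show "\<zero> \<in> span monomials" by (rule lin_span.zero)
  show "x \<oplus> y \<in> span monomials" if "x \<in> span monomials" "y \<in> span monomials" for x y
    using span_add[OF that mc] .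
  show "\<iota> k \<otimes> x \<in> span monomials" if "k \<in> carrier K" "x \<in> span monomials" for k x
    using span_smult[OF that mc] .
  show "V v \<in> span monomials" if v: "v \<in> verts G" for v
  proof (rule span_base[OF _ mc])
    have "V v = path v [] \<otimes> ghost v []" using v by (simp add: VV)
    moreover have "awalk v [] v" using v by (simp add: G.awalk_simps)
    ultimately show "V v \<in> monomials" unfolding monomials_def by blast
  qed
  show "V v \<otimes> x \<in> span monomials" if "v \<in> verts G" "x \<in> span monomials" for v x
    using left[OF V_closed[OF that(1)]] generator_times_monomial(1) that by blast
  show "E a \<otimes> x \<in> span monomials" if "a \<in> arcs G" "x \<in> span monomials" for a x
    using left[OF E_closed[OF that(1)]] generator_times_monomial(2) that by blast
  show "H a \<otimes> x \<in> span monomials" if "a \<in> arcs G" "x \<in> span monomials" for a x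
    using left[OF H_closed[OF that(1)]] generator_times_monomial(3) that by blast
qed

lemma V_mult_path:
  assumes "u \<in> verts G" "awalk v p x"
  shows "V u \<otimes> path v p = (if u = v then path v p else \<zero>)"
proof -
  have v: "v \<in> verts G" using assms awalk_verts by blast
  have "V u \<otimes> path v p = (V u \<otimes> V v) \<otimes> path v p"
    using assms v V_path[OF assms(2)] by (simp add: m_assoc)
  then show ?thesis using assms v by (simp add: VV V_path)
qed

lemma ghost_mult_V:
  assumes "u \<in> verts G" "awalk v p x"
  shows "ghost v p \<otimes> V u = (if u = v then ghost v p else \<zero>)"
proof -
  have v: "v \<in> verts G" using assms awalk_verts by blast
  have "ghost v p \<otimes> V u = ghost v p \<otimes> (V v \<otimes> V u)"
    using assms v ghost_V[OF assms(2)] by (simp flip: m_assoc)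
  then show ?thesis using assms v by (simp add: VV ghost_V)
qed

definition monomials_at where
  "monomials_at w = {path w p \<otimes> ghost w q | p q v. awalk w p v \<and> awalk w q v}"

lemma monomials_at_closed: "monomials_at w \<subseteq> carrier R"
  by (auto simp: monomials_at_def)

lemma monomial_at_vertices:
  assumes uv: "u \<in> verts G" "v \<in> verts G" and m: "m \<in> monomials"
  shows "V u \<otimes> m \<otimes> V v = \<zero> \<or>
    (\<exists>p q x. V u \<otimes> m \<otimes> V v = path u p \<otimes> ghost v q \<and> awalk u p x \<and> awalk v q x)"
proof -
  obtain u' p v' q x where e: "m = path u' p \<otimes> ghost v' q" and w: "awalk u' p x" "awalk v' q x"
    using m unfolding monomials_def by blast
  have "V u \<otimes> m \<otimes> V v = (V u \<otimes> path u' p) \<otimes> (ghost v' q \<otimes> V v)"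
    using uv w by (simp add: e m_assoc)
  also have "\<dots> = (if u = u' then path u' p else \<zero>) \<otimes> (if v = v' then ghost v' q else \<zero>)"
    using uv w by (simp add: V_mult_path ghost_mult_V)
  finally show ?thesis using w by (cases "u = u'"; cases "v = v'") auto
qed

lemma corner_span:
  assumes "w \<in> verts G" "x \<in> carrier R"
  shows "V w \<otimes> x \<otimes> V w \<in> span (monomials_at w)"
proof (rule span_sandwich)
  show "x \<in> span monomials" using carrier_span assms by blast
  fix m assume "m \<in> monomials"
  then have "V w \<otimes> m \<otimes> V w \<in> insert \<zero> (monomials_at w)"
    using monomial_at_vertices[OF assms(1,1)] unfolding monomials_at_def by blast
  then show "V w \<otimes> m \<otimes> V w \<in> span (monomials_at w)"
    by (auto intro: span_base[OF _ monomials_at_closed] lin_span.zero)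
qed (use assms monomials_closed monomials_at_closed in auto)

end

text \<open>Relations and generation persist in homomorphic images. Nonvanishing does not, which is
  why the locale permits vertices to be zero.\<close>

lemma leavitt_family_image:
  assumes "leavitt_family R G K \<iota> V E H" and h: "surj_ring_hom R S h"
  shows "leavitt_family S G K (h \<circ> \<iota>) (h \<circ> V) (h \<circ> E) (h \<circ> H)"
proof -
  interpret leavitt_family R G K \<iota> V E H by fact
  interpret h: surj_ring_hom R S h by fact
  show ?thesis
  proof (intro leavitt_family.intro leavitt_family_axioms.intro, goal_cases)
    case 4
    show ?case
      by (rule ring_hom_ringI) (auto simp: K.ring_axioms h.S.ring_axioms)
  next
    case (5 k y)
    then obtain x where "x \<in> carrier R" "y = h x" by (elim h.surjE)
    then show ?case using 5 \<iota>_central[of k x] by (simp flip: h.hom_mult)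
  next
    case (15 v)
    have "h (V v) = h (\<Oplus>\<^bsub>R\<^esub>a\<in>out_arcs G v. E a \<otimes>\<^bsub>R\<^esub> H a)" using CK[OF 15] by simp
    also have "\<dots> = (\<Oplus>\<^bsub>S\<^esub>a\<in>out_arcs G v. h (E a \<otimes>\<^bsub>R\<^esub> H a))"
      by (subst h.hom_finsum) (auto simp: comp_def)
    also have "\<dots> = (\<Oplus>\<^bsub>S\<^esub>a\<in>out_arcs G v. h (E a) \<otimes>\<^bsub>S\<^esub> h (H a))"
      by (intro h.S.finsum_cong') auto
    finally show ?case by simp
  next
    case 16
    have "\<one>\<^bsub>S\<^esub> = h (\<Oplus>\<^bsub>R\<^esub>v\<in>verts G. V v)" using V_sum h.hom_one by simp
    then show ?case by (subst (asm) h.hom_finsum) (auto simp: comp_def)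
  next
    case (17 W)
    have "carrier R \<subseteq> {x \<in> carrier R. h x \<in> W}"
      by (rule generated) (simp_all add: 17(1) 17(2,3,4,5,6,7)[unfolded comp_def])
    then have "h ` carrier R \<subseteq> W" by auto
    then show ?case unfolding h.surj .
  qed (auto simp: VV VE EV VH HV HE h.S.ring_axioms G.fin_digraph_axioms K.field_axioms simp flip: h.hom_mult)
qed

section \<open>Words without short periods\<close>

definition aperiodic :: "nat \<Rightarrow> 'x list \<Rightarrow> bool" where
  "aperiodic N r \<longleftrightarrow> (\<forall>d. 0 < d \<and> d \<le> N \<longrightarrow> (\<exists>i. i + d < length r \<and> r ! (i + d) \<noteq> r ! i))"

lemma aperiodic_mono: "\<lbrakk>aperiodic N r; M \<le> N\<rbrakk> \<Longrightarrow> aperiodic M r"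
  unfolding aperiodic_def by auto

lemma aperiodic_append: "aperiodic N r \<Longrightarrow> aperiodic N (s @ r)"
  unfolding aperiodic_def
proof (intro allI impI)
  fix d assume r: "\<forall>d. 0 < d \<and> d \<le> N \<longrightarrow> (\<exists>i. i + d < length r \<and> r ! (i + d) \<noteq> r ! i)"
    and d: "0 < d \<and> d \<le> N"
  then obtain i where i: "i + d < length r" "r ! (i + d) \<noteq> r ! i" by blast
  show "\<exists>i. i + d < length (s @ r) \<and> (s @ r) ! (i + d) \<noteq> (s @ r) ! i"
    by (rule exI[of _ "length s + i"]) (use i in \<open>simp add: nth_append\<close>)
qed

text \<open>The equation makes \<open>length g\<close> a period of \<open>r\<close>, unless
  \<open>g\<close> is empty.\<close>

lemma aperiodic_prefix:
  assumes "aperiodic N r" "g @ r = r @ s" "length g \<le> N"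
  shows "g = []"
proof (rule ccontr)
  assume "g \<noteq> []"
  then obtain i where i: "i + length g < length r" "r ! (i + length g) \<noteq> r ! i"
    using assms(1,3) unfolding aperiodic_def by (metis length_greater_0_conv)
  have "r ! (i + length g) = (r @ s) ! (i + length g)" using i(1) by (simp add: nth_append)
  also have "\<dots> = r ! i" unfolding assms(2)[symmetric] by (simp add: nth_append)
  finally show False using i(2) by simp
qed

lemma length_concat_replicate: "length (concat (replicate n x)) = n * length x"
  by (induction n) auto

lemma nth_concat_replicate:
  "\<lbrakk>j < n; i < length x\<rbrakk> \<Longrightarrow> concat (replicate n x) ! (j * length x + i) = x ! i"
proof (induction n arbitrary: j)
  case (Suc n)
  then show ?case by (cases j) (auto simp: nth_append)
qed simp

text \<open>
  A period \<open>d \<le> N\<close> of the word \<open>x\<^sup>N y\<close> yields the period \<open>d \<cdot> |x|\<close>, which compares \<open>y\<close> with an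
  occurrence of \<open>x\<close>.
\<close>

lemma aperiodic_exists:
  assumes "length x = length y" "x \<noteq> y"
  shows "aperiodic N (concat (replicate N x) @ y)"
  unfolding aperiodic_def
proof (intro allI impI, rule ccontr)
  let ?r = "concat (replicate N x) @ y"
  fix d assume d: "0 < d \<and> d \<le> N" and "\<not> (\<exists>i. i + d < length ?r \<and> ?r ! (i + d) \<noteq> ?r ! i)"
  then have per: "?r ! (i + d) = ?r ! i" if "i + d < length ?r" for i using that by blast
  have mult: "?r ! (i + k * d) = ?r ! i" if "i + k * d < length ?r" for i k
    using that
  proof (induction k)
    case (Suc k)
    then show ?case using per[of "i + k * d"] by (simp add: add_ac)
  qed simp
  have "x ! i = y ! i" if i: "i < length x" for i
  proof -
    \<comment> \<open>The shift by \<open>length x * d\<close> leads from letter \<open>i\<close> of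
      the block of \<open>x\<close> with index \<open>N - d\<close> exactly to letter
      \<open>i\<close> of \<open>y\<close>.\<close>
    have Nd: "(N - d) * length x + length x * d = N * length x"
      using d by (metis add_mult_distrib le_add_diff_inverse2 mult.commute)
    then have e: "(N - d) * length x + i + length x * d = N * length x + i" by simp
    have "?r ! ((N - d) * length x + i) = ?r ! (N * length x + i)"
      using mult[of "(N - d) * length x + i" "length x"] i assms(1)
      unfolding e by (simp add: length_concat_replicate)
    moreover have "?r ! (N * length x + i) = y ! i"
      by (simp add: nth_append length_concat_replicate)
    moreover have "(N - d) * length x + i < N * length x"
    proof -
      have "(N - d) * length x + i < (N - d) * length x + length x * 1" using i by simp
      also have "\<dots> \<le> (N - d) * length x + length x * d" using d by (intro add_left_mono mult_left_mono) auto
      also have "\<dots> = N * length x" by (rule Nd)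
      finally show ?thesis .
    qed
    then have "?r ! ((N - d) * length x + i) = x ! i"
      using nth_concat_replicate[of "N - d" N i x] d i
      by (simp add: nth_append length_concat_replicate)
    ultimately show ?thesis by simp
  qed
  then show False using assms by (metis nth_equalityI)
qed

section \<open>A vertex below all others\<close>

locale prime_leavitt_family = leavitt_family R G K \<iota> V E H + prime_ring R
  for R :: "('a, 'r) ring_scheme" (structure) and G :: "('v, 'e) pre_digraph" and K :: "('k, 'm) ring_scheme"
    and \<iota> V E H
begin

declare G.awalk_append_iff [simp del]

lemma awalk_appendI: "\<lbrakk>awalk u p x; awalk x q v\<rbrakk> \<Longrightarrow> awalk u (p @ q) v"
  unfolding awalk_append by blast

text \<open>Primeness gives a nonzero element between \<open>V u\<close> and \<open>V v\<close>, so
  some monomial between them is nonzero. Its path and its ghost part end at the same vertex, which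
  cannot vanish.\<close>

lemma lower_bound_pair:
  assumes u: "u \<in> verts G" "V u \<noteq> \<zero>" and v: "v \<in> verts G" "V v \<noteq> \<zero>"
  obtains x p q where "x \<in> verts G" "V x \<noteq> \<zero>" "awalk u p x" "awalk v q x"
proof -
  obtain b where b: "b \<in> carrier R" "V u \<otimes> b \<otimes> V v \<noteq> \<zero>"
    using prime[of "V u" "V v"] u v by auto
  have "\<exists>m\<in>monomials. V u \<otimes> m \<otimes> V v \<noteq> \<zero>"
  proof (rule ccontr)
    assume "\<not> ?thesis"
    then have "V u \<otimes> m \<otimes> V v \<in> span {}" if "m \<in> monomials" for m
      using that lin_span.zero by auto
    then have "V u \<otimes> b \<otimes> V v \<in> span {}"
      using span_sandwich[of b monomials "{}"] carrier_span monomials_closed b(1) u(1) v(1) by auto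
    then show False using b(2) by (auto elim: lin_span.cases)
  qed
  then obtain m where m: "m \<in> monomials" "V u \<otimes> m \<otimes> V v \<noteq> \<zero>" by blast
  then obtain p q x where e: "V u \<otimes> m \<otimes> V v = path u p \<otimes> ghost v q" and w: "awalk u p x" "awalk v q x"
    using monomial_at_vertices[OF u(1) v(1) m(1)] by blast
  have x: "x \<in> verts G" using w awalk_verts by blast
  have "V x \<noteq> \<zero>"
  proof
    assume "V x = \<zero>"
    then have "path u p = \<zero>" using path_V[OF w(1)] w by simp
    then show False using e m(2) w by simp
  qed
  then show ?thesis using that w x by blast
qed

lemma lower_bound_exists:
  obtains w where "w \<in> verts G" "V w \<noteq> \<zero>" "\<And>u. \<lbrakk>u \<in> verts G; V u \<noteq> \<zero>\<rbrakk> \<Longrightarrow> \<exists>p. awalk u p w"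
proof -
  let ?T = "{v \<in> verts G. V v \<noteq> \<zero>}"
  \<comment> \<open>The unit is the sum of all vertices, so some vertex survives; it also serves as
    the bound for the empty set below.\<close>
  have "?T \<noteq> {}"
  proof
    assume "?T = {}"
    then have "(\<Oplus>v\<in>verts G. V v) = (\<Oplus>v\<in>verts G. \<zero>)" by (intro finsum_cong') auto
    then show False using V_sum one_neq_zero by (simp add: finsum_zero)
  qed
  then obtain t where t: "t \<in> ?T" by blast
  have "\<exists>w\<in>?T. \<forall>u\<in>A. \<exists>p. awalk u p w" if "finite A" "A \<subseteq> ?T" for A
    using that
  proof (induction A rule: finite_induct)
    case empty
    then show ?case using t by blast
  next
    case (insert u A)
    then obtain w where w: "w \<in> ?T" "\<And>u. u \<in> A \<Longrightarrow> \<exists>p. awalk u p w" by blast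
    obtain x p q where x: "x \<in> verts G" "V x \<noteq> \<zero>" "awalk u p x" "awalk w q x"
      by (rule lower_bound_pair[of u w]) (use insert.prems w(1) in auto)
    have "\<exists>p. awalk y p x" if "y \<in> A" for y
      using w(2)[OF that] x(4) awalk_append by blast
    then show ?case using x by blast
  qed
  from this[of ?T] show ?thesis using that by auto
qed

end

locale bottom_vertex = prime_leavitt_family +
  fixes w
  assumes w_vert: "w \<in> verts G" and Vw_nonzero: "V w \<noteq> \<zero>"
    and reach: "\<lbrakk>u \<in> verts G; V u \<noteq> \<zero>\<rbrakk> \<Longrightarrow> \<exists>p. awalk u p w"
begin

sublocale corner R "V w"
  by unfold_locales (use w_vert Vw_nonzero in \<open>auto simp: VV\<close>)

definition scalar_set where "scalar_set = (\<lambda>k. \<iota> k \<otimes> V w) ` carrier K"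

text \<open>Equal length makes both alternatives usable at once: different walks of equal length are
  not prefixes of each other, and if there are none, then \<open>x @ y = y @ x\<close> for closed
  walks, as both sides have the same length.\<close>

definition branching where
  "branching \<longleftrightarrow> (\<exists>x y. awalk w x w \<and> awalk w y w \<and> length x = length y \<and> x \<noteq> y)"

lemma D_span: "x \<in> carrier D \<Longrightarrow> x \<in> span (monomials_at w)"
  using corner_span[OF w_vert, of x] by (simp add: D_iff)

lemma awalk_power: "awalk w x w \<Longrightarrow> awalk w (concat (replicate n x)) w"
  by (induction n) (use w_vert in \<open>auto simp: awalk_append G.awalk_simps\<close>)

lemma path_D: "awalk w p w \<Longrightarrow> path w p \<in> carrier D"
  by (simp add: D_iff V_path path_V)

lemma ghost_D: "awalk w p w \<Longrightarrow> ghost w p \<in> carrier D"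
  by (simp add: D_iff V_ghost ghost_V)

subsection \<open>Two closed walks of the same length\<close>

context
  assumes br: branching
begin

lemma aperiodic_closed_walk:
  obtains r where "awalk w r w" "aperiodic N r"
proof -
  obtain x y where xy: "awalk w x w" "awalk w y w" "length x = length y" "x \<noteq> y"
    using br unfolding branching_def by blast
  have "awalk w (concat (replicate N x) @ y) w"
    using awalk_appendI[OF awalk_power[OF xy(1)] xy(2)] .
  then show ?thesis using that aperiodic_exists[OF xy(3,4)] by blast
qed

lemma nonempty_closed_walk:
  obtains x where "awalk w x w" "x \<noteq> []"
  using br unfolding branching_def by auto

lemma not_sink:
  assumes u: "u \<in> verts G" "V u \<noteq> \<zero>"
  shows "out_arcs G u \<noteq> {}"
proof -
  obtain p where p: "awalk u p w" using reach[OF u] by blast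
  obtain x where x: "awalk w x w" "x \<noteq> []" by (rule nonempty_closed_walk)
  have "awalk u (p @ x) w" "p @ x \<noteq> []" using p x by (auto simp: awalk_append)
  then obtain a q where "awalk u (a # q) w" by (cases "p @ x") auto
  then show ?thesis by (auto simp: G.awalk_simps out_arcs_def)
qed

text \<open>If \<open>a\<close> times a path to \<open>u\<close> is nonzero, then \<open>u\<close>
  survives and emits an edge, and expanding \<open>V u\<close> by the relation \<open>CK\<close>
  shows that some prolongation by an edge keeps the product nonzero.\<close>

lemma long_walk_nonzero:
  assumes a: "a \<in> carrier D" "a \<noteq> \<zero>"
  shows "\<exists>p u. awalk w p u \<and> length p = n \<and> a \<otimes> path w p \<noteq> \<zero>"
proof (induction n)
  case 0
  have "awalk w [] w" "a \<otimes> path w [] \<noteq> \<zero>" using a w_vert by (simp_all add: G.awalk_simps DD)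
  then show ?case by (metis list.size(3))
next
  case (Suc n)
  then obtain p u where p: "awalk w p u" "length p = n" "a \<otimes> path w p \<noteq> \<zero>" by blast
  note aR = DD(1)[OF a(1)]
  have u: "u \<in> verts G" using awalk_verts p by blast
  have aV: "a \<otimes> path w p \<otimes> V u = a \<otimes> path w p" using p aR u by (simp add: m_assoc path_V)
  then have "V u \<noteq> \<zero>" using p aR by auto
  then have ne: "out_arcs G u \<noteq> {}" using not_sink u by blast
  have fin: "finite (out_arcs G u)" by (rule finite_subset[OF _ G.finite_arcs]) (auto simp: out_arcs_def)
  have "\<exists>e\<in>out_arcs G u. a \<otimes> path w p \<otimes> E e \<noteq> \<zero>"
  proof (rule ccontr)
    assume neg: "\<not> ?thesis"
    have "a \<otimes> path w p = a \<otimes> path w p \<otimes> (\<Oplus>e\<in>out_arcs G u. E e \<otimes> H e)"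
      using aV CK[OF u ne] by simp
    also have "\<dots> = (\<Oplus>e\<in>out_arcs G u. a \<otimes> path w p \<otimes> (E e \<otimes> H e))"
      using fin aR p by (intro finsum_rdistr) (auto simp: out_arcs_def)
    also have "\<dots> = (\<Oplus>e\<in>out_arcs G u. \<zero>)"
    proof (intro finsum_cong')
      fix e assume e: "e \<in> out_arcs G u"
      then have "a \<otimes> path w p \<otimes> (E e \<otimes> H e) = a \<otimes> path w p \<otimes> E e \<otimes> H e"
        using aR p by (simp add: out_arcs_def m_assoc)
      then show "a \<otimes> path w p \<otimes> (E e \<otimes> H e) = \<zero>" using neg e by (simp add: out_arcs_def)
    qed auto
    finally show False using p(3) by (simp add: finsum_zero)
  qed
  then obtain e where e: "e \<in> arcs G" "tail G e = u" "a \<otimes> path w p \<otimes> E e \<noteq> \<zero>"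
    by (auto simp: out_arcs_def)
  then have e': "awalk u [e] (head G e)" by (simp add: G.awalk_simps)
  have "path w (p @ [e]) = path w p \<otimes> E e" using path_append[OF p(1) e'] e EV by simp
  then have "a \<otimes> path w (p @ [e]) \<noteq> \<zero>" using e aR p by (simp add: m_assoc)
  moreover have "awalk w (p @ [e]) (head G e)" using p e' by (auto simp: awalk_append)
  ultimately show ?case using p(2) by (metis length_append_singleton)
qed

text \<open>Against a path at least as long as all ghost parts of \<open>a\<close>, each ghost part
  is either cancelled completely or yields zero, so only paths remain.\<close>

lemma ghost_elimination:
  assumes "a \<in> span (monomials_at w)"
  shows "\<exists>n. \<forall>p u. awalk w p u \<longrightarrow> n \<le> length p \<longrightarrow> a \<otimes> path w p \<in> span {path w r | r. awalk w r u}"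
  using assms
proof (induction rule: lin_span.induct)
  case zero
  then show ?case by (auto simp: lin_span.zero)
next
  case (add k m y)
  obtain n where n: "\<And>p u. \<lbrakk>awalk w p u; n \<le> length p\<rbrakk> \<Longrightarrow> y \<otimes> path w p \<in> span {path w r | r. awalk w r u}"
    using add by blast
  obtain s q x where m: "m = path w s \<otimes> ghost w q" and wk: "awalk w s x" "awalk w q x"
    using add(2) unfolding monomials_at_def by blast
  have y: "y \<in> carrier R" using span_closed[OF add(3) monomials_at_closed] .
  have "(\<iota> k \<otimes> m \<oplus> y) \<otimes> path w p \<in> span {path w r | r. awalk w r u}"
    if p: "awalk w p u" "max n (length q) \<le> length p" for p u
  proof -
    let ?M = "{path w r | r. awalk w r u}"
    have M: "?M \<subseteq> carrier R" by auto
    have "path w s \<otimes> (ghost w q \<otimes> path w p) \<in> span ?M"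
    proof (cases "\<exists>r. p = q @ r")
      case True
      then obtain r where r: "p = q @ r" by blast
      then have r': "awalk x r u" using p(1) wk(2) awalk_end_unique by (auto simp: awalk_append)
      have "awalk w (s @ r) u" using awalk_appendI[OF wk(1) r'] .
      moreover have "path w s \<otimes> (ghost w q \<otimes> path w p) = path w (s @ r)"
        using ghost_path_append(1)[OF wk(2) r'] path_append[OF wk(1) r'] r by simp
      ultimately show ?thesis using span_base[OF _ M] by auto
    next
      case False
      have "ghost w q \<otimes> path w p = \<zero>"
        using p(2) False by (intro ghost_path_incomparable[OF wk(2) p(1)]) auto
      then show ?thesis using wk by (simp add: lin_span.zero)
    qed
    then have "\<iota> k \<otimes> (path w s \<otimes> (ghost w q \<otimes> path w p)) \<in> span ?M"
      using span_smult[OF add(1) _ M] by blast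
    then have "\<iota> k \<otimes> (path w s \<otimes> (ghost w q \<otimes> path w p)) \<oplus> y \<otimes> path w p \<in> span ?M"
      using n[OF p(1)] p(2) span_add[OF _ _ M] by simp
    then show ?thesis using y wk p(1) add(1) by (simp add: m l_distr m_assoc)
  qed
  then show ?case by blast
qed

text \<open>Each walk gets a single coefficient. Linear independence of the paths is not claimed; a
  coefficient is isolated later by sandwiching.\<close>

lemma collect_terms:
  assumes "b \<in> span {path w r | r. awalk w r u}"
  shows "\<exists>A k. finite A \<and> (\<forall>r\<in>A. awalk w r u) \<and> (\<forall>r. k r \<in> carrier K) \<and> (\<forall>r. r \<notin> A \<longrightarrow> k r = \<zero>\<^bsub>K\<^esub>) \<and>
    b = (\<Oplus>r\<in>A. \<iota> (k r) \<otimes> path w r)"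
  using assms
proof (induction rule: lin_span.induct)
  case zero
  then show ?case by (intro exI[of _ "{}"] exI[of _ "\<lambda>_. \<zero>\<^bsub>K\<^esub>"]) auto
next
  case (add c m y)
  obtain s where s: "m = path w s" "awalk w s u" using add(2) by blast
  obtain A k where A: "finite A" "\<And>r. r \<in> A \<Longrightarrow> awalk w r u" "\<And>r. k r \<in> carrier K"
    "\<And>r. r \<notin> A \<Longrightarrow> k r = \<zero>\<^bsub>K\<^esub>" "y = (\<Oplus>r\<in>A. \<iota> (k r) \<otimes> path w r)"
    using add(4) by blast
  \<comment> \<open>Taking \<open>s\<close> out of \<open>A\<close> and inserting it again treats a
    repeated walk and a new one alike, since \<open>k s\<close> is zero in the latter case.\<close>
  let ?B = "A - {s}" and ?k = "k(s := c \<oplus>\<^bsub>K\<^esub> k s)"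
  have cl: "\<iota> (k r) \<otimes> path w r \<in> carrier R" if "r \<in> insert s A" for r
    using that path_closed[OF A(2)] path_closed[OF s(2)] A(3) by auto
  have cl': "\<iota> (?k r) \<otimes> path w r \<in> carrier R" if "r \<in> insert s A" for r
    using that path_closed[OF A(2)] path_closed[OF s(2)] A(3) add(1) by auto
  have clB: "(\<Oplus>r\<in>?B. \<iota> (k r) \<otimes> path w r) \<in> carrier R" using cl by (intro finsum_closed) auto
  have "y = \<iota> (k s) \<otimes> path w s \<oplus> (\<Oplus>r\<in>?B. \<iota> (k r) \<otimes> path w r)"
  proof (cases "s \<in> A")
    case True
    then have "A = insert s ?B" by blast
    then have "y = (\<Oplus>r\<in>insert s ?B. \<iota> (k r) \<otimes> path w r)" using A(5) by simp
    then show ?thesis using A(1) cl by (subst (asm) finsum_insert) auto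
  next
    case False
    then show ?thesis using A(4)[OF False] A(5) s clB by simp
  qed
  then have "\<iota> c \<otimes> m \<oplus> y = \<iota> (?k s) \<otimes> path w s \<oplus> (\<Oplus>r\<in>?B. \<iota> (k r) \<otimes> path w r)"
    using add(1) A(3) s clB by (simp add: l_distr a_assoc)
  also have "(\<Oplus>r\<in>?B. \<iota> (k r) \<otimes> path w r) = (\<Oplus>r\<in>?B. \<iota> (?k r) \<otimes> path w r)"
    using cl by (intro finsum_cong') auto
  also have "\<iota> (?k s) \<otimes> path w s \<oplus> \<dots> = (\<Oplus>r\<in>insert s ?B. \<iota> (?k r) \<otimes> path w r)"
    using A(1) cl'[of s] cl' by (subst finsum_insert) auto
  finally show ?case
    using A s(2) add(1) by (intro exI[of _ "insert s ?B"] exI[of _ ?k]) auto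
qed

text \<open>Let \<open>s\<close> be a shortest walk with nonzero coefficient in an element
  \<open>b\<close> of the ideal that is a combination of paths. Multiplying by the ghost of
  \<open>s @ x\<close> on the left and by the path of \<open>x\<close> on the right, for an
  aperiodic \<open>x\<close>, annihilates every other term, and leaves a nonzero scalar multiple of
  \<open>V w\<close> in the ideal.\<close>

lemma branching_full: full
  unfolding full_def
proof (intro allI impI)
  fix I assume I: "ideal I R" "I \<noteq> {\<zero>}"
  obtain a where a: "a \<in> I" "a \<in> carrier D" "a \<noteq> \<zero>" by (rule ideal_corner_nonzero[OF I])
  obtain n where n: "\<And>p u. \<lbrakk>awalk w p u; n \<le> length p\<rbrakk> \<Longrightarrow> a \<otimes> path w p \<in> span {path w r | r. awalk w r u}"
    using ghost_elimination[OF D_span[OF a(2)]] by blast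
  obtain p u where p: "awalk w p u" "length p = n" "a \<otimes> path w p \<noteq> \<zero>"
    using long_walk_nonzero[OF a(2,3)] by blast
  note aR = DD(1)[OF a(2)]
  define b where "b = a \<otimes> path w p"
  have b: "b \<in> I" "b \<noteq> \<zero>" "b \<in> carrier R"
    unfolding b_def using ideal.I_r_closed[OF I(1) a(1)] p aR by auto
  have u: "u \<in> verts G" using awalk_verts p by blast
  have "b \<otimes> V u = b" unfolding b_def using p aR u by (simp add: m_assoc path_V)
  then have Vu: "V u \<noteq> \<zero>" using b by auto
  obtain A k where A: "finite A" "\<And>r. r \<in> A \<Longrightarrow> awalk w r u" "\<And>r. k r \<in> carrier K"
    and bA: "b = (\<Oplus>r\<in>A. \<iota> (k r) \<otimes> path w r)"
    using collect_terms[OF n[OF p(1)]] p(2) unfolding b_def by blast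
  have "\<exists>r\<in>A. k r \<noteq> \<zero>\<^bsub>K\<^esub>"
  proof (rule ccontr)
    assume "\<not> ?thesis"
    then have "b = (\<Oplus>r\<in>A. \<zero>)" unfolding bA using path_closed[OF A(2)] by (intro finsum_cong') auto
    then show False using b(2) by (simp add: finsum_zero)
  qed
  then obtain s where s: "s \<in> A" "k s \<noteq> \<zero>\<^bsub>K\<^esub>"
    and min: "\<And>r. \<lbrakk>r \<in> A; k r \<noteq> \<zero>\<^bsub>K\<^esub>\<rbrakk> \<Longrightarrow> length s \<le> length r"
    using ex_has_least_nat[of "\<lambda>r. r \<in> A \<and> k r \<noteq> \<zero>\<^bsub>K\<^esub>" _ length] by blast
  \<comment> \<open>The periods to be excluded are the lengths of final segments of walks in
    \<open>A\<close>.\<close>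
  define N where "N = Max (length ` A)"
  have N: "length r \<le> N" if "r \<in> A" for r unfolding N_def using A(1) that by auto
  obtain z where z: "awalk w z w" "aperiodic N z" by (rule aperiodic_closed_walk)
  obtain t where t: "awalk u t w" using reach[OF u Vu] by blast
  define x where "x = t @ z"
  have x: "awalk u x w" "aperiodic N x"
    unfolding x_def using t z by (auto simp: awalk_append intro: aperiodic_append)
  have wx: "awalk w (r @ x) w" if "r \<in> A" for r using A(2)[OF that] x(1) by (auto simp: awalk_append)
  have sandwich: "ghost w (s @ x) \<otimes> (\<iota> (k r) \<otimes> path w r) \<otimes> path u x = (if s = r then \<iota> (k s) \<otimes> V w else \<zero>)"
    if r: "r \<in> A" for r
  proof -
    have cl: "ghost w (s @ x) \<in> carrier R" "\<iota> (k r) \<in> carrier R" "path w r \<in> carrier R" "path u x \<in> carrier R"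
      using wx[OF s(1)] path_closed[OF A(2)[OF r]] A(3) x(1) by auto
    have "ghost w (s @ x) \<otimes> (\<iota> (k r) \<otimes> path w r) \<otimes> path u x = ghost w (s @ x) \<otimes> \<iota> (k r) \<otimes> (path w r \<otimes> path u x)"
      using cl by (simp add: m_assoc)
    also have "\<dots> = \<iota> (k r) \<otimes> (ghost w (s @ x) \<otimes> path w (r @ x))"
      using \<iota>_central[OF A(3) cl(1), symmetric] path_append[OF A(2)[OF r] x(1)] cl by (simp add: m_assoc)
    also have "\<dots> = (if s = r then \<iota> (k s) \<otimes> V w else \<zero>)"
    proof (cases "s = r")
      case True
      then show ?thesis using ghost_path[OF wx[OF s(1)]] by simp
    next
      case False
      show ?thesis
      proof (cases "k r = \<zero>\<^bsub>K\<^esub>")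
        case True
        then show ?thesis using False ghost_closed[OF wx[OF s(1)]] path_closed[OF wx[OF r]] by simp
      next
        case nz: False
        \<comment> \<open>If \<open>s @ x\<close> is a prefix of \<open>r @ x\<close>, the excess
          \<open>g\<close> of \<open>r\<close> over \<open>s\<close> is a period of \<open>x\<close>
          of length at most \<open>N\<close>. In the other direction the minimal length of
          \<open>s\<close> already forces equality.\<close>
        have "g = []" if g: "g @ x = x @ h" "r = s @ g" for g h
          using aperiodic_prefix[OF x(2) g(1)] N[OF r] g(2) by simp
        moreover have "\<exists>g. r = s @ g \<and> g @ x = x @ h" if "r @ x = (s @ x) @ h" for h
          using that min[OF r nz] by (auto simp: append_eq_append_conv2)
        ultimately have n1: "r @ x \<noteq> (s @ x) @ h" for h using False by fastforce
        have n2: "s @ x \<noteq> (r @ x) @ h" for h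
        proof
          assume a: "s @ x = (r @ x) @ h"
          have "length s + length x = length r + length x + length h"
            using arg_cong[OF a, of length] by (simp only: length_append)
          then have "h = []" using min[OF r nz] by simp
          then show False using a False by simp
        qed
        have "ghost w (s @ x) \<otimes> path w (r @ x) = \<zero>"
          using ghost_path_incomparable[OF wx[OF s(1)] wx[OF r]] n1 n2 by blast
        then show ?thesis using False A(3) by simp
      qed
    qed
    finally show ?thesis .
  qed
  have "ghost w (s @ x) \<otimes> b \<otimes> path u x = (\<Oplus>r\<in>A. ghost w (s @ x) \<otimes> (\<iota> (k r) \<otimes> path w r) \<otimes> path u x)"
    unfolding bA using A(1,3) path_closed[OF A(2)] wx[OF s(1)] x(1)
    by (subst finsum_rdistr, simp, simp, simp, subst finsum_ldistr) auto
  also have "\<dots> = (\<Oplus>r\<in>A. if s = r then \<iota> (k s) \<otimes> V w else \<zero>)"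
    using sandwich A(3) by (intro finsum_cong') auto
  also have "\<dots> = \<iota> (k s) \<otimes> V w"
    using s(1) A(1,3) by (intro finsum_singleton) auto
  finally have eq: "ghost w (s @ x) \<otimes> b \<otimes> path u x = \<iota> (k s) \<otimes> V w" .
  have "ghost w (s @ x) \<otimes> b \<otimes> path u x \<in> I"
    using wx[OF s(1)] x(1) b by (intro ideal.I_r_closed[OF I(1)] ideal.I_l_closed[OF I(1)]) auto
  then have mem: "\<iota> (k s) \<otimes> V w \<in> I" unfolding eq .
  have "k s \<in> Units K" using s(2) A(3) K.field_Units by simp
  then have i: "inv\<^bsub>K\<^esub> (k s) \<otimes>\<^bsub>K\<^esub> k s = \<one>\<^bsub>K\<^esub>" "inv\<^bsub>K\<^esub> (k s) \<in> carrier K" by auto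
  then have "\<iota> (inv\<^bsub>K\<^esub> (k s)) \<otimes> \<iota> (k s) = \<one>" using A(3) \<iota>.hom_mult \<iota>.hom_one by metis
  then have "\<iota> (inv\<^bsub>K\<^esub> (k s)) \<otimes> (\<iota> (k s) \<otimes> V w) = V w" using A(3) i(2) by (simp flip: m_assoc)
  then show "V w \<in> I" using ideal.I_l_closed[OF I(1) mem \<iota>.hom_closed[OF i(2)]] by simp
qed

text \<open>Let \<open>m\<close> consist of the path \<open>p\<close> and the ghost of
  \<open>q\<close>. The product is zero unless \<open>s @ r = q @ y\<close>, and is then the ghost
  of \<open>q @ y\<close> times the path of \<open>p @ y\<close>. The length of \<open>s\<close>
  ensures that \<open>y\<close> still ends with \<open>r\<close> and so has no short period; hence
  the two walks are comparable only for \<open>p = q\<close>, which gives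
  \<open>V w\<close>.\<close>

lemma compressed_monomial:
  assumes "m \<in> monomials_at w"
  shows "\<exists>n. \<forall>s r. awalk w s w \<longrightarrow> awalk w r w \<longrightarrow> n \<le> length s \<longrightarrow> aperiodic n r \<longrightarrow>
    ghost w (s @ r) \<otimes> m \<otimes> path w (s @ r) \<in> {\<zero>, V w}"
proof -
  obtain p q v where m: "m = path w p \<otimes> ghost w q" and wk: "awalk w p v" "awalk w q v"
    using assms unfolding monomials_at_def by blast
  show ?thesis
  proof (intro exI[of _ "max (length p) (length q)"] allI impI)
    fix s r assume s: "awalk w s w" "awalk w r w" "max (length p) (length q) \<le> length s"
      and r: "aperiodic (max (length p) (length q)) r"
    let ?x = "s @ r"
    have x: "awalk w ?x w" using awalk_appendI[OF s(1,2)] .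
    have eq: "ghost w ?x \<otimes> m \<otimes> path w ?x = ghost w ?x \<otimes> (path w p \<otimes> (ghost w q \<otimes> path w ?x))"
      using wk x by (simp add: m m_assoc)
    show "ghost w ?x \<otimes> m \<otimes> path w ?x \<in> {\<zero>, V w}"
    proof (cases "\<exists>y. ?x = q @ y")
      case False
      have "ghost w q \<otimes> path w ?x = \<zero>"
        using s(3) False by (intro ghost_path_incomparable[OF wk(2) x]) auto
      then show ?thesis unfolding eq using wk x by simp
    next
      case True
      then obtain y where y: "?x = q @ y" by blast
      have y': "awalk v y w" using x wk(2) awalk_end_unique unfolding y by (auto simp: awalk_append)
      have "\<exists>z. y = z @ r" using y s(3) by (auto simp: append_eq_append_conv2)
      then have ya: "aperiodic (max (length p) (length q)) y" using r aperiodic_append by blast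
      have py: "awalk w (p @ y) w" using wk(1) y' by (auto simp: awalk_append)
      have e2: "ghost w ?x \<otimes> m \<otimes> path w ?x = ghost w (q @ y) \<otimes> path w (p @ y)"
        unfolding eq unfolding y using ghost_path_append(1)[OF wk(2) y'] path_append[OF wk(1) y'] by simp
      show ?thesis
      proof (cases "p = q")
        case True
        then show ?thesis unfolding e2 using ghost_path[OF py] by simp
      next
        case neq: False
        have g: "g = []" if "g @ y = y @ h" "length g \<le> max (length p) (length q)" for g h
          by (rule aperiodic_prefix[OF ya that])
        have "p @ y \<noteq> (q @ y) @ h" for h
        proof
          assume a: "p @ y = (q @ y) @ h"
          have "length p + length y = length q + length y + length h"
            using arg_cong[OF a, of length] by (simp only: length_append)
          then have "length q \<le> length p" by simp
          then obtain g' where "p = q @ g'" using a by (auto simp: append_eq_append_conv2)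
          then show False using g[of g' h] a neq by simp
        qed
        moreover have "q @ y \<noteq> (p @ y) @ h" for h
        proof
          assume a: "q @ y = (p @ y) @ h"
          have "length q + length y = length p + length y + length h"
            using arg_cong[OF a, of length] by (simp only: length_append)
          then have "length p \<le> length q" by simp
          then obtain g' where "q = p @ g'" using a by (auto simp: append_eq_append_conv2)
          then show False using g[of g' h] a neq by simp
        qed
        ultimately show ?thesis
          unfolding e2 using ghost_path_incomparable[OF x[unfolded y] py] by blast
      qed
    qed
  qed
qed

end

end

section \<open>Scalars and rationality in the corner\<close>

context bottom_vertex
begin

lemma scalar_hom: "ring_hom_ring K D (\<lambda>k. \<iota> k \<otimes> V w)"
proof (rule ring_hom_ringI[OF K.ring_axioms ring_D])
  fix k l assume k: "k \<in> carrier K" and l: "l \<in> carrier K"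
  have "V w \<otimes> \<iota> k = \<iota> k \<otimes> V w" using \<iota>_central[OF k w_closed] by simp
  then show "\<iota> k \<otimes> V w \<in> carrier D"
    using k by (simp add: D_iff m_assoc) (simp add: m_assoc flip: m_assoc[of "V w" "\<iota> k"])
  have "V w \<otimes> \<iota> l = \<iota> l \<otimes> V w" using \<iota>_central[OF l w_closed] by simp
  then have "V w \<otimes> (\<iota> l \<otimes> V w) = \<iota> l \<otimes> V w"
    using l by (simp add: m_assoc flip: m_assoc[of "V w" "\<iota> l"])
  then show "\<iota> (k \<otimes>\<^bsub>K\<^esub> l) \<otimes> V w = \<iota> k \<otimes> V w \<otimes>\<^bsub>D\<^esub> (\<iota> l \<otimes> V w)"
    using k l by (simp add: m_assoc)
qed (simp_all add: l_distr)

lemma subfield_scalar_set: "subfield scalar_set D"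
  unfolding scalar_set_def
  using ring_hom_ring.img_is_subfield(2)[OF scalar_hom K.carrier_is_subfield] w_nonzero by simp

lemma scalar_set_Z: "scalar_set \<subseteq> Z"
proof
  fix z assume "z \<in> scalar_set"
  then obtain k where k: "k \<in> carrier K" "z = \<iota> k \<otimes> V w" unfolding scalar_set_def by blast
  have "z \<in> carrier D" using ring_hom_ring.homh[OF scalar_hom] k unfolding ring_hom_def by blast
  moreover have "z \<otimes> x = x \<otimes> z" if "x \<in> carrier D" for x
  proof -
    note x = DD[OF that]
    have "z \<otimes> x = \<iota> k \<otimes> x" using x k by (simp add: m_assoc)
    also have "\<dots> = x \<otimes> V w \<otimes> \<iota> k" using \<iota>_central[OF k(1) x(1)] x by simp
    also have "\<dots> = x \<otimes> (V w \<otimes> \<iota> k)" using x(1) k(1) by (simp add: m_assoc)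
    also have "V w \<otimes> \<iota> k = z" using k(2) \<iota>_central[OF k(1) w_closed] by simp
    finally show ?thesis .
  qed
  ultimately show "z \<in> Z" by (simp add: Z_iff)
qed

lemma scalar_set_algebraic:
  assumes "z \<in> scalar_set"
  shows "(ring.algebraic D over scalar_set) z"
proof -
  interpret DZ: ring D by (rule ring_D)
  note sub = subfieldE(1)[OF subfield_scalar_set]
  have z: "z \<in> carrier D" using assms scalar_set_Z Z_D(1) by blast
  show ?thesis
  proof (rule DZ.algebraicI)
    \<comment> \<open>The list below is the polynomial \<open>X - z\<close>, whose leading
      coefficient \<open>V w\<close> is the unit of \<open>D\<close>.\<close>
    have "V w \<in> scalar_set" "\<ominus>\<^bsub>D\<^esub> z \<in> scalar_set"
      using subringE(3)[OF sub] subringE(5)[OF sub assms] by simp_all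
    then show "[V w, \<ominus>\<^bsub>D\<^esub> z] \<in> carrier (scalar_set[X]\<^bsub>D\<^esub>)"
      using w_nonzero by (simp add: univ_poly_def polynomial_def)
    show "DZ.eval [V w, \<ominus>\<^bsub>D\<^esub> z] z = \<zero>\<^bsub>D\<^esub>"
    proof -
      have m: "\<ominus>\<^bsub>D\<^esub> z \<in> carrier D" using z by (rule DZ.a_inv_closed)
      have "DZ.eval [V w, \<ominus>\<^bsub>D\<^esub> z] z = V w \<otimes>\<^bsub>D\<^esub> z \<oplus>\<^bsub>D\<^esub> \<ominus>\<^bsub>D\<^esub> z"
        using z m DZ.nat_pow_eone[OF z] DD[OF m] by simp
      also have "\<dots> = z \<oplus>\<^bsub>D\<^esub> \<ominus>\<^bsub>D\<^esub> z" using DD[OF z] by simp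
      also have "\<dots> = \<zero>\<^bsub>D\<^esub>" using z by (rule DZ.r_neg)
      finally show ?thesis .
    qed
  qed simp
qed

definition rational_corner where
  "rational_corner \<longleftrightarrow> (\<forall>c\<in>carrier (extended_centroid R).
     (ring.algebraic (extended_centroid R) over (ext_class ` scalar_set)) c)"

text \<open>The centre of \<open>D\<close> always embeds into the extended centroid, which gives the
  first part; for the converse it has to be everything, which is ensured by
  \<open>full\<close>.\<close>

lemma rational_corner_iff:
  "rational_corner \<Longrightarrow> z \<in> Z \<Longrightarrow> (ring.algebraic D over scalar_set) z"
  "\<lbrakk>full; \<And>z. z \<in> Z \<Longrightarrow> (ring.algebraic D over scalar_set) z\<rbrakk> \<Longrightarrow> rational_corner"
  unfolding rational_corner_def
  using algebraic_ext_class_iff[OF scalar_set_Z] ext_class_center full_ext_class_surj by metis+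

text \<open>The maximum of the thresholds of the terms serves all of them.\<close>

lemma compressed_span:
  assumes br: branching and "z \<in> span (monomials_at w)"
  shows "\<exists>n. \<forall>s r. awalk w s w \<longrightarrow> awalk w r w \<longrightarrow> n \<le> length s \<longrightarrow> aperiodic n r \<longrightarrow>
    ghost w (s @ r) \<otimes> z \<otimes> path w (s @ r) \<in> scalar_set"
  using assms(2)
proof (induction rule: lin_span.induct)
  case zero
  have "\<zero> \<in> scalar_set" using subringE(2)[OF subfieldE(1)[OF subfield_scalar_set]] by simp
  moreover have "ghost w (s @ r) \<otimes> \<zero> \<otimes> path w (s @ r) = \<zero>" if "awalk w s w" "awalk w r w" for s r
    using ghost_closed[OF awalk_appendI[OF that]] path_closed[OF awalk_appendI[OF that]] by simp
  ultimately show ?case by auto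
next
  case (add k m y)
  obtain n where n: "\<And>s r. \<lbrakk>awalk w s w; awalk w r w; n \<le> length s; aperiodic n r\<rbrakk> \<Longrightarrow>
      ghost w (s @ r) \<otimes> y \<otimes> path w (s @ r) \<in> scalar_set"
    using add by blast
  obtain l where l: "\<And>s r. \<lbrakk>awalk w s w; awalk w r w; l \<le> length s; aperiodic l r\<rbrakk> \<Longrightarrow>
      ghost w (s @ r) \<otimes> m \<otimes> path w (s @ r) \<in> {\<zero>, V w}"
    using compressed_monomial[OF br add(2)] by blast
  have "ghost w (s @ r) \<otimes> (\<iota> k \<otimes> m \<oplus> y) \<otimes> path w (s @ r) \<in> scalar_set"
    if s: "awalk w s w" "awalk w r w" "max n l \<le> length s" "aperiodic (max n l) r" for s r
  proof -
    note sr = awalk_appendI[OF s(1,2)]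
    have c: "m \<in> carrier R" "y \<in> carrier R" "ghost w (s @ r) \<in> carrier R" "path w (s @ r) \<in> carrier R"
      using add(2) monomials_at_closed span_closed[OF add(3) monomials_at_closed] sr by auto
    have "ghost w (s @ r) \<otimes> (\<iota> k \<otimes> m) = \<iota> k \<otimes> (ghost w (s @ r) \<otimes> m)"
      using c add(1) \<iota>_central[OF add(1) c(3)] by (simp flip: m_assoc)
    then have eq: "ghost w (s @ r) \<otimes> (\<iota> k \<otimes> m \<oplus> y) \<otimes> path w (s @ r) =
        \<iota> k \<otimes> (ghost w (s @ r) \<otimes> m \<otimes> path w (s @ r)) \<oplus> ghost w (s @ r) \<otimes> y \<otimes> path w (s @ r)"
      using c add(1) by (simp add: r_distr l_distr m_assoc)
    have "ghost w (s @ r) \<otimes> m \<otimes> path w (s @ r) \<in> {\<zero>, V w}"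
      using s(1-3) aperiodic_mono[OF s(4), of l] by (intro l) auto
    moreover have "\<iota> k \<otimes> \<zero> \<in> scalar_set"
      using add(1) subringE(2)[OF subfieldE(1)[OF subfield_scalar_set]] by simp
    moreover have "\<iota> k \<otimes> V w \<in> scalar_set" using add(1) by (simp add: scalar_set_def)
    ultimately have "\<iota> k \<otimes> (ghost w (s @ r) \<otimes> m \<otimes> path w (s @ r)) \<in> scalar_set" by auto
    moreover have "ghost w (s @ r) \<otimes> y \<otimes> path w (s @ r) \<in> scalar_set"
      using s(1-3) aperiodic_mono[OF s(4), of n] by (intro n) auto
    ultimately show ?thesis
      unfolding eq using subringE(7)[OF subfieldE(1)[OF subfield_scalar_set]] by simp
  qed
  then show ?case by blast
qed

text \<open>A central \<open>z\<close> commutes with the path of \<open>s @ r\<close>, so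
  compression by this walk leaves \<open>z\<close> as it is, while turning it into a scalar.\<close>

lemma branching_center:
  assumes br: branching and z: "z \<in> Z"
  shows "z \<in> scalar_set"
proof -
  note zD = Z_D(1)[OF z]
  obtain n where n: "\<And>s r. \<lbrakk>awalk w s w; awalk w r w; n \<le> length s; aperiodic n r\<rbrakk> \<Longrightarrow>
      ghost w (s @ r) \<otimes> z \<otimes> path w (s @ r) \<in> scalar_set"
    using compressed_span[OF br D_span[OF zD]] by blast
  obtain x where x: "awalk w x w" "x \<noteq> []" by (rule nonempty_closed_walk[OF br])
  obtain r where r: "awalk w r w" "aperiodic n r" by (rule aperiodic_closed_walk[OF br])
  \<comment> \<open>As \<open>x\<close> is nonempty, \<open>n\<close> repetitions reach the length
    \<open>n\<close> that the compression asks for.\<close>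
  define s where "s = concat (replicate n x)"
  have "n * 1 \<le> n * length x" using x(2) by (intro mult_left_mono) (auto simp: Suc_le_eq)
  then have s: "awalk w s w" "n \<le> length s"
    unfolding s_def using awalk_power[OF x(1)] by (simp_all add: length_concat_replicate)
  note sr = awalk_appendI[OF s(1) r(1)]
  have "ghost w (s @ r) \<otimes> z \<otimes> path w (s @ r) = ghost w (s @ r) \<otimes> (z \<otimes> path w (s @ r))"
    using sr Z_D(2)[OF z] by (simp add: m_assoc)
  also have "z \<otimes> path w (s @ r) = path w (s @ r) \<otimes> z"
    using z path_D[OF sr] unfolding Z_iff by blast
  also have "ghost w (s @ r) \<otimes> (path w (s @ r) \<otimes> z) = z"
    using ghost_path[OF sr] ghost_closed[OF sr] path_closed[OF sr] DD[OF zD] by (simp flip: m_assoc)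
  finally show ?thesis using n[OF s(1) r(1) s(2) r(2)] by simp
qed

subsection \<open>At most one closed walk of each length\<close>

context
  assumes nb: "\<not> branching"
begin

lemma closed_walk_unique: "\<lbrakk>awalk w x w; awalk w y w; length x = length y\<rbrakk> \<Longrightarrow> x = y"
  using nb unfolding branching_def by blast

lemma closed_walks_commute: "\<lbrakk>awalk w x w; awalk w y w\<rbrakk> \<Longrightarrow> x @ y = y @ x"
  by (intro closed_walk_unique awalk_appendI) auto

lemma V_nonzero_predecessor:
  assumes "awalk v r u" "V u \<noteq> \<zero>"
  shows "V v \<noteq> \<zero>"
proof
  assume "V v = \<zero>"
  then have "path v r = \<zero>" using V_path[OF assms(1)] path_closed[OF assms(1)] by simp
  then show False using ghost_path[OF assms(1)] ghost_closed[OF assms(1)] assms(2) by simp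
qed

text \<open>Both edges can be completed to closed walks starting with \<open>p\<close>, since their
  ends reach \<open>w\<close>. The two products of these closed walks coincide, and they have
  \<open>a\<close> and \<open>b\<close> in the same position.\<close>

lemma unique_exit:
  assumes p: "awalk w p v" and a: "a \<in> arcs G" "tail G a = v" "V (head G a) \<noteq> \<zero>"
    and b: "b \<in> arcs G" "tail G b = v" "V (head G b) \<noteq> \<zero>"
  shows "a = b"
proof -
  obtain r where r: "awalk (head G a) r w" using reach[OF _ a(3)] a(1) by auto
  obtain s where s: "awalk (head G b) s w" using reach[OF _ b(3)] b(1) by auto
  have "awalk w (p @ a # r) w" "awalk w (p @ b # s) w"
    using p r s a b by (auto intro!: awalk_appendI simp: G.awalk_simps)
  from closed_walks_commute[OF this] show ?thesis by simp
qed

text \<open>By \<open>unique_exit\<close> all other edges leaving a vertex of the walk end at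
  vanished vertices and are zero, so the relation \<open>CK\<close> reduces to
  \<open>V v = E a \<otimes> H a\<close>. Together with \<open>ghost_path\<close> this makes paths
  invertible.\<close>

lemma path_ghost:
  assumes "awalk w p v" "awalk v r u" "V u \<noteq> \<zero>"
  shows "path v r \<otimes> ghost v r = V v"
  using assms(1,2)
proof (induction r arbitrary: p v)
  case Nil
  then show ?case by (auto simp: G.awalk_simps VV)
next
  case (Cons a r)
  then have a: "a \<in> arcs G" "tail G a = v" "awalk (head G a) r u" by (auto simp: G.awalk_simps)
  have v: "v \<in> verts G" using a by auto
  have Va: "V (head G a) \<noteq> \<zero>" by (rule V_nonzero_predecessor[OF a(3) assms(3)])
  have aout: "a \<in> out_arcs G v" using a by (simp add: out_arcs_def)
  have fin: "finite (out_arcs G v)" by (rule finite_subset[OF _ G.finite_arcs]) (auto simp: out_arcs_def)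
  have "V v = (\<Oplus>e\<in>out_arcs G v. E e \<otimes> H e)" using aout v by (intro CK) auto
  also have "\<dots> = (\<Oplus>e\<in>out_arcs G v. if a = e then E a \<otimes> H a else \<zero>)"
  proof (intro finsum_cong')
    fix e assume e: "e \<in> out_arcs G v"
    show "E e \<otimes> H e = (if a = e then E a \<otimes> H a else \<zero>)"
    proof (cases "a = e")
      case False
      then have "V (head G e) = \<zero>"
        using unique_exit[OF Cons.prems(1) a(1,2) Va, of e] e by (auto simp: out_arcs_def)
      then have "E e = \<zero>" using EV[of e] e by (simp add: out_arcs_def)
      then show ?thesis using False e by (simp add: out_arcs_def)
    qed simp
  qed (use a in auto)
  also have "\<dots> = E a \<otimes> H a" using aout fin a by (intro finsum_singleton) auto
  finally have Vv: "V v = E a \<otimes> H a" .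
  have "awalk w (p @ [a]) (head G a)"
    using Cons.prems(1) a by (intro awalk_appendI) (auto simp: G.awalk_simps)
  from Cons.IH[OF this a(3)] have "E a \<otimes> (path (head G a) r \<otimes> ghost (head G a) r) \<otimes> H a = E a \<otimes> V (head G a) \<otimes> H a"
    by simp
  then show ?case using a Vv path_closed[OF a(3)] ghost_closed[OF a(3)] by (simp add: m_assoc VH)
qed

definition closed_monomials where
  "closed_monomials = {path w p \<otimes> ghost w q | p q. awalk w p w \<and> awalk w q w}"

lemma closed_monomials_closed: "closed_monomials \<subseteq> carrier R"
  by (auto simp: closed_monomials_def)

text \<open>If the common end \<open>v\<close> of both parts survives, a walk \<open>r\<close> from
  \<open>v\<close> back to \<open>w\<close> allows \<open>V v\<close> to be replaced by
  \<open>path v r \<otimes> ghost v r\<close>, which closes both parts; otherwise the monomial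
  vanishes.\<close>

lemma D_span_closed:
  assumes "x \<in> carrier D"
  shows "x \<in> span closed_monomials"
proof -
  have "V w \<otimes> x \<otimes> V w \<in> span closed_monomials"
  proof (rule span_sandwich[OF D_span[OF assms] monomials_at_closed closed_monomials_closed w_closed w_closed])
    fix m assume "m \<in> monomials_at w"
    then obtain p q v where m: "m = path w p \<otimes> ghost w q" and wk: "awalk w p v" "awalk w q v"
      unfolding monomials_at_def by blast
    note cl = path_closed[OF wk(1)] ghost_closed[OF wk(2)]
    have v: "v \<in> verts G" using awalk_verts wk by blast
    have "V w \<otimes> m \<otimes> V w = (V w \<otimes> path w p) \<otimes> (ghost w q \<otimes> V w)" using cl by (simp add: m m_assoc)
    also have "\<dots> = m" using V_path[OF wk(1)] ghost_V[OF wk(2)] by (simp add: m)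
    finally have e: "V w \<otimes> m \<otimes> V w = m" .
    show "V w \<otimes> m \<otimes> V w \<in> span closed_monomials"
    proof (cases "V v = \<zero>")
      case True
      then have "path w p = \<zero>" using path_V[OF wk(1)] cl by simp
      then show ?thesis unfolding e using cl by (simp add: m lin_span.zero)
    next
      case False
      obtain r where r: "awalk v r w" using reach[OF v False] by blast
      have "m = path w p \<otimes> V v \<otimes> ghost w q" using path_V[OF wk(1)] by (simp add: m)
      also have "\<dots> = path w p \<otimes> (path v r \<otimes> ghost v r) \<otimes> ghost w q"
        using path_ghost[OF wk(1) r w_nonzero] by simp
      also have "\<dots> = path w (p @ r) \<otimes> ghost w (q @ r)"
        using path_append[OF wk(1) r] ghost_append[OF wk(2) r] cl path_closed[OF r] ghost_closed[OF r]
        by (simp add: m_assoc)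
      finally have "m \<in> closed_monomials"
        unfolding closed_monomials_def using awalk_appendI[OF wk(1) r] awalk_appendI[OF wk(2) r] by blast
      then show ?thesis unfolding e by (rule span_base[OF _ closed_monomials_closed])
    qed
  qed
  then show ?thesis using DD[OF assms] by simp
qed

lemma path_path_commute:
  assumes "awalk w p w" "awalk w q w"
  shows "path w p \<otimes> path w q = path w q \<otimes> path w p"
  using path_append[OF assms] path_append[OF assms(2,1)] closed_walks_commute[OF assms] by simp

lemma ghost_ghost_commute:
  assumes "awalk w p w" "awalk w q w"
  shows "ghost w p \<otimes> ghost w q = ghost w q \<otimes> ghost w p"
  using ghost_append[OF assms] ghost_append[OF assms(2,1)] closed_walks_commute[OF assms] by simp

lemma path_ghost_self: "awalk w p w \<Longrightarrow> path w p \<otimes> ghost w p = V w"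
  using path_ghost[of "[]" w p w] w_vert w_nonzero by (simp add: G.awalk_simps)

text \<open>Conjugation by the invertible path of \<open>q\<close> fixes the path of
  \<open>p\<close>, because the two paths commute; its inverse is the ghost of
  \<open>q\<close>.\<close>

lemma path_ghost_commute:
  assumes p: "awalk w p w" and q: "awalk w q w"
  shows "path w p \<otimes> ghost w q = ghost w q \<otimes> path w p"
proof -
  note cl = path_closed[OF p] path_closed[OF q] ghost_closed[OF q]
  have "ghost w q \<otimes> path w p = ghost w q \<otimes> (path w p \<otimes> V w)" using path_V[OF p] by simp
  also have "\<dots> = ghost w q \<otimes> (path w p \<otimes> path w q) \<otimes> ghost w q"
    using path_ghost_self[OF q] cl by (simp add: m_assoc)
  also have "\<dots> = (ghost w q \<otimes> path w q) \<otimes> (path w p \<otimes> ghost w q)"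
    unfolding path_path_commute[OF p q] using cl by (simp add: m_assoc)
  also have "\<dots> = path w p \<otimes> ghost w q"
    unfolding ghost_path[OF q] using V_path[OF p] cl by (simp flip: m_assoc)
  finally show ?thesis by simp
qed

text \<open>An element commuting with all closed paths and ghosts commutes with \<open>D\<close>.
  This is applied first to the closed paths and ghosts themselves, and then to an arbitrary element
  of \<open>D\<close>.\<close>

lemma D_commute:
  assumes x: "x \<in> carrier D" and y: "y \<in> carrier D"
  shows "x \<otimes> y = y \<otimes> x"
proof -
  have gen: "y \<otimes> b = b \<otimes> y"
    if b: "b \<in> carrier R" "\<And>p. awalk w p w \<Longrightarrow> path w p \<otimes> b = b \<otimes> path w p"
      "\<And>p. awalk w p w \<Longrightarrow> ghost w p \<otimes> b = b \<otimes> ghost w p" and y: "y \<in> carrier D" for b y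
  proof (rule span_commute[OF D_span_closed[OF y] closed_monomials_closed b(1)])
    fix m assume "m \<in> closed_monomials"
    then obtain p q where m: "m = path w p \<otimes> ghost w q" and pq: "awalk w p w" "awalk w q w"
      unfolding closed_monomials_def by blast
    note cl = path_closed[OF pq(1)] ghost_closed[OF pq(2)]
    have "m \<otimes> b = path w p \<otimes> (b \<otimes> ghost w q)" using cl b(1) b(3)[OF pq(2)] by (simp add: m m_assoc)
    also have "\<dots> = path w p \<otimes> b \<otimes> ghost w q" using cl b(1) by (simp add: m_assoc)
    also have "\<dots> = b \<otimes> m" unfolding b(2)[OF pq(1)] using cl b(1) by (simp add: m m_assoc)
    finally show "m \<otimes> b = b \<otimes> m" .
  qed
  show ?thesis
  proof (rule gen[OF DD(1)[OF y] _ _ x])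
    fix p assume p: "awalk w p w"
    show "path w p \<otimes> y = y \<otimes> path w p"
      by (rule gen[OF path_closed[OF p] _ _ y, symmetric])
        (use p path_path_commute path_ghost_commute in auto)
    show "ghost w p \<otimes> y = y \<otimes> ghost w p"
      by (rule gen[OF ghost_closed[OF p] _ _ y, symmetric])
        (use p ghost_ghost_commute path_ghost_commute in auto)
  qed
qed

text \<open>A shortest nonempty closed walk \<open>c\<close> satisfies \<open>c @ p = p @ c\<close>,
  so it is a prefix of every nonempty closed walk \<open>p\<close>, and the rest of \<open>p\<close>
  is again closed. If there is only the empty closed walk, it is its own generator.\<close>

lemma closed_walk_generator:
  obtains c where "awalk w c w" "\<And>p. awalk w p w \<Longrightarrow> \<exists>n. p = concat (replicate n c)"
proof (cases "\<exists>p. awalk w p w \<and> p \<noteq> []")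
  case False
  have "awalk w [] w" using w_vert by (simp add: G.awalk_simps)
  moreover have "\<exists>n. p = concat (replicate n [])" if "awalk w p w" for p
    using False that by (intro exI[of _ 0]) auto
  ultimately show ?thesis using that by blast
next
  case True
  then obtain c where c: "awalk w c w" "c \<noteq> []"
    and min: "\<And>p. \<lbrakk>awalk w p w; p \<noteq> []\<rbrakk> \<Longrightarrow> length c \<le> length p"
    using ex_has_least_nat[of "\<lambda>p. awalk w p w \<and> p \<noteq> []" _ length] by blast
  have "\<exists>n. p = concat (replicate n c)" if "awalk w p w" for p
    using that
  proof (induction p rule: length_induct)
    case (1 p)
    show ?case
    proof (cases "p = []")
      case True
      then show ?thesis by (intro exI[of _ 0]) simp
    next
      case False
      have "length c \<le> length p" using min 1(2) False by blast
      moreover have "c @ p = p @ c" by (rule closed_walks_commute[OF c(1) 1(2)])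
      ultimately obtain q where q: "p = c @ q" by (auto simp: append_eq_append_conv2)
      obtain v where "awalk w c v" "awalk v q w" using 1(2) unfolding q awalk_append by blast
      then have "awalk w q w" using awalk_end_unique[OF c(1)] by blast
      moreover have "length q < length p" using c(2) q by simp
      ultimately obtain n where "q = concat (replicate n c)" using 1(1) by blast
      then show ?thesis using q by (intro exI[of _ "Suc n"]) simp
    qed
  qed
  then show ?thesis using that c(1) by blast
qed

text \<open>In a commutative corner
  \<open>a \<otimes> x \<otimes> b = x \<otimes> (a \<otimes> b)\<close>, so primeness becomes
  absence of zero divisors.\<close>

lemma domain_D: "domain D"
proof (rule domain.intro)
  show "cring D"
    by (rule cring.intro[OF ring_D]) (intro comm_monoid.intro comm_monoid_axioms.intro ring.is_monoid[OF ring_D],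
        simp add: D_commute)
  show "domain_axioms D"
  proof
    show "\<one>\<^bsub>D\<^esub> \<noteq> \<zero>\<^bsub>D\<^esub>" using w_nonzero by simp
    fix a b assume ab: "a \<otimes>\<^bsub>D\<^esub> b = \<zero>\<^bsub>D\<^esub>" "a \<in> carrier D" "b \<in> carrier D"
    have "a \<otimes> x \<otimes> b = \<zero>" if "x \<in> carrier D" for x
    proof -
      have "a \<otimes> x \<otimes> b = x \<otimes> (a \<otimes> b)" using D_commute[OF ab(2) that] ab(2,3) that by (simp add: DD m_assoc)
      then show ?thesis using ab that by (simp add: DD)
    qed
    then show "a = \<zero>\<^bsub>D\<^esub> \<or> b = \<zero>\<^bsub>D\<^esub>" using corner_prime ab by simp
  qed
qed

text \<open>The generator is the path of the walk of which all closed walks are powers, and its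
  inverse is the ghost of this walk. If only the empty walk is closed, then \<open>c\<close> is the
  unit of \<open>D\<close>.\<close>

lemma laurent_D:
  obtains c c' where "laurent_domain D scalar_set c c'"
proof -
  interpret D: domain D by (rule domain_D)
  obtain p where p: "awalk w p w" and gen: "\<And>q. awalk w q w \<Longrightarrow> \<exists>n. q = concat (replicate n p)"
    using closed_walk_generator by blast
  define c where "c = path w p"
  have c: "c \<in> carrier D" unfolding c_def by (rule path_D[OF p])
  have pow: "path w (concat (replicate n p)) = c [^]\<^bsub>D\<^esub> n" for n
  proof (induction n)
    case (Suc n)
    have "path w (concat (replicate (Suc n) p)) = c \<otimes> c [^]\<^bsub>D\<^esub> n"
      using path_append[OF p awalk_power[OF p]] Suc by (simp add: c_def)
    then show ?case using D.m_comm[OF c D.nat_pow_closed[OF c]] by simp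
  qed simp
  note sub = subfieldE(1)[OF subfield_scalar_set]
  let ?S = "ring.simple_extension D scalar_set c"
  have S: "subring ?S D" by (rule D.simple_extension_is_subring[OF sub c])
  have Sc: "c [^]\<^bsub>D\<^esub> (n :: nat) \<in> ?S" for n
    using subringE(3,6)[OF S] D.simple_extension_mem[OF sub c] by (induction n) auto
  have SK: "scalar_set \<subseteq> ?S" by (rule D.simple_extension_incl[OF subfieldE(3)[OF subfield_scalar_set] c])
  have span: "\<exists>n::nat. d \<otimes> c [^]\<^bsub>D\<^esub> n \<in> ?S" if "d \<in> span closed_monomials" for d
    using that
  proof (induction rule: lin_span.induct)
    case zero
    then show ?case using subringE(2)[OF S] DD(1)[OF c] by (intro exI[of _ 0]) simp
  next
    case (add k m y)
    obtain q s where m: "m = path w q \<otimes> ghost w s" and qs: "awalk w q w" "awalk w s w"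
      using add(2) unfolding closed_monomials_def by blast
    obtain i j where ij: "q = concat (replicate i p)" "s = concat (replicate j p)" using gen qs by blast
    obtain n where n: "y \<otimes> c [^]\<^bsub>D\<^esub> (n :: nat) \<in> ?S" using add(4) by blast
    have cR: "c [^]\<^bsub>D\<^esub> (l :: nat) \<in> carrier D" "c [^]\<^bsub>D\<^esub> (l :: nat) \<in> carrier R" for l
      using D.nat_pow_closed[OF c] DD(1) by auto
    have yR: "y \<in> carrier R" by (rule span_closed[OF add(3) closed_monomials_closed])
    \<comment> \<open>The ghost part of \<open>m\<close> is the inverse of the power
      \<open>j\<close> of \<open>c\<close>, so this power clears the denominator of
      \<open>m\<close>.\<close>
    have mc: "m \<otimes> c [^]\<^bsub>D\<^esub> j = c [^]\<^bsub>D\<^esub> i"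
      unfolding m using ghost_path[OF qs(2)] path_V[OF qs(1)] path_closed[OF qs(1)] ghost_closed[OF qs(2)]
        path_closed[OF qs(2)] pow[of i, folded ij] pow[of j, folded ij]
      by (simp add: m_assoc)
    have mR: "m \<in> carrier R" unfolding m using qs by simp
    have kS: "\<iota> k \<otimes> V w \<in> ?S" using SK add(1) unfolding scalar_set_def by blast
    have "\<iota> k \<otimes> m \<otimes> c [^]\<^bsub>D\<^esub> (j + n) = \<iota> k \<otimes> (m \<otimes> c [^]\<^bsub>D\<^esub> j) \<otimes> c [^]\<^bsub>D\<^esub> n"
      using add(1) mR cR D.nat_pow_mult[OF c, of j n] by (simp add: m_assoc)
    also have "\<dots> = (\<iota> k \<otimes> V w) \<otimes> c [^]\<^bsub>D\<^esub> i \<otimes> c [^]\<^bsub>D\<^esub> n"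
      unfolding mc using add(1) cR DD(2)[OF cR(1)] by (simp add: m_assoc)
    also have "\<dots> \<in> ?S" using subringE(6)[OF S] kS Sc by simp
    finally have 1: "\<iota> k \<otimes> m \<otimes> c [^]\<^bsub>D\<^esub> (j + n) \<in> ?S" .
    have "y \<otimes> c [^]\<^bsub>D\<^esub> (j + n) = y \<otimes> c [^]\<^bsub>D\<^esub> n \<otimes> c [^]\<^bsub>D\<^esub> j"
      using yR cR D.nat_pow_mult[OF c, of n j] by (simp add: m_assoc add.commute)
    also have "\<dots> \<in> ?S" using subringE(6)[OF S n Sc] by simp
    finally have 2: "y \<otimes> c [^]\<^bsub>D\<^esub> (j + n) \<in> ?S" .
    have "(\<iota> k \<otimes> m \<oplus> y) \<otimes> c [^]\<^bsub>D\<^esub> (j + n) \<in> ?S"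
      using subringE(7)[OF S 1 2] add(1) mR yR cR by (simp add: l_distr)
    then show ?case by blast
  qed
  have "laurent_domain D scalar_set c (ghost w p)"
  proof (intro laurent_domain.intro laurent_domain_axioms.intro)
    show "c \<otimes>\<^bsub>D\<^esub> ghost w p = \<one>\<^bsub>D\<^esub>" using path_ghost_self[OF p] by (simp add: c_def)
    show "\<exists>n::nat. d \<otimes>\<^bsub>D\<^esub> c [^]\<^bsub>D\<^esub> n \<in> ?S" if "d \<in> carrier D" for d
      using span[OF D_span_closed[OF that]] by simp
  qed (fact domain_D subfield_scalar_set c ghost_D[OF p])+
  then show ?thesis using that by blast
qed

lemma Z_eq_D: "Z = carrier D"
  using D_commute unfolding Z_iff by (auto simp: Z_iff)

text \<open>This hypothesis is the one that local closedness delivers. It makes \<open>c\<close>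
  algebraic, whence \<open>D\<close> is an algebraic field extension of the scalars and both
  conclusions follow.\<close>

lemma units_imp_rational_full:
  assumes d: "d \<in> carrier D" "d \<noteq> \<zero>"
    and unit: "\<And>u. u \<in> carrier D \<Longrightarrow> V w \<ominus> d \<otimes> u = \<zero> \<or> (\<exists>v\<in>carrier D. (V w \<ominus> d \<otimes> u) \<otimes> v = V w)"
  shows "full \<and> rational_corner"
proof -
  obtain c c' where L: "laurent_domain D scalar_set c c'" by (rule laurent_D)
  interpret L: laurent_domain D scalar_set c c' by (rule L)
  \<comment> \<open>Subtraction in \<open>D\<close> is formed from additive inverses within
    \<open>D\<close>, which have to be identified with those of the whole ring.\<close>
  have minus: "x \<ominus>\<^bsub>D\<^esub> y = x \<ominus> y" if "x \<in> carrier D" "y \<in> carrier D" for x y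
  proof -
    have "\<ominus> y \<in> carrier D" "\<ominus> y \<oplus> y = \<zero>" using DD[OF that(2)] by (simp_all add: D_iff l_minus r_minus l_neg)
    then have "\<ominus>\<^bsub>D\<^esub> y = \<ominus> y" using that by (intro L.minus_equality) auto
    then show ?thesis by (simp add: a_minus_def)
  qed
  have alg: "(ring.algebraic D over scalar_set) c"
  proof (rule L.algebraic_of_units[OF d(1)])
    show "d \<noteq> \<zero>\<^bsub>D\<^esub>" using d(2) by simp
    fix u assume u: "u \<in> carrier D"
    then have "\<one>\<^bsub>D\<^esub> \<ominus>\<^bsub>D\<^esub> d \<otimes>\<^bsub>D\<^esub> u = V w \<ominus> d \<otimes> u"
      using minus[OF w_D, of "d \<otimes> u"] L.m_closed[OF d(1) u] by simp
    then show "\<one>\<^bsub>D\<^esub> \<ominus>\<^bsub>D\<^esub> d \<otimes>\<^bsub>D\<^esub> u = \<zero>\<^bsub>D\<^esub> \<or> (\<exists>v\<in>carrier D. (\<one>\<^bsub>D\<^esub> \<ominus>\<^bsub>D\<^esub> d \<otimes>\<^bsub>D\<^esub> u) \<otimes>\<^bsub>D\<^esub> v = \<one>\<^bsub>D\<^esub>)"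
      using unit[OF u] by simp
  qed
  have f: full
  proof (rule corner_field_imp_full)
    fix a assume "a \<in> carrier D" "a \<noteq> \<zero>"
    then show "\<exists>u\<in>carrier D. a \<otimes> u = V w" using L.algebraic_imp_unit[OF alg, of a] by simp
  qed
  moreover have rational_corner
    by (rule rational_corner_iff(2)[OF f]) (use L.algebraic_imp_algebraic[OF alg] Z_eq_D in auto)
  ultimately show ?thesis ..
qed

text \<open>In the commutative corner the generator \<open>c\<close> is central, so rationality
  makes it algebraic and \<open>D\<close> a field.\<close>

lemma rational_imp_full:
  assumes rational_corner
  shows full
proof -
  obtain c c' where L: "laurent_domain D scalar_set c c'" by (rule laurent_D)
  interpret L: laurent_domain D scalar_set c c' by (rule L)
  have alg: "(ring.algebraic D over scalar_set) c"
    using rational_corner_iff(1)[OF assms] L.c(1) unfolding Z_eq_D by blast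
  show full
  proof (rule corner_field_imp_full)
    fix a assume "a \<in> carrier D" "a \<noteq> \<zero>"
    then show "\<exists>u\<in>carrier D. a \<otimes> u = V w" using L.algebraic_imp_unit[OF alg, of a] by simp
  qed
qed

text \<open>A nonzero non-unit would lie in a prime ideal that misses \<open>V w\<close>, and this
  nonzero ideal contradicts \<open>full\<close>.\<close>

lemma full_imp_unit:
  assumes full "d \<in> carrier D" "d \<noteq> \<zero>"
  shows "\<exists>u\<in>carrier D. d \<otimes> u = V w"
proof (rule ccontr)
  assume "\<not> ?thesis"
  then obtain Q where Q: "Q \<in> Spec R" "d \<in> Q" "V w \<notin> Q"
    using exists_prime_avoiding[OF D_commute assms(2)] by blast
  have "ideal Q R" using Q(1) by (simp add: Spec_def prime_ideal_def)
  moreover have "Q \<noteq> {\<zero>}" using Q(2) assms(3) by blast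
  ultimately show False using assms(1) Q(3) unfolding full_def by blast
qed

text \<open>\<open>D\<close> is a field, so each \<open>V w \<ominus> u\<close> is zero or a unit,
  and the criterion applies with \<open>d = V w\<close>. In effect, a field generated by
  \<open>c\<close> and its inverse is algebraic over the scalars.\<close>

lemma full_imp_rational:
  assumes full
  shows rational_corner
proof -
  have "V w \<ominus> V w \<otimes> u = \<zero> \<or> (\<exists>v\<in>carrier D. (V w \<ominus> V w \<otimes> u) \<otimes> v = V w)" if u: "u \<in> carrier D" for u
  proof -
    have "V w \<ominus> u \<in> carrier D"
      using DD[OF u] by (simp add: D_iff minus_eq r_distr l_distr r_minus l_minus)
    then show ?thesis using full_imp_unit[OF assms, of "V w \<ominus> u"] DD[OF u] by auto
  qed
  then show ?thesis using units_imp_rational_full[OF w_D w_nonzero] by blast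
qed

end

section \<open>The three properties in terms of the bottom vertex\<close>

lemma full_iff:
  "rational_corner \<longleftrightarrow> full"
  "primitive_ideal R {\<zero>} \<longleftrightarrow> full"
  "zero_locally_closed \<longleftrightarrow> full"
proof -
  have "rational_corner" if branching
    using rational_corner_iff(2)[OF branching_full[OF that]] branching_center[OF that] scalar_set_algebraic
    by blast
  then show "rational_corner \<longleftrightarrow> full"
    using branching_full rational_imp_full full_imp_rational by blast
  have "full" if "\<not> branching" "primitive_ideal R {\<zero>}"
    by (rule corner_field_imp_full[OF primitive_imp_corner_field[OF that(2) D_commute[OF that(1)]]])
  then show "primitive_ideal R {\<zero>} \<longleftrightarrow> full"
    using branching_full full_imp_primitive by blast
  have "full" if nb: "\<not> branching" and lc: "zero_locally_closed"
  proof -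
    obtain d where "d \<in> carrier D" "d \<noteq> \<zero>"
      "\<And>u. u \<in> carrier D \<Longrightarrow> V w \<ominus> d \<otimes> u = \<zero> \<or> (\<exists>v\<in>carrier D. (V w \<ominus> d \<otimes> u) \<otimes> v = V w)"
      using locally_closed_imp_corner_units[OF lc D_commute[OF nb]] by blast
    then show full using units_imp_rational_full[OF nb] by blast
  qed
  then show "zero_locally_closed \<longleftrightarrow> full"
    using branching_full full_imp_locally_closed by blast
qed

end

section \<open>The Leavitt path algebra\<close>

lemma (in cring) free_algebra_scalar:
  assumes f: "f \<in> carrier (free_algebra R S)" and c: "c \<in> carrier R"
  shows "(\<lambda>w. if w = [] then c else \<zero>) \<otimes>\<^bsub>free_algebra R S\<^esub> f = c \<odot>\<^bsub>free_algebra R S\<^esub> f"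
    and "f \<otimes>\<^bsub>free_algebra R S\<^esub> (\<lambda>w. if w = [] then c else \<zero>) = c \<odot>\<^bsub>free_algebra R S\<^esub> f"
proof -
  have fw: "f w \<in> carrier R" for w using f by (simp add: free_algebra_def)
  show "(\<lambda>w. if w = [] then c else \<zero>) \<otimes>\<^bsub>free_algebra R S\<^esub> f = c \<odot>\<^bsub>free_algebra R S\<^esub> f"
    using convolution_append[of f c "[]", OF fw c] by (simp add: free_algebra_simps fun_eq_iff)
  have "convolution R f (\<lambda>w. if w = [] then c else \<zero>) w = c \<otimes> f w" for w
  proof -
    have "convolution R f (\<lambda>w. if w = [] then c else \<zero>) w =
        (\<Oplus>i\<in>{..length w}. if length w = i then c \<otimes> f w else \<zero>)"
      unfolding convolution_def using fw c by (intro finsum_cong') (auto simp: m_comm)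
    also have "\<dots> = c \<otimes> f w" using fw c by (subst finsum_singleton) auto
    finally show ?thesis .
  qed
  then show "f \<otimes>\<^bsub>free_algebra R S\<^esub> (\<lambda>w. if w = [] then c else \<zero>) = c \<odot>\<^bsub>free_algebra R S\<^esub> f"
    by (simp add: free_algebra_simps fun_eq_iff)
qed

definition lpa_class where
  "lpa_class K G f = lpa_ideal K G +>\<^bsub>lpa_free K G\<^esub> f"

text \<open>The second claim allows the scalar multiplication, which \<open>scalars\<close> refers
  to, to be replaced by multiplication with central ring elements.\<close>

lemma leavitt_family_leavitt:
  fixes K :: "('k, 'm) ring_scheme" and G :: "('v, 'e) pre_digraph"
  assumes "field K" and "fin_digraph G"
  shows "leavitt_family (leavitt K G) G K (\<lambda>k. k \<odot>\<^bsub>leavitt K G\<^esub> \<one>\<^bsub>leavitt K G\<^esub>)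
      (\<lambda>x. lpa_class K G (word K [Vert x])) (\<lambda>a. lpa_class K G (word K [Edge a]))
      (\<lambda>a. lpa_class K G (word K [Ghost a]))"
    and "\<lbrakk>k \<in> carrier K; x \<in> carrier (leavitt K G)\<rbrakk> \<Longrightarrow>
      k \<odot>\<^bsub>leavitt K G\<^esub> x = (k \<odot>\<^bsub>leavitt K G\<^esub> \<one>\<^bsub>leavitt K G\<^esub>) \<otimes>\<^bsub>leavitt K G\<^esub> x"
proof -
  interpret K: field K by fact
  interpret G: fin_digraph G by fact
  define F where "F = lpa_free K G"
  define J where "J = lpa_ideal K G"
  define L where "L = leavitt K G"
  interpret L: ring L unfolding L_def by (rule K.ring_leavitt[OF assms(2)])
  interpret F: ring F unfolding F_def by (rule K.ring_free_algebra)
  let ?v = "\<lambda>x. word K [Vert x]" and ?e = "\<lambda>x. word K [Edge x]" and ?g = "\<lambda>x. word K [Ghost x]"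
  have gens [simp]: "x \<in> verts G \<Longrightarrow> ?v x \<in> carrier F"
    "a \<in> arcs G \<Longrightarrow> ?e a \<in> carrier F" "a \<in> arcs G \<Longrightarrow> ?g a \<in> carrier F" for x a
    unfolding F_def by (auto intro!: K.word_closed simp: lpa_generators_def)
  have sumF: "(\<Oplus>\<^bsub>F\<^esub>a\<in>out_arcs G x. ?e a \<otimes>\<^bsub>F\<^esub> ?g a) \<in> carrier F" for x
    by (rule F.finsum_closed) auto
  have rel: "lpa_relators K G \<subseteq> carrier F"
    unfolding lpa_relators_def Let_def F_def[symmetric] using sumF by (auto intro!: F.minus_closed)
  interpret J: ideal J F
    using F.genideal_ideal[OF rel] unfolding J_def F_def .
  interpret Q: ring "F Quot J" by (rule J.quotient_is_ring)
  define p where "p f = J +>\<^bsub>F\<^esub> f" for f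
  have p: "lpa_class K G = p" unfolding lpa_class_def p_def J_def F_def by (rule ext) simp
  interpret p: ring_hom_ring F "F Quot J" p
    unfolding p_def by (rule J.rcos_ring_hom_ring)
  have p_eq: "p f = p g \<longleftrightarrow> f \<ominus>\<^bsub>F\<^esub> g \<in> J" if "f \<in> carrier F" "g \<in> carrier F" for f g
    using F.quotient_eq_iff_same_a_r_cos[OF J.ideal_axioms that] unfolding p_def by simp
  have eq: "p f = p g" if "f \<in> carrier F" "g \<in> carrier F" "f \<ominus>\<^bsub>F\<^esub> g \<in> lpa_relators K G" for f g
    using p_eq[OF that(1,2)] F.genideal_self[OF rel] that(3) unfolding J_def F_def by blast
  define N where "N = {f \<in> carrier F. f [] = \<zero>\<^bsub>K\<^esub>}"
  define U where "U = (\<Oplus>\<^bsub>F\<^esub>x\<in>verts G. ?v x)"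
  have L: "carrier L = p ` N" "one L = p U"
    "zero L = \<zero>\<^bsub>F Quot J\<^esub>" "add L = add (F Quot J)" "mult L = mult (F Quot J)"
    "smult L = (\<lambda>k C. \<Union>x\<in>C. p (k \<odot>\<^bsub>F\<^esub> x))"
    by (auto simp: L_def leavitt_def quotient_algebra_def p_def U_def N_def J_def F_def)
  have NF: "f \<in> carrier F" if "f \<in> N" for f using that by (simp add: N_def)
  have pL: "p f \<in> carrier L" if "f \<in> N" for f using that by (simp add: L)
  have LE: thesis if "x \<in> carrier L" "\<And>f. \<lbrakk>f \<in> N; x = p f\<rbrakk> \<Longrightarrow> thesis" for x thesis
    using that unfolding L by blast
  have LQ: "x \<in> carrier (F Quot J)" if "x \<in> carrier L" for x
    using that NF by (auto simp: L)
  have wordN: "word K u \<in> N" if "u \<in> lists (lpa_generators G)" "u \<noteq> []" for u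
    using K.word_closed[OF that(1)] that(2) by (simp add: N_def F_def word_def)
  have gN: "x \<in> verts G \<Longrightarrow> ?v x \<in> N" "a \<in> arcs G \<Longrightarrow> ?e a \<in> N" "a \<in> arcs G \<Longrightarrow> ?g a \<in> N" for x a
    by (auto intro!: wordN simp: lpa_generators_def)
  have Nadd: "f \<oplus>\<^bsub>F\<^esub> g \<in> N" if "f \<in> N" "g \<in> N" for f g
    using that F.a_closed[of f g] by (auto simp: N_def) (simp add: F_def K.free_algebra_simps)
  have Nmult: "f \<otimes>\<^bsub>F\<^esub> g \<in> N" if "f \<in> N" "g \<in> N" for f g
  proof -
    have "convolution K f g [] = f [] \<otimes>\<^bsub>K\<^esub> g []"
      using that by (intro K.convolution_Nil) (auto simp: N_def F_def free_algebra_def)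
    then show ?thesis using that F.m_closed[of f g] by (auto simp: N_def F_def K.free_algebra_simps)
  qed
  have Nzero: "\<zero>\<^bsub>F\<^esub> \<in> N" using F.zero_closed by (auto simp: N_def) (simp add: F_def K.free_algebra_simps)
  \<comment> \<open>As a map to \<open>L\<close>, \<open>p\<close> respects sums and products but
    not units: the unit of \<open>L\<close> is \<open>p U\<close>, that of \<open>F Quot J\<close>
    is the class of the empty word.\<close>
  have p_add: "p (f \<oplus>\<^bsub>F\<^esub> g) = p f \<oplus>\<^bsub>L\<^esub> p g" and p_mult: "p (f \<otimes>\<^bsub>F\<^esub> g) = p f \<otimes>\<^bsub>L\<^esub> p g"
    if "f \<in> carrier F" "g \<in> carrier F" for f g
    using that by (simp_all add: L)
  have p_zero: "p \<zero>\<^bsub>F\<^esub> = \<zero>\<^bsub>L\<^esub>" by (simp add: L)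
  note [simp del] = p.hom_add p.hom_mult p.hom_zero p.hom_finsum
  have p_sum: "(\<Oplus>\<^bsub>F\<^esub>x\<in>A. h x) \<in> N \<and> p (\<Oplus>\<^bsub>F\<^esub>x\<in>A. h x) = (\<Oplus>\<^bsub>L\<^esub>x\<in>A. p (h x))"
    if "finite A" "\<And>x. x \<in> A \<Longrightarrow> h x \<in> N" for A and h :: "'z \<Rightarrow> _"
    using that
  proof (induction A rule: finite_induct)
    case empty
    then show ?case using Nzero p_zero by simp
  next
    case (insert a A)
    then have "(\<Oplus>\<^bsub>F\<^esub>x\<in>insert a A. h x) = h a \<oplus>\<^bsub>F\<^esub> (\<Oplus>\<^bsub>F\<^esub>x\<in>A. h x)"
      using NF by (intro F.finsum_insert) auto
    moreover have "(\<Oplus>\<^bsub>L\<^esub>x\<in>insert a A. p (h x)) = p (h a) \<oplus>\<^bsub>L\<^esub> (\<Oplus>\<^bsub>L\<^esub>x\<in>A. p (h x))"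
      using insert pL by (intro L.finsum_insert) auto
    ultimately show ?case using insert Nadd NF p_add by simp
  qed
  \<comment> \<open>The constant \<open>k\<close> of the unital free algebra. Its class belongs to
    \<open>F Quot J\<close> and in general not to \<open>L\<close>, so products with it are computed
    in the larger ring.\<close>
  define s where "s k = (\<lambda>w :: ('v, 'e) lpa_generator list. if w = [] then k else \<zero>\<^bsub>K\<^esub>)" for k
  have sF: "s k \<in> carrier F" if "k \<in> carrier K" for k
    unfolding s_def F_def using that by (intro K.scaled_word_closed) auto
  have s_l: "s k \<otimes>\<^bsub>F\<^esub> f = k \<odot>\<^bsub>F\<^esub> f" and s_r: "f \<otimes>\<^bsub>F\<^esub> s k = k \<odot>\<^bsub>F\<^esub> f"
    if "k \<in> carrier K" "f \<in> carrier F" for k f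
    using K.free_algebra_scalar[OF that(2)[unfolded F_def] that(1)] by (simp_all add: s_def F_def)
  \<comment> \<open>Scalar multiplication of a coset is a union over its members, all of which
    contribute the same coset.\<close>
  have smult_p: "k \<odot>\<^bsub>L\<^esub> p f = p (s k) \<otimes>\<^bsub>L\<^esub> p f" if k: "k \<in> carrier K" and f: "f \<in> carrier F" for k f
  proof -
    have sub: "p f \<subseteq> carrier F" unfolding p_def using f J.a_subset by (intro F.a_r_coset_subset_G)
    have "p (k \<odot>\<^bsub>F\<^esub> x) = p (k \<odot>\<^bsub>F\<^esub> f)" if x: "x \<in> p f" for x
    proof -
      have xF: "x \<in> carrier F" using sub x by blast
      have "p x = p f"
        using F.a_repr_independence[OF _ f J.a_subgroup, of x] x unfolding p_def by simp
      then have "p (s k) \<otimes>\<^bsub>L\<^esub> p x = p (s k) \<otimes>\<^bsub>L\<^esub> p f" by simp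
      then show ?thesis using xF f sF[OF k] s_l[OF k] by (simp flip: p_mult)
    qed
    moreover have "f \<in> p f" unfolding p_def by (rule J.a_rcos_self[OF f])
    ultimately have "k \<odot>\<^bsub>L\<^esub> p f = p (k \<odot>\<^bsub>F\<^esub> f)" unfolding L by blast
    then show ?thesis using s_l[OF k f] p_mult[OF sF[OF k] f] by simp
  qed
  have UN: "U \<in> N" unfolding U_def using p_sum[of "verts G" ?v] gN by auto
  have one: "\<one>\<^bsub>L\<^esub> = p U" by (simp add: L)
  define i where "i k = k \<odot>\<^bsub>L\<^esub> \<one>\<^bsub>L\<^esub>" for k
  have i: "i k = p (s k) \<otimes>\<^bsub>L\<^esub> \<one>\<^bsub>L\<^esub>" if "k \<in> carrier K" for k
    unfolding i_def one using smult_p[OF that NF[OF UN]] .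
  have pQ: "p (s k) \<in> carrier (F Quot J)" if "k \<in> carrier K" for k using sF[OF that] by simp
  have assoc: "x \<otimes>\<^bsub>L\<^esub> y \<otimes>\<^bsub>L\<^esub> z = x \<otimes>\<^bsub>L\<^esub> (y \<otimes>\<^bsub>L\<^esub> z)"
    if "x \<in> carrier (F Quot J)" "y \<in> carrier (F Quot J)" "z \<in> carrier (F Quot J)" for x y z
    using Q.m_assoc that by (simp add: L)
  have i_mult: "i k \<otimes>\<^bsub>L\<^esub> x = p (s k) \<otimes>\<^bsub>L\<^esub> x" "x \<otimes>\<^bsub>L\<^esub> i k = p (s k) \<otimes>\<^bsub>L\<^esub> x"
    if k: "k \<in> carrier K" and x: "x \<in> carrier L" for k x
  proof -
    show "i k \<otimes>\<^bsub>L\<^esub> x = p (s k) \<otimes>\<^bsub>L\<^esub> x"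
      unfolding i[OF k] using assoc[OF pQ[OF k] LQ LQ, OF L.one_closed x] x by simp
    obtain f where f: "f \<in> N" "x = p f" by (rule LE[OF x])
    have comm: "x \<otimes>\<^bsub>L\<^esub> p (s k) = p (s k) \<otimes>\<^bsub>L\<^esub> x"
      using f NF[OF f(1)] sF[OF k] s_l[OF k] s_r[OF k] by (simp flip: p_mult)
    have "x \<otimes>\<^bsub>L\<^esub> i k = (x \<otimes>\<^bsub>L\<^esub> p (s k)) \<otimes>\<^bsub>L\<^esub> \<one>\<^bsub>L\<^esub>"
      unfolding i[OF k] using assoc[OF LQ[OF x] pQ[OF k] LQ[OF L.one_closed]] by simp
    also have "\<dots> = p (s k) \<otimes>\<^bsub>L\<^esub> (x \<otimes>\<^bsub>L\<^esub> \<one>\<^bsub>L\<^esub>)"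
      unfolding comm using assoc[OF pQ[OF k] LQ[OF x] LQ[OF L.one_closed]] by simp
    finally show "x \<otimes>\<^bsub>L\<^esub> i k = p (s k) \<otimes>\<^bsub>L\<^esub> x" using x by simp
  qed
  have smult_i: "k \<odot>\<^bsub>L\<^esub> x = i k \<otimes>\<^bsub>L\<^esub> x" if k: "k \<in> carrier K" and x: "x \<in> carrier L" for k x
  proof -
    obtain f where "f \<in> N" "x = p f" by (rule LE[OF x])
    then show ?thesis using smult_p[OF k NF] i_mult(1)[OF k x] by simp
  qed
  have sN: "s k \<otimes>\<^bsub>F\<^esub> f \<in> N" if "k \<in> carrier K" "f \<in> N" for k f
    using that F.m_closed[OF sF[OF that(1)] NF[OF that(2)]] s_l[OF that(1) NF[OF that(2)]]
    by (simp add: N_def) (simp add: F_def K.free_algebra_simps)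
  have iL: "i k \<in> carrier L" if "k \<in> carrier K" for k
    unfolding i[OF that] one using pL[OF sN[OF that UN]] p_mult[OF sF[OF that] NF[OF UN]] by simp
  have fam: "leavitt_family L G K i (\<lambda>x. p (?v x)) (\<lambda>a. p (?e a)) (\<lambda>a. p (?g a))"
  proof (intro leavitt_family.intro leavitt_family_axioms.intro L.ring_axioms G.fin_digraph_axioms K.field_axioms)
    show "ring_hom_ring K L i"
    proof (rule ring_hom_ringI[OF K.ring_axioms L.ring_axioms iL])
      fix k l assume k: "k \<in> carrier K" and l: "l \<in> carrier K"
      have "s (k \<oplus>\<^bsub>K\<^esub> l) = s k \<oplus>\<^bsub>F\<^esub> s l"
        using k l by (auto simp: s_def F_def K.free_algebra_simps)
      then show "i (k \<oplus>\<^bsub>K\<^esub> l) = i k \<oplus>\<^bsub>L\<^esub> i l"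
        using k l sF Q.l_distr[OF pQ[OF k] pQ[OF l] LQ[OF L.one_closed]]
        by (simp add: i p_add) (simp add: L)
      have "s (k \<otimes>\<^bsub>K\<^esub> l) = s k \<otimes>\<^bsub>F\<^esub> s l"
        unfolding s_l[OF k sF[OF l]] using k l by (auto simp: s_def F_def K.free_algebra_simps)
      then have "i (k \<otimes>\<^bsub>K\<^esub> l) = p (s k) \<otimes>\<^bsub>L\<^esub> i l"
        using k l sF assoc[OF pQ[OF k] pQ[OF l] LQ[OF L.one_closed]] by (simp add: i p_mult)
      then show "i (k \<otimes>\<^bsub>K\<^esub> l) = i k \<otimes>\<^bsub>L\<^esub> i l" using i_mult(1)[OF k iL[OF l]] by simp
    next
      have "s \<one>\<^bsub>K\<^esub> = \<one>\<^bsub>F\<^esub>" by (simp add: s_def F_def K.free_algebra_simps)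
      then have "p (s \<one>\<^bsub>K\<^esub>) = \<one>\<^bsub>F Quot J\<^esub>" by simp
      then show "i \<one>\<^bsub>K\<^esub> = \<one>\<^bsub>L\<^esub>"
        using Q.l_one[OF LQ[OF L.one_closed]] by (simp add: i) (simp add: L)
    qed
    show "i k \<otimes>\<^bsub>L\<^esub> x = x \<otimes>\<^bsub>L\<^esub> i k" if "k \<in> carrier K" "x \<in> carrier L" for k x
      using i_mult[OF that] by simp
    show "p (?v x) \<in> carrier L" if "x \<in> verts G" for x using that by (intro pL gN)
    show "p (?e a) \<in> carrier L" "p (?g a) \<in> carrier L" if "a \<in> arcs G" for a
      using that by (intro pL gN; simp)+
    note R = lpa_relators_def[of K G, unfolded Let_def, folded F_def]
    show "p (?v x) \<otimes>\<^bsub>L\<^esub> p (?v y) = (if x = y then p (?v x) else \<zero>\<^bsub>L\<^esub>)"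
      if "x \<in> verts G" "y \<in> verts G" for x y
    proof -
      have "p (?v x \<otimes>\<^bsub>F\<^esub> ?v y) = p (if x = y then ?v x else \<zero>\<^bsub>F\<^esub>)"
        using that by (intro eq) (auto simp: R)
      then show ?thesis using that by (auto simp: p_mult p_zero)
    qed
    have ends: "p (?v (tail G a) \<otimes>\<^bsub>F\<^esub> ?e a) = p (?e a)" "p (?e a \<otimes>\<^bsub>F\<^esub> ?v (head G a)) = p (?e a)"
      "p (?v (head G a) \<otimes>\<^bsub>F\<^esub> ?g a) = p (?g a)" "p (?g a \<otimes>\<^bsub>F\<^esub> ?v (tail G a)) = p (?g a)"
      if "a \<in> arcs G" for a
      using that by (intro eq; force simp: R)+
    show ev: "p (?e a) \<otimes>\<^bsub>L\<^esub> p (?v (head G a)) = p (?e a)" if "a \<in> arcs G" for a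
      using ends(2) that by (simp add: p_mult)
    show gv: "p (?g a) \<otimes>\<^bsub>L\<^esub> p (?v (tail G a)) = p (?g a)" if "a \<in> arcs G" for a
      using ends(4) that by (simp add: p_mult)
    show "p (?v (tail G a)) \<otimes>\<^bsub>L\<^esub> p (?e a) = p (?e a)" "p (?v (head G a)) \<otimes>\<^bsub>L\<^esub> p (?g a) = p (?g a)"
      if "a \<in> arcs G" for a
      using ends(1,3) that by (simp_all add: p_mult)
    show "p (?g a) \<otimes>\<^bsub>L\<^esub> p (?e b) = (if a = b then p (?v (head G a)) else \<zero>\<^bsub>L\<^esub>)"
      if "a \<in> arcs G" "b \<in> arcs G" for a b
    proof -
      have "p (?g a \<otimes>\<^bsub>F\<^esub> ?e b) = p (if a = b then ?v (head G a) else \<zero>\<^bsub>F\<^esub>)"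
        using that by (intro eq) (auto simp: R)
      then show ?thesis using that by (auto simp: p_mult p_zero)
    qed
    show "p (?v x) = (\<Oplus>\<^bsub>L\<^esub>a\<in>out_arcs G x. p (?e a) \<otimes>\<^bsub>L\<^esub> p (?g a))"
      if "x \<in> verts G" "out_arcs G x \<noteq> {}" for x
    proof -
      have fin: "finite (out_arcs G x)" by (rule finite_subset[OF _ G.finite_arcs]) (auto simp: out_arcs_def)
      have "p (?v x) = p (\<Oplus>\<^bsub>F\<^esub>a\<in>out_arcs G x. ?e a \<otimes>\<^bsub>F\<^esub> ?g a)"
        using that sumF by (intro eq) (auto simp: R)
      also have "\<dots> = (\<Oplus>\<^bsub>L\<^esub>a\<in>out_arcs G x. p (?e a \<otimes>\<^bsub>F\<^esub> ?g a))"
        using p_sum[OF fin, of "\<lambda>a. ?e a \<otimes>\<^bsub>F\<^esub> ?g a"] gN Nmult by (simp add: out_arcs_def)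
      also have "\<dots> = (\<Oplus>\<^bsub>L\<^esub>a\<in>out_arcs G x. p (?e a) \<otimes>\<^bsub>L\<^esub> p (?g a))"
        using gN pL by (intro L.finsum_cong') (auto simp: p_mult out_arcs_def)
      finally show ?thesis .
    qed
    show "\<one>\<^bsub>L\<^esub> = (\<Oplus>\<^bsub>L\<^esub>x\<in>verts G. p (?v x))"
      unfolding one U_def using p_sum[of "verts G" ?v] gN by simp
    fix W
    assume W0: "\<zero>\<^bsub>L\<^esub> \<in> W" and WV: "\<And>v. v \<in> verts G \<Longrightarrow> p (?v v) \<in> W"
      and Wadd: "\<And>x y. \<lbrakk>x \<in> W; y \<in> W\<rbrakk> \<Longrightarrow> x \<oplus>\<^bsub>L\<^esub> y \<in> W"
      and Wi: "\<And>k x. \<lbrakk>k \<in> carrier K; x \<in> W\<rbrakk> \<Longrightarrow> i k \<otimes>\<^bsub>L\<^esub> x \<in> W"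
      and Wv: "\<And>v x. \<lbrakk>v \<in> verts G; x \<in> W\<rbrakk> \<Longrightarrow> p (?v v) \<otimes>\<^bsub>L\<^esub> x \<in> W"
      and We: "\<And>a x. \<lbrakk>a \<in> arcs G; x \<in> W\<rbrakk> \<Longrightarrow> p (?e a) \<otimes>\<^bsub>L\<^esub> x \<in> W"
      and Wg: "\<And>a x. \<lbrakk>a \<in> arcs G; x \<in> W\<rbrakk> \<Longrightarrow> p (?g a) \<otimes>\<^bsub>L\<^esub> x \<in> W"
    have W1: "p (word K [x]) \<otimes>\<^bsub>L\<^esub> y \<in> W" if "x \<in> lpa_generators G" "y \<in> W" for x y
      using that Wv We Wg by (auto simp: lpa_generators_def)
    \<comment> \<open>An edge is its product with its range vertex, and a ghost edge its product
      with the source vertex of the edge, so left multiplication reaches them from the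
      vertices.\<close>
    have W2: "p (word K [x]) \<in> W" if "x \<in> lpa_generators G" for x
    proof -
      from that consider v where "v \<in> verts G" "x = Vert v" | a where "a \<in> arcs G" "x = Edge a"
        | a where "a \<in> arcs G" "x = Ghost a" by (auto simp: lpa_generators_def)
      then show ?thesis
      proof cases
        case (2 a)
        then show ?thesis using We[OF 2(1) WV[of "head G a"]] ev[OF 2(1)] by simp
      next
        case (3 a)
        then show ?thesis using Wg[OF 3(1) WV[of "tail G a"]] gv[OF 3(1)] by simp
      qed (use WV in simp)
    qed
    have Wword: "p (word K u) \<in> W" if "u \<in> lists (lpa_generators G)" "u \<noteq> []" for u
      using that
    proof (induction u rule: list.induct)
      case (Cons x u)
      have xu: "x \<in> lpa_generators G" "u \<in> lists (lpa_generators G)" using Cons.prems(1) by auto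
      show ?case
      proof (cases "u = []")
        case True
        then show ?thesis using W2[OF xu(1)] by simp
      next
        case False
        have "word K (x # u) = word K [x] \<otimes>\<^bsub>F\<^esub> word K u"
          using K.convolution_words(1)[OF K.one_closed, of "[x]" u]
          by (simp add: F_def K.free_algebra_simps) (simp add: word_def)
        then have "p (word K (x # u)) = p (word K [x]) \<otimes>\<^bsub>L\<^esub> p (word K u)"
          using xu False NF[OF wordN[of "[x]"]] NF[OF wordN[of u]] by (simp add: p_mult)
        then show ?thesis using W1[OF xu(1) Cons.IH[OF xu(2) False]] by simp
      qed
    qed simp
    have "p f \<in> W" if "f \<in> carrier F" "f [] = \<zero>\<^bsub>K\<^esub>" for f
      using that unfolding F_def
    proof (induction f rule: K.free_algebra_nonunital_induct)
      case zero
      then show ?case using W0 p_zero by (simp add: F_def K.free_algebra_simps)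
    next
      case (step u c g)
      have "(\<lambda>w. if w = u then c else \<zero>\<^bsub>K\<^esub>) = s c \<otimes>\<^bsub>F\<^esub> word K u"
        using K.convolution_words(2)[OF step(3), of "[]" u] by (simp add: F_def K.free_algebra_simps s_def)
      moreover have "p (s c \<otimes>\<^bsub>F\<^esub> word K u) = i c \<otimes>\<^bsub>L\<^esub> p (word K u)"
        using i_mult(1)[OF step(3) pL[OF wordN[OF step(1,2)]]] p_mult[OF sF[OF step(3)] NF[OF wordN[OF step(1,2)]]]
        by simp
      ultimately have "p (\<lambda>w. if w = u then c else \<zero>\<^bsub>K\<^esub>) \<in> W" using Wi[OF step(3) Wword[OF step(1,2)]] by simp
      moreover have "(\<lambda>w. if w = u then c else \<zero>\<^bsub>K\<^esub>) \<in> carrier F"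
        unfolding F_def by (rule K.scaled_word_closed[OF step(1,3)])
      ultimately show ?case
        using Wadd step(6) p_add step(4) unfolding F_def by simp
    qed
    then show "carrier L \<subseteq> W" by (auto simp: L N_def)
  qed
  show "leavitt_family (leavitt K G) G K (\<lambda>k. k \<odot>\<^bsub>leavitt K G\<^esub> \<one>\<^bsub>leavitt K G\<^esub>)
      (\<lambda>x. lpa_class K G (word K [Vert x])) (\<lambda>a. lpa_class K G (word K [Edge a]))
      (\<lambda>a. lpa_class K G (word K [Ghost a]))"
    using fam unfolding p i_def[abs_def] L_def .
  show "\<lbrakk>k \<in> carrier K; x \<in> carrier (leavitt K G)\<rbrakk> \<Longrightarrow>
      k \<odot>\<^bsub>leavitt K G\<^esub> x = (k \<odot>\<^bsub>leavitt K G\<^esub> \<one>\<^bsub>leavitt K G\<^esub>) \<otimes>\<^bsub>leavitt K G\<^esub> x"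
    using smult_i unfolding i_def L_def .
qed

section \<open>Passage from a prime ideal of the Leavitt path algebra to its quotient\<close>

lemma carrier_FactRing: "carrier (A Quot P) = (\<lambda>x. P +>\<^bsub>A\<^esub> x) ` carrier A"
  by (auto simp: FactRing_def A_RCOSETS_def')

lemma zero_quotient_algebra: "\<zero>\<^bsub>quotient_algebra A P\<^esub> = P"
  by (simp add: quotient_algebra_def FactRing_def)

lemma surj_quotient_algebra:
  assumes "ring A" "ideal P A"
  shows "surj_ring_hom A (quotient_algebra A P) (\<lambda>x. P +>\<^bsub>A\<^esub> x)"
    and "surj_ring_hom.Ker A (quotient_algebra A P) (\<lambda>x. P +>\<^bsub>A\<^esub> x) = P"
proof -
  interpret A: ring A by fact
  interpret P: ideal P A by fact
  let ?B = "quotient_algebra A P"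
  have B: "carrier ?B = carrier (A Quot P)" "mult ?B = mult (A Quot P)" "one ?B = one (A Quot P)"
    "zero ?B = zero (A Quot P)" "add ?B = add (A Quot P)"
    by (simp_all add: quotient_algebra_def)
  interpret Q: ring "A Quot P" by (rule P.quotient_is_ring)
  have "ring ?B"
  proof (rule ringI)
    show "abelian_group ?B"
    proof (rule abelian_groupI, goal_cases)
      case (6 x)
      then show ?case unfolding B using Q.l_neg Q.a_inv_closed by blast
    qed (simp_all add: B Q.a_ac)
    show "monoid ?B" by (rule monoidI) (simp_all add: B Q.m_assoc)
  qed (simp_all add: B Q.l_distr Q.r_distr)
  interpret h: ring_hom_ring A "A Quot P" "\<lambda>x. P +>\<^bsub>A\<^esub> x" by (rule P.rcos_ring_hom_ring)
  have "(\<lambda>x. P +>\<^bsub>A\<^esub> x) \<in> ring_hom A ?B"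
    using h.homh unfolding ring_hom_def B .
  then have hom: "ring_hom_ring A ?B (\<lambda>x. P +>\<^bsub>A\<^esub> x)"
    by (rule ring_hom_ringI2[OF assms(1) \<open>ring ?B\<close>])
  have im: "(\<lambda>x. P +>\<^bsub>A\<^esub> x) ` carrier A = carrier ?B"
    unfolding B(1) carrier_FactRing by (rule refl)
  show S: "surj_ring_hom A ?B (\<lambda>x. P +>\<^bsub>A\<^esub> x)"
    by (rule surj_ring_hom.intro[OF hom surj_ring_hom_axioms.intro[OF im]])
  note zB = zero_quotient_algebra[of A P]
  have P0: "P +>\<^bsub>A\<^esub> \<zero>\<^bsub>A\<^esub> = P" by (rule A.a_coset_add_zero[OF P.a_subset])
  have "P +>\<^bsub>A\<^esub> x = \<zero>\<^bsub>?B\<^esub> \<longleftrightarrow> x \<in> P" if x: "x \<in> carrier A" for x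
  proof -
    have "x \<ominus>\<^bsub>A\<^esub> \<zero>\<^bsub>A\<^esub> = x" using x by (simp add: A.minus_eq)
    then show ?thesis
      using A.quotient_eq_iff_same_a_r_cos[OF P.ideal_axioms x A.zero_closed] unfolding P0 zB by simp
  qed
  then have "{x \<in> carrier A. P +>\<^bsub>A\<^esub> x = \<zero>\<^bsub>?B\<^esub>} = P" using P.a_subset by blast
  then show "surj_ring_hom.Ker A ?B (\<lambda>x. P +>\<^bsub>A\<^esub> x) = P"
    unfolding surj_ring_hom.Ker_def[OF S] .
qed

theorem theorem1:
  fixes K :: "('k, 'm) ring_scheme" and G :: "('v, 'e) pre_digraph"
  assumes "field K" and "fin_digraph G"
  shows "\<forall>P \<in> Spec (leavitt K G).
           (primitive_ideal (leavitt K G) P \<longleftrightarrow> rational_ideal K (leavitt K G) P) \<and>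
           (rational_ideal K (leavitt K G) P \<longleftrightarrow> locally_closed_prime (leavitt K G) P)"
proof
  fix P assume P: "P \<in> Spec (leavitt K G)"
  define L where "L = leavitt K G"
  define B where "B = quotient_algebra L P"
  define h where "h x = P +>\<^bsub>L\<^esub> x" for x
  have ringL: "ring L" unfolding L_def by (rule field.ring_leavitt[OF assms])
  have idP: "ideal P L" using P by (simp add: L_def Spec_def prime_ideal_def)
  interpret h: surj_ring_hom L B h
    using surj_quotient_algebra(1)[OF ringL idP] unfolding B_def h_def[abs_def] .
  have Ker: "h.Ker = P"
    using surj_quotient_algebra(2)[OF ringL idP] unfolding B_def h_def[abs_def] .
  have "P \<in> Spec L" using P by (simp add: L_def)
  then have KerS: "h.Ker \<in> Spec L" unfolding Ker .
  define i where "i k = k \<odot>\<^bsub>L\<^esub> \<one>\<^bsub>L\<^esub>" for k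
  note fam = leavitt_family_image[OF leavitt_family_leavitt(1)[OF assms, folded L_def, folded i_def] h.surj_ring_hom_axioms]
  interpret B: prime_leavitt_family B G K "h \<circ> i" "h \<circ> (\<lambda>x. lpa_class K G (word K [Vert x]))"
    "h \<circ> (\<lambda>a. lpa_class K G (word K [Edge a]))" "h \<circ> (\<lambda>a. lpa_class K G (word K [Ghost a]))"
    by (intro prime_leavitt_family.intro fam h.prime_ring_image[OF KerS])
  obtain w where w: "w \<in> verts G" "(h \<circ> (\<lambda>x. lpa_class K G (word K [Vert x]))) w \<noteq> \<zero>\<^bsub>B\<^esub>"
    "\<And>u. \<lbrakk>u \<in> verts G; (h \<circ> (\<lambda>x. lpa_class K G (word K [Vert x]))) u \<noteq> \<zero>\<^bsub>B\<^esub>\<rbrakk> \<Longrightarrow> \<exists>p. B.awalk u p w"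
    using B.lower_bound_exists by blast
  interpret B: bottom_vertex B G K "h \<circ> i" "h \<circ> (\<lambda>x. lpa_class K G (word K [Vert x]))"
    "h \<circ> (\<lambda>a. lpa_class K G (word K [Edge a]))" "h \<circ> (\<lambda>a. lpa_class K G (word K [Ghost a]))" w
    using w by unfold_locales
  have iL: "i k \<in> carrier L" if "k \<in> carrier K" for k
    using ring_hom_closed[OF ring_hom_ring.homh[OF leavitt_family.\<iota>_hom[OF leavitt_family_leavitt(1)[OF assms]]] that]
    unfolding i_def L_def .
  have smult: "k \<odot>\<^bsub>B\<^esub> y = (h \<circ> i) k \<otimes>\<^bsub>B\<^esub> y" if k: "k \<in> carrier K" and y: "y \<in> carrier B" for k y
  proof -
    interpret Pid: ideal P L by (rule idP)
    obtain x where x: "x \<in> carrier L" "y = h x" by (rule h.surjE[OF y])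
    \<comment> \<open>Again the scalar multiplication is a union over a coset, and each member
      \<open>z\<close> gives the same value.\<close>
    have "h (k \<odot>\<^bsub>L\<^esub> z) = (h \<circ> i) k \<otimes>\<^bsub>B\<^esub> y" if z: "z \<in> h x" for z
    proof -
      have zL: "z \<in> carrier L"
        using z h.R.a_r_coset_subset_G[OF Pid.a_subset x(1)] unfolding h_def by blast
      have "h z = h x"
        using h.R.a_repr_independence[OF _ x(1) Pid.a_subgroup, of z] z unfolding h_def by simp
      moreover have "k \<odot>\<^bsub>L\<^esub> z = i k \<otimes>\<^bsub>L\<^esub> z"
        using leavitt_family_leavitt(2)[OF assms k] zL unfolding i_def L_def by blast
      ultimately show ?thesis using h.hom_mult[OF iL[OF k] zL] x(2) by simp
    qed
    moreover have "x \<in> h x" unfolding h_def by (rule Pid.a_rcos_self[OF x(1)])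
    ultimately show ?thesis
      unfolding x(2) by (subst B_def) (auto simp: quotient_algebra_def simp flip: h_def)
  qed
  \<comment> \<open>The copy of \<open>K\<close> over which rationality is defined is the image of
    the scalars of the corner, so the ideal is rational exactly if \<open>rational_corner\<close>
    holds for the quotient.\<close>
  have "scalars K B = B.ext_class ` B.scalar_set"
    unfolding scalars_def B.scalar_set_def image_image
    by (intro image_cong refl B.ext_class_scalar B.\<iota>_center smult)
  then have rat: "rational_ideal K L P \<longleftrightarrow> B.rational_corner"
    unfolding rational_ideal_def B.rational_corner_def Let_def B_def[symmetric] by simp
  have "primitive_ideal L P \<longleftrightarrow> B.full"
    using h.primitive_iff B.full_iff(2) unfolding Ker by simp
  moreover have "locally_closed_prime L P \<longleftrightarrow> B.full"
    using h.locally_closed_iff[OF KerS] B.full_iff(3) unfolding Ker by simp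
  ultimately show "(primitive_ideal (leavitt K G) P \<longleftrightarrow> rational_ideal K (leavitt K G) P) \<and>
      (rational_ideal K (leavitt K G) P \<longleftrightarrow> locally_closed_prime (leavitt K G) P)"
    using rat B.full_iff(1) unfolding L_def by simp
qed

end
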